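(* Let $r\ge 3$ be an integer, $d>0$ a real number, $(d_n)_{n\in\mathbb{N}}$ a sequence of reals with $d_n\to d$, and $p=p(n)=d_n/\binom{n-1}{r-1}$. Let $H=H^r(n,p)$, let $C_H$ be its loose core, and let $\hat\rho_*$ and $\eta$ be the constants (depending on $r,d$) defined in the context. Let $Y$ be a random variable with distribution $\mathrm{Po}(d\hat\rho_* )$ and define $$Z := \begin{cases} Y & \text{if } Y\neq 1,\\ \mathrm{Ber}(\eta) & \text{if } Y=1.\end{cases}$$ (That is, conditionally on $Y=1$, $Z$ is a Bernoulli variable with parameter $\eta$.) For $j\ge 1$ let $\mu_j$ be $n^{-1}$ times the number of vertices of $H$ which have degree $j$ in $C_H$, and let $\mu_0$ be $n^{-1}$ times the number of vertices of $H$ which are not in $C_H$. Then there exists a function $\varepsilon=\varepsilon(n)=o(1)$ (not depending on $j$) such that, for any constant $j\in\mathbb{N}=\{0,1,2,\dots\}$, with high probability $$\mathbb{P}(Z=j)-\varepsilon\le \mu_j\le \mathbb{P}(Z=j)+\varepsilon .$$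
   Context: Asymptotics are as $n\to\infty$; "with high probability" means with probability tending to $1$ as $n\to\infty$; "constant" means not depending on $n$. $H^r(n,p)$ is the random $r$-uniform hypergraph on vertex set $[n]$ in which each $r$-subset of $[n]$ is an edge independently with probability $p$. For an $r$-uniform hypergraph $H$, $d_H(v)$ is the number of edges containing $v$, and $\delta(H)$ is the minimum of $d_H(v)$ over vertices $v$. The connection number of an edge $e$ is $\kappa_H(e)=|\{v\in e: d_H(v)\ge 2\}|$, and $\kappa(H)=\min_{e\in E(H)}\kappa_H(e)$. The loose core $C_H$ of $H$ is the maximal (unique) subhypergraph $H'$ of $H$ with $\delta(H')\ge 1$ and $\kappa(H')\ge 2$; if no such subhypergraph exists, the loose core is the empty hypergraph (no vertices, no edges). Let $F(x)=\exp(-d(1-x^{r-1}))$ for $x\ge 0$, and let $\rho_*=\rho_*(r,d)$ be the largest solution $\rho$ of $1-\rho=F(1-\rho)$ (note $\rho=0$ is always a solution). Define $$\hat\rho_* = 1-(1-\rho_* )^{r-1},\qquad \eta = 1-\frac{(r-1)\rho_*(1-\rho_* )^{r-2}}{\hat\rho_*}.$$ A $\mathrm{Po}(0)$ variable is interpreted as deterministically $0$; when $\hat\rho_*=0$ the value of $\eta$ is irrelevant, since then $Y=0$ almost surely. *)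

theory Defs
  imports "HOL-Probability.Probability"
begin

record 'a hypergraph =
  verts :: "'a set"
  edges :: "'a set set"

definition empty_hypergraph :: "'a hypergraph" where
  "empty_hypergraph = \<lparr>verts = {}, edges = {}\<rparr>"

definition subhypergraph :: "'a hypergraph \<Rightarrow> 'a hypergraph \<Rightarrow> bool" where
  "subhypergraph H' H \<longleftrightarrow>
     verts H' \<subseteq> verts H \<and> edges H' \<subseteq> edges H \<and> (\<forall>e\<in>edges H'. e \<subseteq> verts H')"

definition vertex_degree :: "'a hypergraph \<Rightarrow> 'a \<Rightarrow> nat" where
  "vertex_degree H v = card {e \<in> edges H. v \<in> e}"

definition min_degree :: "'a hypergraph \<Rightarrow> nat" where
  "min_degree H = Min (vertex_degree H ` verts H)"

definition edge_connection_number :: "'a hypergraph \<Rightarrow> 'a set \<Rightarrow> nat" where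
  "edge_connection_number H e = card {v \<in> e. vertex_degree H v \<ge> 2}"

definition connection_number :: "'a hypergraph \<Rightarrow> nat" where
  "connection_number H = Min (edge_connection_number H ` edges H)"

text \<open>
  The minima over vertices and over edges are only meaningful for a nonempty index set. Here the
  vertex set is required to be nonempty, and then minimum degree at least 1 forces an edge.
\<close>

definition loose_core_candidate :: "'a hypergraph \<Rightarrow> 'a hypergraph \<Rightarrow> bool" where
  "loose_core_candidate H H' \<longleftrightarrow>
     subhypergraph H' H \<and> verts H' \<noteq> {} \<and> min_degree H' \<ge> 1 \<and> connection_number H' \<ge> 2"

definition is_maximal_candidate :: "'a hypergraph \<Rightarrow> 'a hypergraph \<Rightarrow> bool" where
  "is_maximal_candidate H C \<longleftrightarrow>
     loose_core_candidate H C \<and>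
     (\<forall>H'. loose_core_candidate H H' \<and> subhypergraph C H' \<longrightarrow> H' = C)"

definition loose_core :: "'a hypergraph \<Rightarrow> 'a hypergraph" where
  "loose_core H =
     (if \<exists>H'. loose_core_candidate H H' then THE C. is_maximal_candidate H C
      else empty_hypergraph)"

text \<open>
  The description in \<^const>\<open>loose_core\<close> is proper for finite hypergraphs: the union of two
  candidates is again a candidate.
\<close>

lemma loose_core_candidate_iff:
  assumes "finite (verts H)" "finite (edges H)"
  shows "loose_core_candidate H H' \<longleftrightarrow>
    subhypergraph H' H \<and> verts H' \<noteq> {} \<and> (\<forall>v\<in>verts H'. \<exists>e\<in>edges H'. v \<in> e) \<and>
    (\<forall>e\<in>edges H'. card {v \<in> e. vertex_degree H' v \<ge> 2} \<ge> 2)"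
proof (cases "subhypergraph H' H \<and> verts H' \<noteq> {}")
  case True
  then have fin: "finite (verts H')" "finite (edges H')"
    using assms by (auto simp: subhypergraph_def intro: finite_subset)
  have deg: "vertex_degree H' v \<ge> 1 \<longleftrightarrow> (\<exists>e\<in>edges H'. v \<in> e)" for v
    using fin by (auto simp: vertex_degree_def Suc_le_eq card_gt_0_iff)
  have A: "min_degree H' \<ge> 1 \<longleftrightarrow> (\<forall>v\<in>verts H'. \<exists>e\<in>edges H'. v \<in> e)"
    unfolding min_degree_def using fin True deg by simp
  show ?thesis
  proof (cases "edges H' = {}")
    case False
    then have "connection_number H' \<ge> 2 \<longleftrightarrow>
        (\<forall>e\<in>edges H'. card {v \<in> e. vertex_degree H' v \<ge> 2} \<ge> 2)"
      unfolding connection_number_def edge_connection_number_def using fin by simp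
    with A show ?thesis by (auto simp: loose_core_candidate_def)
  next
    case edges_empty: True
    then show ?thesis using A True by (auto simp: loose_core_candidate_def)
  qed
qed (auto simp: loose_core_candidate_def)

lemma loose_core_candidate_union:
  assumes fin: "finite (verts H)" "finite (edges H)"
    and A: "loose_core_candidate H A" and B: "loose_core_candidate H B"
  shows "loose_core_candidate H \<lparr>verts = verts A \<union> verts B, edges = edges A \<union> edges B\<rparr>"
    (is "loose_core_candidate H ?U")
proof -
  note A' = A[unfolded loose_core_candidate_iff[OF fin]]
  note B' = B[unfolded loose_core_candidate_iff[OF fin]]
  have finU: "finite (edges ?U)" "finite (verts ?U)"
    using A' B' fin finite_subset by (auto simp: subhypergraph_def)
  have "vertex_degree A v \<le> vertex_degree ?U v" "vertex_degree B v \<le> vertex_degree ?U v" for v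
    using finU by (auto simp: vertex_degree_def intro!: card_mono)
  note le = order_trans[OF _ this(1)] order_trans[OF _ this(2)]
  have sub: "{v \<in> e. vertex_degree A v \<ge> 2} \<subseteq> {v \<in> e. vertex_degree ?U v \<ge> 2}"
      "{v \<in> e. vertex_degree B v \<ge> 2} \<subseteq> {v \<in> e. vertex_degree ?U v \<ge> 2}" for e
    using le by blast+
  have conn: "card {v \<in> e. vertex_degree ?U v \<ge> 2} \<ge> 2" if e: "e \<in> edges ?U" for e
  proof -
    have "e \<subseteq> verts ?U" using e A' B' by (auto simp: subhypergraph_def)
    then have "finite {v \<in> e. vertex_degree ?U v \<ge> 2}"
      using finU(2) by (metis (no_types, lifting) finite_subset mem_Collect_eq subsetI)
    note mono = card_mono[OF this sub(1)] card_mono[OF this sub(2)]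
    from e consider "e \<in> edges A" | "e \<in> edges B" by auto
    then show ?thesis
    proof cases
      case 1
      with A' have "2 \<le> card {v \<in> e. vertex_degree A v \<ge> 2}" by blast
      then show ?thesis using mono(1) by (rule order_trans)
    next
      case 2
      with B' have "2 \<le> card {v \<in> e. vertex_degree B v \<ge> 2}" by blast
      then show ?thesis using mono(2) by (rule order_trans)
    qed
  qed
  have sH: "subhypergraph ?U H"
    using A' B' by (auto simp: subhypergraph_def)
  have ne: "verts ?U \<noteq> {}" using A' by simp
  have cov: "\<forall>v\<in>verts ?U. \<exists>e\<in>edges ?U. v \<in> e"
    using A' B' by auto
  show ?thesis
    unfolding loose_core_candidate_iff[OF fin] using sH ne cov conn by blast
qed

lemma ex1_maximal_candidate:
  assumes fin: "finite (verts H)" "finite (edges H)" and ex: "\<exists>H'. loose_core_candidate H H'"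
  shows "\<exists>!C. is_maximal_candidate H C"
proof -
  let ?f = "\<lambda>X::'a hypergraph. card (verts X) + card (edges X)"
  have bound: "?f X < card (verts H) + card (edges H) + 1" if "loose_core_candidate H X" for X
    using that card_mono[OF fin(1), of "verts X"] card_mono[OF fin(2), of "edges X"]
    by (simp add: loose_core_candidate_def subhypergraph_def)
  from ex obtain X where "loose_core_candidate H X" by blast
  then obtain C where C: "loose_core_candidate H C"
    and max: "\<And>X. loose_core_candidate H X \<Longrightarrow> ?f X \<le> ?f C"
    using ex_has_greatest_nat[where P = "loose_core_candidate H" and f = ?f] bound by blast
  have top: "subhypergraph X C" if X: "loose_core_candidate H X" for X
  proof -
    let ?U = "\<lparr>verts = verts C \<union> verts X, edges = edges C \<union> edges X\<rparr>"
    have U: "loose_core_candidate H ?U"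
      using loose_core_candidate_union[OF fin C X] .
    then have finU: "finite (verts ?U)" "finite (edges ?U)"
      using fin by (auto simp: loose_core_candidate_def subhypergraph_def intro: finite_subset)
    have le: "card (verts C) \<le> card (verts ?U)" "card (edges C) \<le> card (edges ?U)"
      using finU by (auto intro!: card_mono)
    with max[OF U] have "card (verts C) = card (verts ?U)" "card (edges C) = card (edges ?U)"
      by linarith+
    moreover have "verts C \<subseteq> verts ?U" "edges C \<subseteq> edges ?U"
      by auto
    ultimately have "verts C = verts ?U" "edges C = edges ?U"
      using finU card_subset_eq by metis+
    then show ?thesis
      using X by (simp add: loose_core_candidate_def subhypergraph_def) blast
  qed
  have antisym: "X = Y" if "subhypergraph X Y" "subhypergraph Y X" for X Y :: "'a hypergraph"
    using that by (auto simp: subhypergraph_def)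
  have "is_maximal_candidate H C"
    unfolding is_maximal_candidate_def using C top antisym by blast
  moreover have "D = C" if "is_maximal_candidate H D" for D
    using that C top unfolding is_maximal_candidate_def by metis
  ultimately show ?thesis by blast
qed

text \<open>
  \<^const>\<open>bernoulli_pmf\<close> truncates its parameter to the unit interval. This only matters where
  the given edge probability is not a probability.
\<close>

definition random_hypergraph :: "nat \<Rightarrow> nat \<Rightarrow> real \<Rightarrow> nat hypergraph pmf" where
  "random_hypergraph r n p =
     (let S = {e. e \<subseteq> {1..n} \<and> card e = r}
      in map_pmf (\<lambda>X. \<lparr>verts = {1..n}, edges = {e \<in> S. X e}\<rparr>)
           (Pi_pmf S False (\<lambda>_. bernoulli_pmf p)))"

definition core_degree_proportion :: "'a hypergraph \<Rightarrow> nat \<Rightarrow> real" where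
  "core_degree_proportion H j =
     (if j = 0 then real (card {v \<in> verts H. v \<notin> verts (loose_core H)})
      else real (card {v \<in> verts H. v \<in> verts (loose_core H) \<and> vertex_degree (loose_core H) v = j}))
     / real (card (verts H))"

definition fixpoint_map :: "nat \<Rightarrow> real \<Rightarrow> real \<Rightarrow> real" where
  "fixpoint_map r d x = exp (- d * (1 - x ^ (r - 1)))"

text \<open>The condition \<open>\<rho> \<le> 1\<close> restricts the argument of \<^const>\<open>fixpoint_map\<close> to nonnegative reals.\<close>

definition rho_star :: "nat \<Rightarrow> real \<Rightarrow> real" where
  "rho_star r d = (GREATEST \<rho>. \<rho> \<le> 1 \<and> 1 - \<rho> = fixpoint_map r d (1 - \<rho>))"

definition rho_hat :: "nat \<Rightarrow> real \<Rightarrow> real" where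
  "rho_hat r d = 1 - (1 - rho_star r d) ^ (r - 1)"

definition eta :: "nat \<Rightarrow> real \<Rightarrow> real" where
  "eta r d = 1 - real (r - 1) * rho_star r d * (1 - rho_star r d) ^ (r - 2) / rho_hat r d"

text \<open>The library's \<^const>\<open>poisson_pmf\<close> is specified for positive rates only.\<close>

definition Po :: "real \<Rightarrow> nat pmf" where
  "Po c = (if c = 0 then return_pmf 0 else poisson_pmf c)"

definition Ber :: "real \<Rightarrow> nat pmf" where
  "Ber q = map_pmf of_bool (bernoulli_pmf q)"

definition Z_pmf :: "nat \<Rightarrow> real \<Rightarrow> nat pmf" where
  "Z_pmf r d =
     bind_pmf (Po (d * rho_hat r d)) (\<lambda>y. if y \<noteq> 1 then return_pmf y else Ber (eta r d))"

end

theory Submission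
  imports Defs
begin

text \<open>
  Call a vertex anchored if it would belong to the core once it lay in one further core edge.
  Removing a vertex \<open>v\<close> leaves a random hypergraph independent of the links of \<open>v\<close>. Unless two of
  these links run into the same small cluster, \<open>v\<close> is anchored iff one of them meets an anchored
  vertex of the rest, and its degree in the core is the number \<open>Y\<close> of such links, except that for
  \<open>Y = 1\<close> the single link must contain two anchored vertices. Everything thus reduces to showing
  that the density of anchored vertices is \<open>\<rho>\<^sub>*\<close>.

  Vertices in large clusters have density at most \<open>\<rho>\<^sub>*\<close>: by concavity of \<open>a \<mapsto> 1 - F (1 - a)\<close>, the
  limit \<open>a\<close> of their mean density as the size threshold grows satisfies \<open>a \<le> 1 - F (1 - a)\<close>. For
  the lower bound, a density \<open>a\<close> of anchored vertices can be improved to \<open>1 - F (1 - a)\<close>, and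
  iterating this leads to \<open>\<rho>\<^sub>*\<close> from any \<open>a > 0\<close>. Such a starting value exists because in the
  supercritical case the large clusters have more edges than a forest on their vertices could
  have, while the edges without anchored vertices form a forest.

  Upper bounds are needed only in mean and lower bounds only with high probability, the latter by
  exposing \<open>k\<close> vertices at once and estimating \<open>k\<close>-th factorial moments.
\<close>

section \<open>Cores of set systems\<close>

text \<open>The local recursion is exact only where deleting v leaves its links in different
  clusters, yet links of v routinely meet again inside the giant cluster. Asymmetry gets around
  this. A link that meets an anchored vertex anchors v, and two such links put v into the core,
  whatever cycles are present. Conversely, a returning link can do harm only at a vertex that is not
  anchored after the deletion of v. Up to a small proportion such vertices lie in bounded clusters,
  and a return to a bounded cluster has probability O(1/n). That small proportion comes from the two
  density bounds: large clusters have density at most \<rho>, anchored vertices at least \<rho>, and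
  those of them in bounded clusters are negligible, so large clusters are almost entirely anchored.

  The lower bound cannot start from nothing, because 0 is a fixed point of the recursion as well and
  no finite tree has an anchored vertex. The edge count supplies this global information. Anchored
  vertices rather than core vertices are iterated because the extra incidence granted in
  \<open>anchored_at\<close> stands for the edge towards the exposed vertex.\<close>

definition edeg :: "'a set set \<Rightarrow> 'a \<Rightarrow> nat" where
  "edeg E v = card {e \<in> E. v \<in> e}"

definition avoid :: "'a set set \<Rightarrow> 'a set \<Rightarrow> 'a set set" where
  "avoid E W = {e \<in> E. e \<inter> W = {}}"

text \<open>An edge through a second vertex of W is discarded. The links at different vertices of W
  then depend on disjoint families of potential edges and are independent. Sets W with several
  vertices occur only in lower bounds, where losing edges is harmless.\<close>

definition links :: "'a set set \<Rightarrow> 'a set \<Rightarrow> 'a \<Rightarrow> 'a set set" where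
  "links E W v = (\<lambda>e. e - {v}) ` {e \<in> E. e \<inter> W = {v}}"

text \<open>The connected component of v. The reflexive closure gives a vertex in no edge the
  cluster consisting of itself.\<close>

definition cluster :: "'a set set \<Rightarrow> 'a \<Rightarrow> 'a set" where
  "cluster E v = {(a, b). \<exists>e\<in>E. a \<in> e \<and> b \<in> e}\<^sup>* `` {v}"

definition core_closed :: "'a set set \<Rightarrow> bool" where
  "core_closed C \<longleftrightarrow> (\<forall>e\<in>C. \<exists>a\<in>e. \<exists>b\<in>e. a \<noteq> b \<and> 2 \<le> edeg C a \<and> 2 \<le> edeg C b)"

text \<open>Degrees only grow in unions, so \<open>core_closed\<close> is preserved by them and this
  is the greatest closed subset. The empty set is \<open>core_closed\<close>, hence a hypergraph
  without a core gives the empty set.\<close>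

definition core_edges :: "'a set set \<Rightarrow> 'a set set" where
  "core_edges E = \<Union>{C. C \<subseteq> E \<and> core_closed C}"

text \<open>
  Such a set \<open>C\<close> satisfies the core condition as soon as \<open>z\<close> lies in one edge outside \<open>C\<close>.
\<close>

definition anchored_at :: "'a \<Rightarrow> 'a set set \<Rightarrow> bool" where
  "anchored_at z C \<longleftrightarrow> z \<in> \<Union>C \<and>
     (\<forall>e\<in>C. \<exists>a\<in>e. \<exists>b\<in>e. a \<noteq> b \<and>
        2 \<le> edeg C a + of_bool (a = z) \<and> 2 \<le> edeg C b + of_bool (b = z))"

definition anchored :: "'a set set \<Rightarrow> 'a set" where
  "anchored E = {z. \<exists>C\<subseteq>E. anchored_at z C}"

text \<open>
  With \<open>D\<close> the edges avoiding a vertex and \<open>L\<close> its links: adding the vertex back closes a cycle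
  through some element of \<open>X\<close>.
\<close>

definition entangled :: "'a set \<Rightarrow> 'a set set \<Rightarrow> 'a set set \<Rightarrow> bool" where
  "entangled X D L \<longleftrightarrow> (\<exists>l\<in>L. \<exists>l'\<in>L. \<exists>u\<in>l \<inter> X. \<exists>w\<in>l'. (l, u) \<noteq> (l', w) \<and> w \<in> cluster D u)"

section \<open>Degrees, links and the greatest core\<close>

lemma two_le_card_iff: "finite A \<Longrightarrow> 2 \<le> card A \<longleftrightarrow> (\<exists>a\<in>A. \<exists>b\<in>A. a \<noteq> b)"
proof -
  assume "finite A"
  have "2 \<le> card A \<longleftrightarrow> \<not> card A \<le> Suc 0" by linarith
  then show ?thesis using card_le_Suc0_iff_eq[OF \<open>finite A\<close>] by blast
qed

lemma edeg_mono: "finite D \<Longrightarrow> C \<subseteq> D \<Longrightarrow> edeg C v \<le> edeg D v"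
  unfolding edeg_def by (intro card_mono) auto

lemma edeg_ge1_iff: "finite C \<Longrightarrow> 1 \<le> edeg C v \<longleftrightarrow> v \<in> \<Union>C"
  unfolding edeg_def by (auto simp: Suc_le_eq card_gt_0_iff)

lemma edeg_insert: "finite C \<Longrightarrow> e \<notin> C \<Longrightarrow> edeg (insert e C) v = edeg C v + of_bool (v \<in> e)"
proof -
  assume "finite C" "e \<notin> C"
  moreover have "{f \<in> insert e C. v \<in> f} = (if v \<in> e then insert e {f \<in> C. v \<in> f} else {f \<in> C. v \<in> f})"
    by auto
  ultimately show ?thesis by (simp add: edeg_def)
qed

lemma finite_avoid [simp]: "finite E \<Longrightarrow> finite (avoid E W)"
  by (simp add: avoid_def)

lemma avoid_subset: "avoid E W \<subseteq> E"
  by (auto simp: avoid_def)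

lemma finite_links [simp]: "finite E \<Longrightarrow> finite (links E W v)"
  by (simp add: links_def)

lemma linksD:
  assumes "l \<in> links E W v"
  shows "insert v l \<in> E" "v \<notin> l" "insert v l \<inter> W = {v}" "l \<inter> W = {}"
proof -
  from assms obtain e where e: "e \<in> E" "e \<inter> W = {v}" "l = e - {v}" by (auto simp: links_def)
  then have "v \<in> e" by blast
  then have "insert v l = e" using e by auto
  with e show "insert v l \<in> E" "v \<notin> l" "insert v l \<inter> W = {v}" "l \<inter> W = {}" by auto
qed

lemma linksI: "e \<in> E \<Longrightarrow> e \<inter> W = {v} \<Longrightarrow> e - {v} \<in> links E W v"
  by (auto simp: links_def)

lemma core_edges_subset: "core_edges E \<subseteq> E"
  by (auto simp: core_edges_def)

lemma core_edges_mono: "E \<subseteq> F \<Longrightarrow> core_edges E \<subseteq> core_edges F"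
  by (auto simp: core_edges_def)

lemma core_edges_greatest: "C \<subseteq> E \<Longrightarrow> core_closed C \<Longrightarrow> C \<subseteq> core_edges E"
  by (auto simp: core_edges_def)

lemma core_edges_closed:
  assumes "finite E"
  shows "core_closed (core_edges E)"
  unfolding core_closed_def
proof
  fix e assume "e \<in> core_edges E"
  then obtain C where C: "C \<subseteq> E" "core_closed C" "e \<in> C"
    by (auto simp: core_edges_def)
  have "finite (core_edges E)" "C \<subseteq> core_edges E"
    using finite_subset[OF core_edges_subset assms] core_edges_greatest[OF C(1,2)] by auto
  then have "edeg C x \<le> edeg (core_edges E) x" for x
    using edeg_mono by metis
  with C show "\<exists>a\<in>e. \<exists>b\<in>e. a \<noteq> b \<and> 2 \<le> edeg (core_edges E) a \<and> 2 \<le> edeg (core_edges E) b"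
    unfolding core_closed_def by (meson order_trans)
qed

section \<open>Sufficient conditions for anchored vertices and core edges\<close>

lemma anchored_subset: "anchored E \<subseteq> \<Union>E"
  by (auto simp: anchored_def anchored_at_def)

lemma core_subset_anchored:
  assumes "finite E"
  shows "\<Union>(core_edges E) \<subseteq> anchored E"
proof
  fix z assume "z \<in> \<Union>(core_edges E)"
  then have "anchored_at z (core_edges E)"
    using core_edges_closed[OF assms] unfolding anchored_at_def core_closed_def
    by (meson trans_le_add1)
  then show "z \<in> anchored E"
    using core_edges_subset by (auto simp: anchored_def)
qed

text \<open>The edge e supplies the incidence that \<open>anchored_at\<close> grants to u for free,
  so inside D the edges of C satisfy the genuine core condition.\<close>

lemma anchored_at_extend:
  assumes "finite D" "C \<subseteq> D" "anchored_at u C" "e \<in> D" "e \<notin> C" "u \<in> e"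
  shows "2 \<le> edeg D u"
    and "f \<in> C \<Longrightarrow> \<exists>a\<in>f. \<exists>b\<in>f. a \<noteq> b \<and> 2 \<le> edeg D a \<and> 2 \<le> edeg D b"
proof -
  have fin: "finite C" using assms finite_subset by blast
  have le: "edeg C x + of_bool (x = u) \<le> edeg D x" for x
  proof -
    have "edeg C x + of_bool (x = u) \<le> edeg (insert e C) x"
      using edeg_insert[OF fin assms(5)] assms(6) by simp
    also have "\<dots> \<le> edeg D x"
      using assms by (intro edeg_mono) auto
    finally show ?thesis .
  qed
  have "1 \<le> edeg C u"
    using assms(3) edeg_ge1_iff[OF fin] by (auto simp: anchored_at_def)
  with le[of u] show "2 \<le> edeg D u" by simp
  show "\<exists>a\<in>f. \<exists>b\<in>f. a \<noteq> b \<and> 2 \<le> edeg D a \<and> 2 \<le> edeg D b" if "f \<in> C"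
    using assms(3) that le unfolding anchored_at_def by (meson order_trans)
qed

lemma anchored_avoidE:
  assumes "u \<in> anchored (avoid E W)" "v \<in> e \<inter> W"
  obtains C where "C \<subseteq> E" "anchored_at u C" "e \<notin> C"
  using assms by (auto simp: anchored_def avoid_def)

text \<open>In \<open>insert e C\<close> the edge e completes the degree of u, while v has degree at
  least one and receives the free incidence in its turn. Thus u and v are the two witnesses for e.
  Deleting W ensures that e was not already used in C.\<close>

lemma anchored_step:
  assumes fin: "finite E" and e: "e \<in> E" "v \<in> e \<inter> W" "u \<in> e" "u \<noteq> v"
    and u: "u \<in> anchored (avoid E W)"
  shows "v \<in> anchored E"
proof -
  obtain C where C: "C \<subseteq> E" "anchored_at u C" "e \<notin> C"
    using anchored_avoidE[OF u e(2)] .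
  have finD: "finite (insert e C)" using fin C finite_subset by auto
  note ext = anchored_at_extend[OF finD subset_insertI C(2) insertI1 C(3) e(3)]
  have "1 \<le> edeg (insert e C) v"
    using edeg_ge1_iff[OF finD] e by auto
  then have v2: "2 \<le> edeg (insert e C) v + of_bool (v = v)" by simp
  have "anchored_at v (insert e C)"
    unfolding anchored_at_def
  proof (intro conjI ballI)
    show "v \<in> \<Union>(insert e C)" using e by auto
    fix f assume "f \<in> insert e C"
    then consider "f = e" | "f \<in> C" by auto
    then show "\<exists>a\<in>f. \<exists>b\<in>f. a \<noteq> b \<and> 2 \<le> edeg (insert e C) a + of_bool (a = v)
        \<and> 2 \<le> edeg (insert e C) b + of_bool (b = v)"
    proof cases
      case 1
      show ?thesis
        unfolding 1 by (rule bexI[of _ u], rule bexI[of _ v]) (use e v2 ext(1) in auto)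
    next
      case 2
      from ext(2)[OF 2] show ?thesis by (meson trans_le_add1)
    qed
  qed
  with C e show ?thesis unfolding anchored_def by blast
qed

text \<open>The vertex v has degree two through e and f and is the common second witness of both
  edges. The sets C and B may overlap, and u = w is allowed, because degrees in the union only
  increase; hence no tree-likeness enters the lower bounds.\<close>

lemma core_edge_if_two_hits:
  assumes fin: "finite E" and e: "e \<in> E" "v \<in> e \<inter> W" "u \<in> e" "u \<noteq> v"
    and f: "f \<in> E" "v \<in> f \<inter> W" "w \<in> f" "w \<noteq> v" and "e \<noteq> f"
    and u: "u \<in> anchored (avoid E W)" and w: "w \<in> anchored (avoid E W)"
  shows "e \<in> core_edges E"
proof -
  obtain C where C: "C \<subseteq> E" "anchored_at u C" "e \<notin> C"
    using anchored_avoidE[OF u e(2)] .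
  obtain B where B: "B \<subseteq> E" "anchored_at w B" "f \<notin> B"
    using anchored_avoidE[OF w f(2)] .
  define D where "D = insert e (insert f (C \<union> B))"
  have D: "D \<subseteq> E" using C B e f by (auto simp: D_def)
  have finD: "finite D" using fin D finite_subset by auto
  have "C \<subseteq> D" "B \<subseteq> D" "e \<in> D" "f \<in> D" by (auto simp: D_def)
  note extC = anchored_at_extend[OF finD \<open>C \<subseteq> D\<close> C(2) \<open>e \<in> D\<close> C(3) e(3)]
  note extB = anchored_at_extend[OF finD \<open>B \<subseteq> D\<close> B(2) \<open>f \<in> D\<close> B(3) f(3)]
  have "card {e, f} \<le> edeg D v"
    unfolding edeg_def using e f finD by (intro card_mono) (auto simp: D_def)
  then have v: "2 \<le> edeg D v" using \<open>e \<noteq> f\<close> by simp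
  have "core_closed D"
    unfolding core_closed_def
  proof
    fix g assume "g \<in> D"
    then consider "g = e" | "g = f" | "g \<in> C" | "g \<in> B" by (auto simp: D_def)
    then show "\<exists>a\<in>g. \<exists>b\<in>g. a \<noteq> b \<and> 2 \<le> edeg D a \<and> 2 \<le> edeg D b"
    proof cases
      case 1
      then show ?thesis using e v extC(1) by blast
    next
      case 2
      then show ?thesis using f v extB(1) by blast
    next
      case 3
      then show ?thesis using extC(2) by blast
    next
      case 4
      then show ?thesis using extB(2) by blast
    qed
  qed
  with D show ?thesis using core_edges_greatest \<open>e \<in> D\<close> by blast
qed

text \<open>Here both witnesses of e lie outside v, so v may have degree one in the core. This is
  the case Y = 1 in which Z equals 1.\<close>

lemma core_edge_if_double_hit:
  assumes fin: "finite E" and e: "e \<in> E" "v \<in> e \<inter> W" "u \<in> e" "w \<in> e" and "u \<noteq> w"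
    and u: "u \<in> anchored (avoid E W)" and w: "w \<in> anchored (avoid E W)"
  shows "e \<in> core_edges E"
proof -
  obtain C where C: "C \<subseteq> E" "anchored_at u C" "e \<notin> C"
    using anchored_avoidE[OF u e(2)] .
  obtain B where B: "B \<subseteq> E" "anchored_at w B" "e \<notin> B"
    using anchored_avoidE[OF w e(2)] .
  define D where "D = insert e (C \<union> B)"
  have D: "D \<subseteq> E" using C B e by (auto simp: D_def)
  have finD: "finite D" using fin D finite_subset by auto
  have "C \<subseteq> D" "B \<subseteq> D" "e \<in> D" by (auto simp: D_def)
  note extC = anchored_at_extend[OF finD \<open>C \<subseteq> D\<close> C(2) \<open>e \<in> D\<close> C(3) e(3)]
  note extB = anchored_at_extend[OF finD \<open>B \<subseteq> D\<close> B(2) \<open>e \<in> D\<close> B(3) e(4)]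
  have "core_closed D"
    unfolding core_closed_def
  proof
    fix g assume "g \<in> D"
    then consider "g = e" | "g \<in> C" | "g \<in> B" by (auto simp: D_def)
    then show "\<exists>a\<in>g. \<exists>b\<in>g. a \<noteq> b \<and> 2 \<le> edeg D a \<and> 2 \<le> edeg D b"
    proof cases
      case 1
      then show ?thesis using e \<open>u \<noteq> w\<close> extC(1) extB(1) by blast
    next
      case 2
      then show ?thesis using extC(2) by blast
    next
      case 3
      then show ?thesis using extB(2) by blast
    qed
  qed
  with D show ?thesis using core_edges_greatest \<open>e \<in> D\<close> by blast
qed

lemma links_hit_anchored:
  assumes "finite E" "l \<in> links E W v" "l \<inter> anchored (avoid E W) \<noteq> {}"
  shows "v \<in> anchored E"
proof -
  note l = linksD[OF assms(2)]
  from assms(3) obtain u where "u \<in> l" "u \<in> anchored (avoid E W)" by auto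
  then show ?thesis using anchored_step[OF assms(1) l(1), of v W u] l by auto
qed

text \<open>Every hit link has a different hit link as partner, so all of them become core edges. A
  single hit link has no partner, which is why Z differs from Y only at Y = 1.\<close>

lemma edeg_core_ge:
  fixes E :: "'a set set"
  assumes fin: "finite E"
    and two: "2 \<le> card {l \<in> links E W v. l \<inter> anchored (avoid E W) \<noteq> {}}" 
  shows "card {l \<in> links E W v. l \<inter> anchored (avoid E W) \<noteq> {}} \<le> edeg (core_edges E) v"
proof -
  let ?L = "{l \<in> links E W v. l \<inter> anchored (avoid E W) \<noteq> {}}"
  have core: "insert v l \<in> core_edges E" if l: "l \<in> ?L" for l
  proof -
    have "finite ?L" using fin by auto
    with two l obtain k where k: "k \<in> ?L" "k \<noteq> l"
      using two_le_card_iff[OF \<open>finite ?L\<close>] by metis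
    have ll: "l \<in> links E W v" "k \<in> links E W v" using l k by auto
    note L = linksD[OF ll(1)] and K = linksD[OF ll(2)]
    from l obtain u where u: "u \<in> l" "u \<in> anchored (avoid E W)" by auto
    from k obtain w where w: "w \<in> k" "w \<in> anchored (avoid E W)" by auto
    have "insert v l \<noteq> insert v k" using k L(2) K(2) by (auto simp: insert_ident)
    then show ?thesis
      using core_edge_if_two_hits[OF fin L(1), of v W u "insert v k" w] K L u w by auto
  qed
  have "inj_on (insert v) ?L"
    by (rule inj_onI) (metis (no_types, lifting) insert_ident linksD(2) mem_Collect_eq)
  then have "card ?L = card (insert v ` ?L)" by (simp add: card_image)
  also have "\<dots> \<le> edeg (core_edges E) v"
    unfolding edeg_def
    using core finite_subset[OF core_edges_subset fin] by (intro card_mono) auto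
  finally show ?thesis .
qed

lemma edeg_core_ge1:
  assumes fin: "finite E" and l: "l \<in> links E W v" "finite l" "2 \<le> card (l \<inter> anchored (avoid E W))"
  shows "1 \<le> edeg (core_edges E) v"
proof -
  note L = linksD[OF l(1)]
  obtain u w where "u \<in> l" "w \<in> l" "u \<noteq> w" "u \<in> anchored (avoid E W)" "w \<in> anchored (avoid E W)"
    using l(2,3) two_le_card_iff[of "l \<inter> anchored (avoid E W)"] by auto
  then have "insert v l \<in> core_edges E"
    using core_edge_if_double_hit[OF fin L(1), of v W u w] L by auto
  then show ?thesis
    using edeg_ge1_iff[OF finite_subset[OF core_edges_subset fin]] by blast
qed

section \<open>Clusters and the deletion of a vertex\<close>

lemma cluster_refl [simp]: "v \<in> cluster E v"
  by (auto simp: cluster_def)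

lemma cluster_step: "b \<in> cluster E v \<Longrightarrow> e \<in> E \<Longrightarrow> b \<in> e \<Longrightarrow> c \<in> e \<Longrightarrow> c \<in> cluster E v"
  unfolding cluster_def by (auto intro: rtrancl_into_rtrancl)

lemma cluster_induct [consumes 1, case_names refl step]:
  assumes "b \<in> cluster E v" "P v"
    and "\<And>b c e. b \<in> cluster E v \<Longrightarrow> P b \<Longrightarrow> e \<in> E \<Longrightarrow> b \<in> e \<Longrightarrow> c \<in> e \<Longrightarrow> P c"
  shows "P b"
proof -
  from assms(1) have "(v, b) \<in> {(a, b). \<exists>e\<in>E. a \<in> e \<and> b \<in> e}\<^sup>*" by (simp add: cluster_def)
  then show ?thesis
    by (induction rule: rtrancl_induct) (use assms(2,3) in \<open>auto simp: cluster_def\<close>)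
qed

lemma cluster_subset: "cluster E v \<subseteq> insert v (\<Union>E)"
proof
  fix b assume "b \<in> cluster E v"
  then show "b \<in> insert v (\<Union>E)" by (induction rule: cluster_induct) auto
qed

lemma finite_cluster: "finite (\<Union>E) \<Longrightarrow> finite (cluster E v)"
  using cluster_subset by (metis finite.insertI finite_subset)

lemma cluster_sym: "b \<in> cluster E v \<Longrightarrow> v \<in> cluster E b"
proof -
  assume "b \<in> cluster E v"
  moreover have "sym ({(a, b). \<exists>e\<in>E. a \<in> e \<and> b \<in> e}\<^sup>*)"
    by (intro sym_rtrancl) (auto simp: sym_def)
  ultimately show ?thesis by (auto simp: cluster_def dest: symD)
qed

lemma cluster_trans: "b \<in> cluster E v \<Longrightarrow> c \<in> cluster E b \<Longrightarrow> c \<in> cluster E v"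
  by (auto simp: cluster_def)

lemma cluster_eq: "b \<in> cluster E v \<Longrightarrow> cluster E b = cluster E v"
  using cluster_sym cluster_trans by (metis subsetI subset_antisym)

lemma cluster_mono: "D \<subseteq> E \<Longrightarrow> cluster D v \<subseteq> cluster E v"
  unfolding cluster_def by (intro Image_mono rtrancl_mono) auto

text \<open>The cluster of u loses at least v. This strictness drives the inductions on the size of
  clusters.\<close>

lemma card_cluster_avoid_less:
  assumes fin: "finite (\<Union>E)" and e: "e \<in> E" "v \<in> e \<inter> W" "u \<in> e" "u \<noteq> v"
  shows "card (cluster (avoid E W) u) < card (cluster E v)"
proof (rule psubset_card_mono)
  show "finite (cluster E v)" using fin by (rule finite_cluster)
  have "cluster (avoid E W) u \<subseteq> insert u (\<Union>(avoid E W))" by (rule cluster_subset)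
  then have "v \<notin> cluster (avoid E W) u" using e by (auto simp: avoid_def)
  moreover have "cluster E u = cluster E v" using cluster_step[OF cluster_refl e(1)] e by (intro cluster_eq) auto
  then have "cluster (avoid E W) u \<subseteq> cluster E v" using cluster_mono[OF avoid_subset] by metis
  ultimately show "cluster (avoid E W) u \<subset> cluster E v" using cluster_refl[of v E] by auto
qed

lemma cluster_subset_links:
  "cluster E v \<subseteq> insert v (\<Union>l\<in>links E {v} v. \<Union>u\<in>l. cluster (avoid E {v}) u)" (is "_ \<subseteq> ?R")
proof
  fix b assume "b \<in> cluster E v"
  then show "b \<in> ?R"
  proof (induction rule: cluster_induct)
    case (step b c e)
    show ?case
    proof (cases "c = v")
      case cv: False
      show ?thesis
      proof (cases "v \<in> e")
        case True
        then have "e - {v} \<in> links E {v} v" using step by (intro linksI) auto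
        moreover have "c \<in> e - {v}" using step cv by auto
        ultimately show ?thesis using cluster_refl[of c "avoid E {v}"] by blast
      next
        case False
        then have "b \<noteq> v" using step by auto
        then obtain l u where "l \<in> links E {v} v" "u \<in> l" "b \<in> cluster (avoid E {v}) u"
          using step by auto
        moreover have "c \<in> cluster (avoid E {v}) u"
          using calculation(3) by (rule cluster_step[where e = e]) (use step False in \<open>auto simp: avoid_def\<close>)
        ultimately show ?thesis by blast
      qed
    qed simp
  qed simp
qed

lemma card_cluster_le_links:
  assumes fin: "finite E" and m: "\<And>l. l \<in> links E {v} v \<Longrightarrow> finite l \<and> card l = m"
    and K: "\<And>l u. l \<in> links E {v} v \<Longrightarrow> u \<in> l \<Longrightarrow> card (cluster (avoid E {v}) u) \<le> K"
  shows "card (cluster E v) \<le> 1 + card (links E {v} v) * (m * K)"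
proof (cases "finite (\<Union>l\<in>links E {v} v. \<Union>u\<in>l. cluster (avoid E {v}) u)")
  case True
  let ?U = "\<lambda>l. \<Union>u\<in>l. cluster (avoid E {v}) u"
  have "card (cluster E v) \<le> card (insert v (\<Union>l\<in>links E {v} v. ?U l))"
    using True by (intro card_mono cluster_subset_links) auto
  also have "\<dots> \<le> 1 + card (\<Union>l\<in>links E {v} v. ?U l)"
    using True by (simp add: card_insert_if)
  also have "card (\<Union>l\<in>links E {v} v. ?U l) \<le> (\<Sum>l\<in>links E {v} v. card (?U l))"
    using fin by (intro card_UN_le) auto
  also have "\<dots> \<le> (\<Sum>l\<in>links E {v} v. m * K)"
  proof (intro sum_mono)
    fix l assume l: "l \<in> links E {v} v"
    have "card (?U l) \<le> (\<Sum>u\<in>l. card (cluster (avoid E {v}) u))"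
      using m[OF l] by (intro card_UN_le) auto
    also have "\<dots> \<le> (\<Sum>u\<in>l. K)" using K[OF l] by (intro sum_mono) auto
    finally show "card (?U l) \<le> m * K" using m[OF l] by simp
  qed
  finally show ?thesis by simp
next
  case False
  \<comment> \<open>An infinite union forces an infinite cluster, whose \<open>card\<close> is 0,
    and the bound is trivial.\<close>
  then have "infinite (cluster E v)"
  proof (rule contrapos_nn)
    assume "finite (cluster E v)"
    moreover have "(\<Union>l\<in>links E {v} v. \<Union>u\<in>l. cluster (avoid E {v}) u) \<subseteq> cluster E v"
    proof safe
      fix l u x assume l: "l \<in> links E {v} v" "u \<in> l" "x \<in> cluster (avoid E {v}) u"
      have "u \<in> cluster E v" using linksD[OF l(1)] l(2) by (intro cluster_step[OF cluster_refl, of "insert v l"]) auto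
      moreover have "x \<in> cluster E u" using l(3) cluster_mono[OF avoid_subset, of E "{v}" u] by blast
      ultimately show "x \<in> cluster E v" by (rule cluster_trans)
    qed
    ultimately show "finite (\<Union>l\<in>links E {v} v. \<Union>u\<in>l. cluster (avoid E {v}) u)"
      by (rule rev_finite_subset)
  qed
  then show ?thesis by simp
qed

section \<open>Necessary conditions in the absence of entanglement\<close>

text \<open>
  If no second incidence at \<open>v\<close> leads into the cluster of \<open>u\<close> in \<open>avoid E {v}\<close>, then that
  cluster loses only \<open>e\<close> when \<open>v\<close> is removed, and the edges of \<open>C\<close> inside it anchor \<open>u\<close>.
\<close>

lemma anchored_or_second_incidence:
  assumes fin: "finite E" and C: "C \<subseteq> E"
    and cl: "\<And>f. f \<in> C \<Longrightarrow> v \<notin> f \<Longrightarrow> \<exists>a\<in>f. \<exists>b\<in>f. a \<noteq> b \<and> 2 \<le> edeg C a \<and> 2 \<le> edeg C b"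
    and e: "e \<in> C" "v \<in> e" "u \<in> e" "u \<noteq> v" and deg: "2 \<le> edeg C u"
  shows "u \<in> anchored (avoid E {v}) \<or>
    (\<exists>f\<in>E. \<exists>w\<in>f. v \<in> f \<and> w \<noteq> v \<and> (f, w) \<noteq> (e, u) \<and> w \<in> cluster (avoid E {v}) u)"
proof (rule disjCI)
  assume "\<not> (\<exists>f\<in>E. \<exists>w\<in>f. v \<in> f \<and> w \<noteq> v \<and> (f, w) \<noteq> (e, u) \<and> w \<in> cluster (avoid E {v}) u)"
  then have only: "f = e \<and> w = u" if "f \<in> E" "w \<in> f" "v \<in> f" "w \<noteq> v" "w \<in> cluster (avoid E {v}) u" for f w
    using that by blast
  \<comment> \<open>The edges of C lying in the component of u after the deletion of v; they will be
    the set that anchors u.\<close>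
  define D where "D = {f \<in> C. v \<notin> f \<and> f \<inter> cluster (avoid E {v}) u \<noteq> {}}"
  have finC: "finite C" using C fin finite_subset by blast
  have finD: "finite D" using finC by (simp add: D_def)
  have DE: "D \<subseteq> avoid E {v}" using C by (auto simp: D_def avoid_def)
  have inC: "x \<in> cluster (avoid E {v}) u" if "f \<in> D" "x \<in> f" for f x
    using that DE cluster_step[of _ "avoid E {v}" u f x] by (auto simp: D_def)
  have "\<not> {f \<in> C. u \<in> f} \<subseteq> {e}"
  proof
    assume "{f \<in> C. u \<in> f} \<subseteq> {e}"
    then have "edeg C u \<le> card {e}" unfolding edeg_def by (intro card_mono) auto
    with deg show False by simp
  qed
  then obtain f where f: "f \<in> C" "u \<in> f" "f \<noteq> e" by auto
  have "v \<notin> f" using only[of f u] f C e by auto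
  then have "f \<in> D" unfolding D_def using f(1,2) cluster_refl[of u "avoid E {v}"] by blast
  then have uD: "u \<in> \<Union>D" using f(2) by blast
  \<comment> \<open>An edge of C at a that is missing from D must contain v. By \<open>only\<close>
    it is then e and a = u, and this lost incidence is the one that anchoring at u gives
    back.\<close>
  have le: "edeg C a \<le> edeg D a + of_bool (a = u)" if "f \<in> D" "a \<in> f" for f a
  proof -
    have a: "a \<in> cluster (avoid E {v}) u" "a \<noteq> v" using inC that by (auto simp: D_def)
    have "{g \<in> C. a \<in> g} \<subseteq> {g \<in> D. a \<in> g} \<union> (if a = u then {e} else {})"
      using only[of _ a] a C by (auto simp: D_def)
    then have "edeg C a \<le> card ({g \<in> D. a \<in> g} \<union> (if a = u then {e} else {}))"
      unfolding edeg_def using finD by (intro card_mono) auto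
    also have "\<dots> \<le> card {g \<in> D. a \<in> g} + card (if a = u then {e} else {})"
      by (rule card_Un_le)
    also have "\<dots> = edeg D a + of_bool (a = u)" by (simp add: edeg_def)
    finally show ?thesis .
  qed
  have "anchored_at u D"
    unfolding anchored_at_def
  proof (intro conjI ballI uD)
    fix f assume f: "f \<in> D"
    then obtain a b where "a \<in> f" "b \<in> f" "a \<noteq> b" "2 \<le> edeg C a" "2 \<le> edeg C b"
      using cl[of f] by (auto simp: D_def)
    then show "\<exists>a\<in>f. \<exists>b\<in>f. a \<noteq> b \<and> 2 \<le> edeg D a + of_bool (a = u) \<and> 2 \<le> edeg D b + of_bool (b = u)"
      using le[OF f] by (meson order_trans)
  qed
  with DE show "u \<in> anchored (avoid E {v})" by (auto simp: anchored_def)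
qed

text \<open>Removing v is injective on the edges through v, so two distinct incidences at v become
  two distinct pairs of a link and one of its elements, as \<open>entangled\<close>
  requires.\<close>

lemma anchored_or_entangled:
  assumes fin: "finite E" and C: "C \<subseteq> E"
    and cl: "\<And>f. f \<in> C \<Longrightarrow> v \<notin> f \<Longrightarrow> \<exists>a\<in>f. \<exists>b\<in>f. a \<noteq> b \<and> 2 \<le> edeg C a \<and> 2 \<le> edeg C b"
    and e: "e \<in> C" "v \<in> e" "u \<in> e" "u \<noteq> v" and deg: "2 \<le> edeg C u"
    and not: "\<not> entangled X (avoid E {v}) (links E {v} v)" and X: "u \<in> X"
  shows "u \<in> anchored (avoid E {v})"
proof (rule ccontr)
  assume "\<not> ?thesis"
  with anchored_or_second_incidence[OF fin C cl e deg]
  obtain f w where f: "f \<in> E" "w \<in> f" "v \<in> f" "w \<noteq> v" "(f, w) \<noteq> (e, u)" "w \<in> cluster (avoid E {v}) u"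
    by blast
  have m: "f - {v} \<in> links E {v} v" "e - {v} \<in> links E {v} v"
    using f(1,3) e(1,2) C by (auto intro: linksI)
  have "insert v (e - {v}) = e" "insert v (f - {v}) = f" using f(3) e(2) by auto
  then have "(e - {v}, u) \<noteq> (f - {v}, w)" using f(5) by (metis prod.inject)
  moreover have "u \<in> (e - {v}) \<inter> X" "w \<in> f - {v}" using f(2,4) e(3,4) X by simp_all
  ultimately have "entangled X (avoid E {v}) (links E {v} v)"
    unfolding entangled_def using m f(6) by (meson bexI)
  with not show False by contradiction
qed

text \<open>The free incidence is available at v only. An edge through v therefore has a second
  witness whose degree is genuinely two, and an edge missing v has two of them.\<close>

lemma anchored_rootE:
  assumes "v \<in> anchored E"
  obtains C e u where "C \<subseteq> E" "e \<in> C" "v \<in> e" "u \<in> e" "u \<noteq> v" "2 \<le> edeg C u"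
    "\<forall>f\<in>C. v \<notin> f \<longrightarrow> (\<exists>a\<in>f. \<exists>b\<in>f. a \<noteq> b \<and> 2 \<le> edeg C a \<and> 2 \<le> edeg C b)"
proof -
  from assms obtain C where C: "C \<subseteq> E" "anchored_at v C" by (auto simp: anchored_def)
  then obtain e where e: "e \<in> C" "v \<in> e" by (auto simp: anchored_at_def)
  obtain a b where ab: "a \<in> e" "b \<in> e" "a \<noteq> b" "2 \<le> edeg C a + of_bool (a = v)" "2 \<le> edeg C b + of_bool (b = v)"
    using C e unfolding anchored_at_def by blast
  then obtain u where u: "u \<in> e" "u \<noteq> v" "2 \<le> edeg C u"
    by (cases "a = v") auto
  have cl: "\<exists>a\<in>f. \<exists>b\<in>f. a \<noteq> b \<and> 2 \<le> edeg C a \<and> 2 \<le> edeg C b" if f: "f \<in> C" "v \<notin> f" for f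
  proof -
    obtain a b where "a \<in> f" "b \<in> f" "a \<noteq> b" "2 \<le> edeg C a + of_bool (a = v)" "2 \<le> edeg C b + of_bool (b = v)"
      using C f unfolding anchored_at_def by blast
    moreover from this f have "a \<noteq> v" "b \<noteq> v" by auto
    ultimately show ?thesis by auto
  qed
  show thesis by (rule that[OF C(1) e u]) (use cl in blast)
qed

lemma anchored_hits_or_entangled:
  assumes fin: "finite E" and v: "v \<in> anchored E"
    and X: "\<And>l u. l \<in> links E {v} v \<Longrightarrow> u \<in> l \<Longrightarrow> u \<in> X"
    and not: "\<not> entangled X (avoid E {v}) (links E {v} v)"
  shows "\<exists>l\<in>links E {v} v. l \<inter> (anchored (avoid E {v}) \<inter> X) \<noteq> {}"
proof -
  from v obtain C e u where *: "C \<subseteq> E" "e \<in> C" "v \<in> e" "u \<in> e" "u \<noteq> v" "2 \<le> edeg C u"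
    "\<forall>f\<in>C. v \<notin> f \<longrightarrow> (\<exists>a\<in>f. \<exists>b\<in>f. a \<noteq> b \<and> 2 \<le> edeg C a \<and> 2 \<le> edeg C b)"
    by (rule anchored_rootE)
  have l: "e - {v} \<in> links E {v} v" "u \<in> e - {v}" using * by (auto intro: linksI)
  have "u \<in> anchored (avoid E {v})"
    by (rule anchored_or_entangled[OF fin *(1) _ *(2-6) not X[OF l]]) (use *(7) in blast)
  with l(2) X[OF l] have "u \<in> (e - {v}) \<inter> (anchored (avoid E {v}) \<inter> X)" by simp
  with l(1) show ?thesis by (metis empty_iff)
qed

text \<open>Taking for X the complement of the conclusion makes it self-fulfilling: if u were not
  anchored, it would lie in X, and then the absence of entanglement would anchor it. Only returns to
  clusters of vertices that are not anchored have to be excluded.\<close>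

lemma core_edge_hits_or_entangled:
  assumes fin: "finite E"
    and not: "\<not> entangled (- anchored (avoid E {v})) (avoid E {v}) (links E {v} v)"
    and e: "e \<in> core_edges E" "v \<in> e" "u \<in> e" "u \<noteq> v" "2 \<le> edeg (core_edges E) u"
  shows "u \<in> anchored (avoid E {v})"
  using anchored_or_entangled[OF fin core_edges_subset _ e not] core_edges_closed[OF fin]
  unfolding core_closed_def by (meson ComplI)

lemma core_edge_other:
  assumes fin: "finite E" and e: "e \<in> core_edges E"
  obtains u where "u \<in> e" "u \<noteq> v" "2 \<le> edeg (core_edges E) u"
  using core_edges_closed[OF fin] e unfolding core_closed_def by metis

lemma edeg_core_le:
  assumes fin: "finite E"
    and not: "\<not> entangled (- anchored (avoid E {v})) (avoid E {v}) (links E {v} v)"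
  shows "edeg (core_edges E) v \<le> card {l \<in> links E {v} v. l \<inter> anchored (avoid E {v}) \<noteq> {}}"
proof -
  have "inj_on (\<lambda>e. e - {v}) {e \<in> core_edges E. v \<in> e}"
    by (rule inj_onI) auto
  then have "edeg (core_edges E) v = card ((\<lambda>e. e - {v}) ` {e \<in> core_edges E. v \<in> e})"
    by (simp add: edeg_def card_image)
  also have "\<dots> \<le> card {l \<in> links E {v} v. l \<inter> anchored (avoid E {v}) \<noteq> {}}"
  proof (rule card_mono)
    show "finite {l \<in> links E {v} v. l \<inter> anchored (avoid E {v}) \<noteq> {}}" using fin by simp
    show "(\<lambda>e. e - {v}) ` {e \<in> core_edges E. v \<in> e} \<subseteq> {l \<in> links E {v} v. l \<inter> anchored (avoid E {v}) \<noteq> {}}"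
    proof
      fix l assume "l \<in> (\<lambda>e. e - {v}) ` {e \<in> core_edges E. v \<in> e}"
      then obtain e where e: "e \<in> core_edges E" "v \<in> e" and l: "l = e - {v}" by auto
      have "l \<in> links E {v} v" unfolding l using e core_edges_subset by (intro linksI) auto
      obtain u where u: "u \<in> e" "u \<noteq> v" "2 \<le> edeg (core_edges E) u"
        using core_edge_other[OF fin e(1)] .
      have "u \<in> anchored (avoid E {v})"
        using core_edge_hits_or_entangled[OF fin not e u] .
      with u \<open>l \<in> links E {v} v\<close> show "l \<in> {l \<in> links E {v} v. l \<inter> anchored (avoid E {v}) \<noteq> {}}"
        by (auto simp: l)
    qed
  qed
  finally show ?thesis .
qed

text \<open>If v has core degree one, it is no witness of its core edge. Both witnesses then survive
  in one link, and both are anchored.\<close>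

lemma edeg_core_ge1_cases:
  assumes fin: "finite E"
    and not: "\<not> entangled (- anchored (avoid E {v})) (avoid E {v}) (links E {v} v)"
    and v: "1 \<le> edeg (core_edges E) v" and finl: "\<And>l. l \<in> links E {v} v \<Longrightarrow> finite l"
  shows "2 \<le> card {l \<in> links E {v} v. l \<inter> anchored (avoid E {v}) \<noteq> {}} \<or>
     (\<exists>l\<in>links E {v} v. 2 \<le> card (l \<inter> anchored (avoid E {v})))"
proof (cases "2 \<le> edeg (core_edges E) v")
  case True
  then show ?thesis using edeg_core_le[OF fin not] by simp
next
  case False
  obtain e where e: "e \<in> core_edges E" "v \<in> e"
    using v edeg_ge1_iff[OF finite_subset[OF core_edges_subset fin]] by auto
  obtain a b where ab: "a \<in> e" "b \<in> e" "a \<noteq> b" "2 \<le> edeg (core_edges E) a" "2 \<le> edeg (core_edges E) b"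
    using core_edges_closed[OF fin] e unfolding core_closed_def by blast
  have ne: "a \<noteq> v" "b \<noteq> v" using ab False by auto
  have l: "e - {v} \<in> links E {v} v" using e core_edges_subset by (intro linksI) auto
  have "{a, b} \<subseteq> (e - {v}) \<inter> anchored (avoid E {v})"
    using core_edge_hits_or_entangled[OF fin not e] ab ne by auto
  then have "card {a, b} \<le> card ((e - {v}) \<inter> anchored (avoid E {v}))"
    using finl[OF l] by (intro card_mono) auto
  then have "2 \<le> card ((e - {v}) \<inter> anchored (avoid E {v}))" using ab(3) by simp
  with l show ?thesis by blast
qed

text \<open>A nonempty set of edges that is not closed has an edge with at most one vertex of degree
  two or more. Peeling off this edge frees at least m vertices that lie in no other edge. This is
  the bound for forests, and it does not count components.\<close>

lemma core_free_card_le: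
  assumes "finite E" "\<And>e. e \<in> E \<Longrightarrow> finite e \<and> card e = Suc m" "core_edges E = {}"
  shows "m * card E \<le> card (\<Union>E)"
  using assms
proof (induction "card E" arbitrary: E)
  case (Suc n)
  have "E \<noteq> {}" using Suc(2) by auto
  have "\<not> core_closed E" using core_edges_greatest[of E E] Suc(5) \<open>E \<noteq> {}\<close> by auto
  then obtain e where e: "e \<in> E"
    and ne: "\<And>a b. a \<in> e \<Longrightarrow> b \<in> e \<Longrightarrow> 2 \<le> edeg E a \<Longrightarrow> 2 \<le> edeg E b \<Longrightarrow> a = b"
    unfolding core_closed_def by blast
  define P where "P = {a \<in> e. 2 \<le> edeg E a}"
  have fe: "finite e" "card e = Suc m" using Suc(4) e by auto
  have "card P \<le> Suc 0"
    using ne fe by (subst card_le_Suc0_iff_eq) (auto simp: P_def)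
  then have c: "m \<le> card (e - P)"
    using fe card_Diff_subset[of P e] by (auto simp: P_def)
  let ?F = "E - {e}"
  have disj: "(e - P) \<inter> \<Union>?F = {}"
  proof (rule ccontr)
    assume "(e - P) \<inter> \<Union>?F \<noteq> {}"
    then obtain x f where x: "x \<in> e" "x \<notin> P" "f \<in> E" "f \<noteq> e" "x \<in> f" by auto
    then have "card {e, f} \<le> edeg E x"
      unfolding edeg_def using e Suc(3) by (intro card_mono) auto
    with x show False by (auto simp: P_def)
  qed
  have finF: "finite ?F" using Suc(3) by simp
  have n: "card ?F = n" using Suc(2) e Suc(3) by simp
  have "core_edges ?F = {}" using core_edges_mono[of ?F E] Suc(5) by auto
  then have IH: "m * card ?F \<le> card (\<Union>?F)"
    using Suc(1)[of ?F] n finF Suc(4) by auto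
  have finU: "finite (\<Union>E)" using Suc(3,4) by auto
  have "m * card E = m + m * card ?F" by (simp add: n Suc(2)[symmetric])
  also have "\<dots> \<le> card (e - P) + card (\<Union>?F)" using c IH by simp
  also have "\<dots> = card ((e - P) \<union> \<Union>?F)"
    using disj finU fe by (intro card_Un_disjoint[symmetric]) (auto intro: finite_subset)
  also have "\<dots> \<le> card (\<Union>E)" using finU e by (intro card_mono) auto
  finally show ?case .
qed simp

lemma sum_edeg:
  assumes "finite S" "finite E"
  shows "(\<Sum>v\<in>S. edeg E v) = (\<Sum>e\<in>E. card (e \<inter> S))"
proof -
  have "(\<Sum>v\<in>S. edeg E v) = (\<Sum>v\<in>S. \<Sum>e\<in>E. of_bool (v \<in> e))"
    using assms by (simp add: edeg_def sum.If_cases of_bool_def Int_def)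
  also have "\<dots> = (\<Sum>e\<in>E. \<Sum>v\<in>S. of_bool (v \<in> e))" by (rule sum.swap)
  also have "\<dots> = (\<Sum>e\<in>E. card (e \<inter> S))"
    using assms by (intro sum.cong refl) (simp add: of_bool_def sum.If_cases Int_def conj_commute)
  finally show ?thesis .
qed

text \<open>
  The edges inside \<open>S\<close> that avoid the anchored vertices contain no core, so there are at most
  \<open>card S / m\<close> of them.
\<close>

lemma sum_edeg_le_anchored:
  assumes fin: "finite E" "finite S" and m: "\<And>e. e \<in> E \<Longrightarrow> finite e \<and> card e = Suc m"
    and S: "\<And>e. e \<in> E \<Longrightarrow> e \<inter> S \<noteq> {} \<Longrightarrow> e \<subseteq> S"
  shows "m * (\<Sum>v\<in>S. edeg E v) \<le> Suc m * card S + Suc m * m * (\<Sum>v\<in>anchored E. edeg E v)"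
proof -
  define F where "F = {e \<in> E. e \<subseteq> S}"
  define F1 where "F1 = {e \<in> F. e \<inter> anchored E = {}}"
  define F2 where "F2 = {e \<in> E. e \<inter> anchored E \<noteq> {}}"
  have finA: "finite (anchored E)" using anchored_subset[of E] fin m
    by (meson finite_Union finite_subset)
  have "(\<Sum>v\<in>S. edeg E v) = (\<Sum>e\<in>E. card (e \<inter> S))" using fin by (intro sum_edeg) auto
  also have "\<dots> = (\<Sum>e\<in>F. card (e \<inter> S))"
    unfolding F_def using fin S by (intro sum.mono_neutral_right) auto
  also have "\<dots> = (\<Sum>e\<in>F. Suc m)"
    using m by (intro sum.cong) (auto simp: F_def Int_absorb2)
  finally have 1: "(\<Sum>v\<in>S. edeg E v) = Suc m * card F" by simp
  \<comment> \<open>Core vertices of F1 are core vertices of E and hence anchored, but edges of F1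
    avoid anchored vertices.\<close>
  have "core_edges F1 = {}"
  proof (rule ccontr)
    assume "core_edges F1 \<noteq> {}"
    then obtain e where e: "e \<in> core_edges F1" by auto
    then have "e \<in> core_edges E" using core_edges_mono[of F1 E] by (auto simp: F1_def F_def)
    then have "e \<subseteq> anchored E" using core_subset_anchored[OF fin(1)] by blast
    moreover have "e \<in> F1" using e core_edges_subset by blast
    ultimately have "e = {}" by (auto simp: F1_def)
    with m[of e] \<open>e \<in> F1\<close> show False by (auto simp: F1_def F_def)
  qed
  then have "m * card F1 \<le> card (\<Union>F1)"
    using fin m by (intro core_free_card_le) (auto simp: F1_def F_def)
  also have "\<dots> \<le> card S" using fin by (intro card_mono) (auto simp: F1_def F_def)
  finally have 2: "m * card F1 \<le> card S" .
  have "card F2 \<le> (\<Sum>e\<in>F2. card (e \<inter> anchored E))"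
    using sum_mono[of F2 "\<lambda>_. 1" "\<lambda>e. card (e \<inter> anchored E)"] finA
    by (auto simp: F2_def Suc_le_eq card_gt_0_iff)
  also have "\<dots> \<le> (\<Sum>e\<in>E. card (e \<inter> anchored E))"
    using fin by (intro sum_mono2) (auto simp: F2_def)
  also have "\<dots> = (\<Sum>v\<in>anchored E. edeg E v)" using sum_edeg[OF finA fin(1)] by simp
  finally have 3: "card F2 \<le> (\<Sum>v\<in>anchored E. edeg E v)" .
  have "F \<subseteq> F1 \<union> F2" by (auto simp: F1_def F2_def F_def)
  then have "card F \<le> card (F1 \<union> F2)"
    using fin by (intro card_mono) (auto simp: F1_def F2_def F_def)
  also have "\<dots> \<le> card F1 + card F2" by (rule card_Un_le)
  finally have "m * card F \<le> m * card F1 + m * card F2" by (metis add_mult_distrib2 mult_le_mono2)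
  also have "\<dots> \<le> card S + m * (\<Sum>v\<in>anchored E. edeg E v)" using 2 3 by (intro add_mono mult_le_mono2)
  finally have "Suc m * (m * card F) \<le> Suc m * (card S + m * (\<Sum>v\<in>anchored E. edeg E v))"
    by (rule mult_le_mono2)
  then show ?thesis unfolding 1 by (simp only: distrib_left mult.assoc mult.left_commute)
qed

text \<open>Minimum degree one makes the vertex set of a candidate the union of its edges, so
  candidates correspond to nonempty closed edge sets. Without candidates both sides are the empty
  hypergraph.\<close>

lemma loose_core_eq:
  assumes fin: "finite (verts H)" "finite (edges H)" and sub: "\<And>e. e \<in> edges H \<Longrightarrow> e \<subseteq> verts H"
  shows "loose_core H = \<lparr>verts = \<Union>(core_edges (edges H)), edges = core_edges (edges H)\<rparr>" (is "_ = ?C")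
proof -
  let ?E = "edges H"
  have deg: "vertex_degree X v = edeg (edges X) v" for X v by (simp add: vertex_degree_def edeg_def)
  have cand: "loose_core_candidate H X \<longleftrightarrow>
      edges X \<subseteq> ?E \<and> verts X = \<Union>(edges X) \<and> edges X \<noteq> {} \<and> core_closed (edges X)" for X
  proof -
    have "(\<forall>e\<in>edges X. 2 \<le> card {v \<in> e. 2 \<le> vertex_degree X v}) \<longleftrightarrow> core_closed (edges X)"
      if "edges X \<subseteq> ?E"
    proof -
      have "finite e" if "e \<in> edges X" for e
        using that \<open>edges X \<subseteq> ?E\<close> sub fin finite_subset by blast
      then have "2 \<le> card {v \<in> e. 2 \<le> vertex_degree X v} \<longleftrightarrow>
          (\<exists>a\<in>e. \<exists>b\<in>e. a \<noteq> b \<and> 2 \<le> edeg (edges X) a \<and> 2 \<le> edeg (edges X) b)" if "e \<in> edges X" for e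
        using that unfolding deg by (subst two_le_card_iff) auto
      then show ?thesis by (simp add: core_closed_def)
    qed
    moreover have "e \<noteq> {}" if "core_closed (edges X)" "e \<in> edges X" for e
      using that by (auto simp: core_closed_def)
    ultimately show ?thesis
      unfolding loose_core_candidate_iff[OF fin] subhypergraph_def using sub by blast
  qed
  show ?thesis
  proof (cases "core_edges ?E = {}")
    case True
    then have "\<not> loose_core_candidate H X" for X
      using core_edges_greatest[of "edges X" ?E] by (auto simp: cand)
    with True show ?thesis by (simp add: loose_core_def empty_hypergraph_def)
  next
    case False
    then have C: "loose_core_candidate H ?C"
      using core_edges_subset core_edges_closed[OF fin(2)] by (simp add: cand)
    have "is_maximal_candidate H ?C"
      unfolding is_maximal_candidate_def
    proof (intro conjI allI impI C)
      fix X assume X: "loose_core_candidate H X \<and> subhypergraph ?C X"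
      then have "edges X \<subseteq> core_edges ?E" using core_edges_greatest by (auto simp: cand)
      with X have "edges X = core_edges ?E" by (auto simp: subhypergraph_def)
      with X show "X = ?C" by (simp add: cand)
    qed
    with C ex1_maximal_candidate[OF fin] have "(THE X. is_maximal_candidate H X) = ?C"
      by (intro the1_equality) blast+
    with C show ?thesis by (auto simp: loose_core_def)
  qed
qed

section \<open>Random subsets\<close>

definition random_subset :: "'a set \<Rightarrow> real \<Rightarrow> 'a set pmf" where
  "random_subset S p = map_pmf (\<lambda>X. {e \<in> S. X e}) (Pi_pmf S False (\<lambda>_. bernoulli_pmf p))"

lemma set_random_subset: "set_pmf (random_subset S p) \<subseteq> Pow S"
  by (auto simp: random_subset_def)

lemma random_subsetD: "X \<in> set_pmf (random_subset S p) \<Longrightarrow> X \<subseteq> S"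
  using set_random_subset by blast

lemma finite_set_random_subset [simp]: "finite S \<Longrightarrow> finite (set_pmf (random_subset S p))"
  by (meson finite_Pow_iff finite_subset set_random_subset)

lemma integrable_random_subset [simp]:
  fixes f :: "'a set \<Rightarrow> real"
  shows "finite S \<Longrightarrow> integrable (measure_pmf (random_subset S p)) f"
  by (intro integrable_measure_pmf_finite) simp

section \<open>Elementary estimates for probabilities and expectations\<close>

lemma expectation_mono:
  fixes f g :: "'a \<Rightarrow> real"
  assumes "finite (set_pmf M)" "\<And>x. x \<in> set_pmf M \<Longrightarrow> f x \<le> g x"
  shows "measure_pmf.expectation M f \<le> measure_pmf.expectation M g"
  using assms by (intro integral_mono_AE integrable_measure_pmf_finite) (auto simp: AE_measure_pmf_iff)

lemma prob_mono:
  assumes "\<And>x. x \<in> set_pmf M \<Longrightarrow> x \<in> A \<Longrightarrow> x \<in> B"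
  shows "measure_pmf.prob M A \<le> measure_pmf.prob M B"
  using assms by (intro measure_pmf.finite_measure_mono_AE) (auto simp: AE_measure_pmf_iff)

lemma prob_cong:
  assumes "\<And>x. x \<in> set_pmf M \<Longrightarrow> x \<in> A \<longleftrightarrow> x \<in> B"
  shows "measure_pmf.prob M A = measure_pmf.prob M B"
  using assms by (intro measure_pmf.finite_measure_eq_AE) (auto simp: AE_measure_pmf_iff)

lemma prob_Un_le: "measure_pmf.prob M {x. P x \<or> Q x} \<le> measure_pmf.prob M {x. P x} + measure_pmf.prob M {x. Q x}"
  using measure_Un_le[of "{x. P x}" "measure_pmf M" "{x. Q x}"]
  by (simp add: Collect_disj_eq)

lemma prob_UN_le:
  assumes "finite I"
  shows "measure_pmf.prob M {x. \<exists>i\<in>I. P i x} \<le> (\<Sum>i\<in>I. measure_pmf.prob M {x. P i x})"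
proof -
  have "{x. \<exists>i\<in>I. P i x} = (\<Union>i\<in>I. {x. P i x})" by auto
  then show ?thesis using measure_pmf.finite_measure_subadditive_finite[OF assms, of "\<lambda>i. {x. P i x}" M] by simp
qed

lemma prob_Not: "measure_pmf.prob M {x. \<not> P x} = 1 - measure_pmf.prob M {x. P x}"
  using measure_pmf.prob_compl[of "{x. P x}" M] by (simp add: Compl_eq_Diff_UNIV[symmetric] Collect_neg_eq)

lemma expectation_card:
  assumes "finite V"
  shows "measure_pmf.expectation M (\<lambda>E. real (card {v \<in> V. P v E})) = (\<Sum>v\<in>V. measure_pmf.prob M {E. P v E})"
proof -
  have "real (card {v \<in> V. P v E}) = (\<Sum>v\<in>V. indicator {E. P v E} E)" for E
    using assms by (simp add: indicator_def of_bool_def sum.If_cases Int_def)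
  moreover have "integrable M (indicator {E. P v E} :: _ \<Rightarrow> real)" for v
    by (rule measure_pmf.integrable_const_bound[where B = 1]) auto
  ultimately show ?thesis by (simp add: Bochner_Integration.integral_sum)
qed

lemma markov:
  fixes f :: "'a \<Rightarrow> real"
  assumes "finite (set_pmf M)" "\<And>x. x \<in> set_pmf M \<Longrightarrow> 0 \<le> f x" "0 < c"
  shows "measure_pmf.prob M {x. c \<le> f x} \<le> measure_pmf.expectation M f / c"
proof -
  have "c * measure_pmf.prob M {x. c \<le> f x} = measure_pmf.expectation M (\<lambda>x. c * indicator {x. c \<le> f x} x)"
    by simp
  also have "\<dots> \<le> measure_pmf.expectation M f"
    by (intro expectation_mono assms) (use assms in \<open>auto simp: indicator_def\<close>)
  finally show ?thesis using assms by (simp add: field_simps)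
qed

lemma prob_pair_pmf:
  "measure_pmf.prob (pair_pmf M N) X = measure_pmf.expectation M (\<lambda>a. measure_pmf.prob N {b. (a, b) \<in> X})"
proof -
  have "ennreal (measure_pmf.prob (pair_pmf M N) X) = (\<integral>\<^sup>+x. indicator X x \<partial>pair_pmf M N)"
    by (simp add: measure_pmf.emeasure_eq_measure)
  also have "\<dots> = (\<integral>\<^sup>+a. \<integral>\<^sup>+b. indicator {b. (a, b) \<in> X} b \<partial>N \<partial>M)"
    unfolding nn_integral_pair_pmf' by (intro nn_integral_cong) (simp add: indicator_def)
  also have "\<dots> = (\<integral>\<^sup>+a. ennreal (measure_pmf.prob N {b. (a, b) \<in> X}) \<partial>M)"
    by (simp add: measure_pmf.emeasure_eq_measure)
  also have "\<dots> = ennreal (measure_pmf.expectation M (\<lambda>a. measure_pmf.prob N {b. (a, b) \<in> X}))"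
    by (intro nn_integral_eq_integral measure_pmf.integrable_const_bound[where B = 1]) auto
  finally show ?thesis by (simp add: integral_nonneg_AE)
qed

section \<open>Independence of disjoint parts of a random subset\<close>

lemma random_subset_Un:
  assumes "finite A" "finite B" "A \<inter> B = {}"
  shows "random_subset (A \<union> B) p = map_pmf (\<lambda>(X, Y). X \<union> Y) (pair_pmf (random_subset A p) (random_subset B p))"
proof -
  have "random_subset (A \<union> B) p = map_pmf (\<lambda>X. {e \<in> A \<union> B. X e}) (map_pmf (\<lambda>(f,g) x. if x \<in> A then f x else g x)
      (pair_pmf (Pi_pmf A False (\<lambda>_. bernoulli_pmf p)) (Pi_pmf B False (\<lambda>_. bernoulli_pmf p))))"
    by (simp add: random_subset_def Pi_pmf_union[OF assms])
  also have "\<dots> = map_pmf (\<lambda>(f, g). {e \<in> A. f e} \<union> {e \<in> B. g e})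
      (pair_pmf (Pi_pmf A False (\<lambda>_. bernoulli_pmf p)) (Pi_pmf B False (\<lambda>_. bernoulli_pmf p)))"
    unfolding map_pmf_comp using assms(3) by (intro map_pmf_cong) auto
  finally show ?thesis
    by (simp add: random_subset_def pair_map_pmf1 pair_map_pmf2 map_pmf_comp case_prod_unfold)
qed

lemma random_subset_Int:
  assumes "finite S" "A \<subseteq> S"
  shows "map_pmf (\<lambda>X. X \<inter> A) (random_subset S p) = random_subset A p"
proof -
  have "random_subset S p = random_subset (A \<union> (S - A)) p" using assms by (simp add: Un_absorb1)
  also have "\<dots> = map_pmf (\<lambda>(X, Y). X \<union> Y) (pair_pmf (random_subset A p) (random_subset (S - A) p))"
    using assms by (intro random_subset_Un) (auto intro: finite_subset)
  also have "map_pmf (\<lambda>X. X \<inter> A) \<dots> = map_pmf fst (pair_pmf (random_subset A p) (random_subset (S - A) p))"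
    unfolding map_pmf_comp
  proof (intro map_pmf_cong refl)
    fix x assume "x \<in> set_pmf (pair_pmf (random_subset A p) (random_subset (S - A) p))"
    then have "fst x \<subseteq> A" "snd x \<subseteq> S - A" using set_random_subset by (auto simp: mem_Times_iff)
    then show "(case x of (X, Y) \<Rightarrow> X \<union> Y) \<inter> A = fst x" by (auto simp: case_prod_unfold)
  qed
  finally show ?thesis by (simp add: map_fst_pair_pmf)
qed

lemma prob_random_subset_Int:
  assumes "finite S" "A \<subseteq> S"
  shows "measure_pmf.prob (random_subset S p) {X. P (X \<inter> A)} = measure_pmf.prob (random_subset A p) {X. P X}"
proof -
  have "measure_pmf.prob (random_subset A p) {X. P X} = measure_pmf.prob (random_subset S p) ((\<lambda>X. X \<inter> A) -` {X. P X})"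
    unfolding random_subset_Int[OF assms, symmetric] by simp
  then show ?thesis by (simp add: vimage_def)
qed

lemma random_subset_image:
  assumes "finite S" "inj_on f S"
  shows "random_subset (f ` S) p = map_pmf ((`) f) (random_subset S p)"
  using assms
proof (induction rule: finite_induct)
  case empty
  then show ?case by (simp add: random_subset_def)
next
  case (insert x S)
  have single: "random_subset {y} p = map_pmf (\<lambda>b. if b then {y} else {}) (bernoulli_pmf p)" for y :: 'c
    unfolding random_subset_def by (subst Pi_pmf_singleton) (auto simp: map_pmf_comp intro!: map_pmf_cong split: if_splits)
  have "random_subset (f ` insert x S) p = random_subset ({f x} \<union> f ` S) p" by simp
  also have "\<dots> = map_pmf (\<lambda>(X, Y). X \<union> Y) (pair_pmf (random_subset {f x} p) (random_subset (f ` S) p))"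
    using insert by (intro random_subset_Un) auto
  also have "random_subset {f x} p = map_pmf ((`) f) (random_subset {x} p)"
    unfolding single
    by (simp add: random_subset_def map_pmf_comp Pi_pmf_singleton) (intro map_pmf_cong, auto)
  also have "random_subset (f ` S) p = map_pmf ((`) f) (random_subset S p)" using insert by simp
  also have "map_pmf (\<lambda>(X, Y). X \<union> Y) (pair_pmf (map_pmf ((`) f) (random_subset {x} p)) (map_pmf ((`) f) (random_subset S p)))
      = map_pmf ((`) f) (map_pmf (\<lambda>(X, Y). X \<union> Y) (pair_pmf (random_subset {x} p) (random_subset S p)))"
    by (simp add: pair_map_pmf1 pair_map_pmf2 map_pmf_comp case_prod_unfold image_Un)
  also have "map_pmf (\<lambda>(X, Y). X \<union> Y) (pair_pmf (random_subset {x} p) (random_subset S p)) = random_subset ({x} \<union> S) p"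
    using insert by (intro random_subset_Un[symmetric]) auto
  finally show ?case by simp
qed

lemma prob_random_subset_superset:
  assumes "finite S" "F \<subseteq> S" "0 \<le> p" "p \<le> 1"
  shows "measure_pmf.prob (random_subset S p) {X. F \<subseteq> X} = p ^ card F"
proof -
  have "measure_pmf.prob (random_subset S p) {X. F \<subseteq> X} = measure_pmf.prob (random_subset F p) {X. X = F}"
  proof -
    have "{X. F \<subseteq> X} = {X. X \<inter> F = F}" by auto
    then show ?thesis by (simp only: prob_random_subset_Int[OF assms(1,2), of p "\<lambda>X. X = F"])
  qed
  also have "\<dots> = measure_pmf.prob (Pi_pmf F False (\<lambda>_. bernoulli_pmf p)) (Pi F (\<lambda>_. {True}))"
    unfolding random_subset_def by (auto intro!: arg_cong2[where f = measure])
  also have "\<dots> = p ^ card F"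
    using assms finite_subset[OF assms(2,1)] by (subst measure_Pi_pmf_Pi) (auto simp: measure_pmf_single)
  finally show ?thesis .
qed

lemma map_card_random_subset:
  assumes "finite S" "0 \<le> p" "p \<le> 1"
  shows "map_pmf card (random_subset S p) = binomial_pmf (card S) p"
  using binomial_pmf_altdef'[of S "card S" p False] assms
  by (simp add: random_subset_def map_pmf_comp)

text \<open>Fubini with respect to the part inside A; the elements outside A and B are integrated
  out.\<close>

lemma prob_random_subset_Int2:
  assumes "finite S" "A \<subseteq> S" "B \<subseteq> S" "A \<inter> B = {}"
  shows "measure_pmf.prob (random_subset S p) {X. P (X \<inter> A) (X \<inter> B)} =
    measure_pmf.expectation (random_subset A p) (\<lambda>Y. measure_pmf.prob (random_subset B p) {Z. P Y Z})"
proof -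
  have fin: "finite A" "finite B" using assms finite_subset by blast+
  have "measure_pmf.prob (random_subset S p) {X. P (X \<inter> A) (X \<inter> B)} =
      measure_pmf.prob (random_subset S p) {X. (\<lambda>Y. P (Y \<inter> A) (Y \<inter> B)) (X \<inter> (A \<union> B))}"
    by (intro prob_cong) (simp add: Int_assoc Int_absorb1 Int_absorb2)
  also have "\<dots> = measure_pmf.prob (random_subset (A \<union> B) p) {X. P (X \<inter> A) (X \<inter> B)}"
    using assms by (intro prob_random_subset_Int) auto
  also have "\<dots> = measure_pmf.prob (pair_pmf (random_subset A p) (random_subset B p)) {(Y, Z). P Y Z}"
    unfolding random_subset_Un[OF fin assms(4)] measure_map_pmf
  proof (rule prob_cong)
    fix x assume "x \<in> set_pmf (pair_pmf (random_subset A p) (random_subset B p))"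
    then have "fst x \<subseteq> A" "snd x \<subseteq> B" using set_random_subset by (auto simp: mem_Times_iff)
    then have "(fst x \<union> snd x) \<inter> A = fst x" "(fst x \<union> snd x) \<inter> B = snd x" using assms(4) by auto
    then show "x \<in> (\<lambda>(X, Y). X \<union> Y) -` {X. P (X \<inter> A) (X \<inter> B)} \<longleftrightarrow> x \<in> {(Y, Z). P Y Z}"
      by (auto simp: case_prod_unfold)
  qed
  also have "\<dots> = measure_pmf.expectation (random_subset A p) (\<lambda>Y. measure_pmf.prob (random_subset B p) {Z. P Y Z})"
    by (simp add: prob_pair_pmf)
  finally show ?thesis .
qed

lemma prob_random_subset_indep:
  assumes "finite S" "A \<subseteq> S" "B \<subseteq> S" "A \<inter> B = {}"
  shows "measure_pmf.prob (random_subset S p) {X. P (X \<inter> A) \<and> Q (X \<inter> B)} =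
    measure_pmf.prob (random_subset A p) {X. P X} * measure_pmf.prob (random_subset B p) {X. Q X}"
proof -
  have "measure_pmf.prob (random_subset B p) {Z. P Y \<and> Q Z} =
      indicator {X. P X} Y * measure_pmf.prob (random_subset B p) {X. Q X}" for Y
    by (cases "P Y") auto
  then show ?thesis
    using prob_random_subset_Int2[OF assms, of p "\<lambda>Y Z. P Y \<and> Q Z"] by simp
qed

lemma prob_random_subset_indep_family:
  assumes "finite W" "\<And>v. v \<in> W \<Longrightarrow> finite (S v)" "disjoint_family_on S W"
  shows "measure_pmf.prob (random_subset (\<Union>v\<in>W. S v) p) {X. \<forall>v\<in>W. P v (X \<inter> S v)} =
    (\<Prod>v\<in>W. measure_pmf.prob (random_subset (S v) p) {X. P v X})"
  using assms
proof (induction rule: finite_induct)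
  case (insert w W)
  let ?T = "\<Union>v\<in>insert w W. S v" and ?U = "\<Union>v\<in>W. S v"
  have disj: "S w \<inter> ?U = {}"
    using insert(2,5) by (fastforce simp: disjoint_family_on_def)
  have "measure_pmf.prob (random_subset ?T p) {X. \<forall>v\<in>insert w W. P v (X \<inter> S v)} =
      measure_pmf.prob (random_subset ?T p) {X. P w (X \<inter> S w) \<and> (\<lambda>Y. \<forall>v\<in>W. P v (Y \<inter> S v)) (X \<inter> ?U)}"
  proof (rule prob_cong)
    fix X
    have "X \<inter> ?U \<inter> S v = X \<inter> S v" if "v \<in> W" for v using that by auto
    then show "X \<in> {X. \<forall>v\<in>insert w W. P v (X \<inter> S v)} \<longleftrightarrow>
      X \<in> {X. P w (X \<inter> S w) \<and> (\<lambda>Y. \<forall>v\<in>W. P v (Y \<inter> S v)) (X \<inter> ?U)}" by auto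
  qed
  also have "\<dots> = measure_pmf.prob (random_subset (S w) p) {X. P w X} *
      measure_pmf.prob (random_subset ?U p) {X. \<forall>v\<in>W. P v (X \<inter> S v)}"
    using insert disj by (intro prob_random_subset_indep) auto
  also have "measure_pmf.prob (random_subset ?U p) {X. \<forall>v\<in>W. P v (X \<inter> S v)} =
      (\<Prod>v\<in>W. measure_pmf.prob (random_subset (S v) p) {X. P v X})"
    using insert by (intro insert.IH) (auto simp: disjoint_family_on_def)
  finally show ?case using insert by simp
qed simp

lemma expectation_sum_random_subset:
  fixes f :: "'a \<Rightarrow> real"
  assumes "finite S" "0 \<le> p" "p \<le> 1"
  shows "measure_pmf.expectation (random_subset S p) (\<lambda>X. \<Sum>e\<in>X. f e) = p * (\<Sum>e\<in>S. f e)"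
proof -
  have "measure_pmf.expectation (random_subset S p) (\<lambda>X. \<Sum>e\<in>X. f e) =
      measure_pmf.expectation (random_subset S p) (\<lambda>X. \<Sum>e\<in>S. f e * indicator {X. {e} \<subseteq> X} X)"
  proof (rule integral_cong_AE)
    show "AE X in random_subset S p. (\<Sum>e\<in>X. f e) = (\<Sum>e\<in>S. f e * indicator {X. {e} \<subseteq> X} X)"
      unfolding AE_measure_pmf_iff
    proof
      fix X assume "X \<in> set_pmf (random_subset S p)"
      then have "X \<subseteq> S" by (rule random_subsetD)
      then show "(\<Sum>e\<in>X. f e) = (\<Sum>e\<in>S. f e * indicator {X. {e} \<subseteq> X} X)"
        using assms by (intro sum.mono_neutral_cong_left) (auto simp: indicator_def)
    qed
  qed auto
  also have "\<dots> = (\<Sum>e\<in>S. f e * measure_pmf.prob (random_subset S p) {X. {e} \<subseteq> X})"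
    using assms by (subst Bochner_Integration.integral_sum) auto
  also have "\<dots> = (\<Sum>e\<in>S. f e * p)"
    using assms by (intro sum.cong refl) (subst prob_random_subset_superset, auto)
  finally show ?thesis by (simp add: sum_distrib_left mult.commute)
qed

section \<open>Uniform hypergraphs and the links of deleted vertices\<close>

definition rsets :: "'a set \<Rightarrow> nat \<Rightarrow> 'a set set" where
  "rsets V r = {e. e \<subseteq> V \<and> card e = r}"

lemma finite_rsets [simp]: "finite V \<Longrightarrow> finite (rsets V r)"
  by (simp add: rsets_def)

lemma card_rsets: "finite V \<Longrightarrow> card (rsets V r) = card V choose r"
  by (simp add: rsets_def n_subsets)

lemma rsetsD: "e \<in> rsets V r \<Longrightarrow> e \<subseteq> V" "e \<in> rsets V r \<Longrightarrow> card e = r"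
  by (auto simp: rsets_def)

lemma links_eq:
  assumes "E \<subseteq> rsets V (Suc m)" "v \<in> W" "finite V"
  shows "links E W v = (\<lambda>e. e - {v}) ` (E \<inter> insert v ` rsets (V - W) m)"
proof -
  have "e \<inter> W = {v} \<longleftrightarrow> e \<in> insert v ` rsets (V - W) m" if "e \<in> E" for e
  proof
    assume eW: "e \<inter> W = {v}"
    have "finite e" "e \<subseteq> V" "card e = Suc m" using that assms rsetsD[of e V "Suc m"] finite_subset by blast+
    moreover have "v \<in> e" using eW by blast
    ultimately have "e - {v} \<in> rsets (V - W) m" using eW by (auto simp: rsets_def)
    moreover have "e = insert v (e - {v})" using eW by auto
    ultimately show "e \<in> insert v ` rsets (V - W) m" by blast
  next
    assume "e \<in> insert v ` rsets (V - W) m"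
    then show "e \<inter> W = {v}" using assms(2) by (auto simp: rsets_def)
  qed
  then have "{e \<in> E. e \<inter> W = {v}} = E \<inter> insert v ` rsets (V - W) m" by blast
  then show ?thesis by (simp add: links_def)
qed

lemma links_subset_rsets:
  assumes "E \<subseteq> rsets V (Suc m)" "v \<in> W" "finite V"
  shows "links E W v \<subseteq> rsets (V - W) m"
proof -
  have "v \<notin> l" if "l \<in> rsets (V - W) m" for l using that assms(2) by (auto simp: rsets_def)
  then show ?thesis unfolding links_eq[OF assms] by auto
qed

text \<open>Given the edges that avoid W, the link families of the vertices in W are independent and
  identically distributed random sets of m-subsets of \<open>V - W\<close>. This produces the power
  on the right.\<close>

lemma prob_links:
  assumes V: "finite V" "W \<subseteq> V"
  shows "measure_pmf.prob (random_subset (rsets V (Suc m)) p) {E. \<forall>v\<in>W. P (avoid E W) (links E W v)} =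
    measure_pmf.expectation (random_subset (rsets (V - W) (Suc m)) p)
      (\<lambda>D. measure_pmf.prob (random_subset (rsets (V - W) m) p) {L. P D L} ^ card W)"
proof -
  let ?R = "rsets (V - W) m" and ?A = "rsets (V - W) (Suc m)"
  define S where "S v = insert v ` ?R" for v
  let ?B = "\<Union>v\<in>W. S v"
  have finW: "finite W" using V finite_subset by blast
  have finR: "finite ?R" using V by simp
  have notin: "v \<notin> l" if "l \<in> ?R" "v \<in> W" for l v using that by (auto simp: rsets_def)
  have card_ins: "card (insert v l) = Suc m" if "l \<in> ?R" "v \<in> W" for l v
  proof -
    have "finite l" using that V by (auto simp: rsets_def intro: finite_subset)
    then show ?thesis using notin[OF that] that by (simp add: rsets_def)
  qed
  have inj: "inj_on (insert v) ?R" if "v \<in> W" for v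
    by (rule inj_onI) (metis insert_ident notin that)
  have SW: "e \<inter> W = {v}" if "e \<in> S v" "v \<in> W" for e v using that by (auto simp: S_def rsets_def)
  have disj: "disjoint_family_on S W"
    unfolding disjoint_family_on_def
  proof (intro ballI impI, rule ccontr)
    fix v w assume vw: "v \<in> W" "w \<in> W" "v \<noteq> w" "S v \<inter> S w \<noteq> {}"
    then obtain e where "e \<in> S v" "e \<in> S w" by auto
    with SW[of e v] SW[of e w] vw show False by simp
  qed
  have finS: "finite (S v)" for v using finR by (simp add: S_def)
  have AB: "?A \<inter> ?B = {}" using SW by (fastforce simp: rsets_def)
  have sub: "?A \<subseteq> rsets V (Suc m)" "?B \<subseteq> rsets V (Suc m)"
    using V card_ins by (auto simp: S_def rsets_def)
  let ?L = "\<lambda>v X. (\<lambda>e. e - {v}) ` X"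
  have "measure_pmf.prob (random_subset (rsets V (Suc m)) p) {E. \<forall>v\<in>W. P (avoid E W) (links E W v)} =
      measure_pmf.prob (random_subset (rsets V (Suc m)) p)
        {E. (\<lambda>D X. \<forall>v\<in>W. P D (?L v (X \<inter> S v))) (E \<inter> ?A) (E \<inter> ?B)}"
  proof (rule prob_cong)
    fix E assume "E \<in> set_pmf (random_subset (rsets V (Suc m)) p)"
    then have E: "E \<subseteq> rsets V (Suc m)" by (rule random_subsetD)
    have 1: "avoid E W = E \<inter> ?A" using E by (auto simp: avoid_def rsets_def)
    have "links E W v = ?L v (E \<inter> ?B \<inter> S v)" if "v \<in> W" for v
      unfolding links_eq[OF E that V(1)] S_def[symmetric] using that by (auto intro!: arg_cong2[where f = image])
    with 1 show "E \<in> {E. \<forall>v\<in>W. P (avoid E W) (links E W v)} \<longleftrightarrow>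
      E \<in> {E. (\<lambda>D X. \<forall>v\<in>W. P D (?L v (X \<inter> S v))) (E \<inter> ?A) (E \<inter> ?B)}" by simp
  qed
  \<comment> \<open>Potential edges with several vertices in W belong to neither ?A nor ?B and
    disappear here.\<close>
  also have "\<dots> = measure_pmf.expectation (random_subset ?A p)
      (\<lambda>D. measure_pmf.prob (random_subset ?B p) {X. \<forall>v\<in>W. P D (?L v (X \<inter> S v))})"
    using V sub AB by (intro prob_random_subset_Int2) auto
  also have "\<dots> = measure_pmf.expectation (random_subset ?A p)
      (\<lambda>D. measure_pmf.prob (random_subset ?R p) {L. P D L} ^ card W)"
  proof (intro Bochner_Integration.integral_cong refl)
    fix D
    have "measure_pmf.prob (random_subset ?B p) {X. \<forall>v\<in>W. P D (?L v (X \<inter> S v))} =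
        (\<Prod>v\<in>W. measure_pmf.prob (random_subset (S v) p) {X. P D (?L v X)})"
      using finW finS disj by (intro prob_random_subset_indep_family) auto
    also have "\<dots> = (\<Prod>v\<in>W. measure_pmf.prob (random_subset ?R p) {L. P D L})"
    proof (intro prod.cong refl)
      fix v assume v: "v \<in> W"
      have "measure_pmf.prob (random_subset (S v) p) {X. P D (?L v X)} =
          measure_pmf.prob (random_subset ?R p) {X. P D (?L v (insert v ` X))}"
        unfolding S_def random_subset_image[OF finR inj[OF v]] by (simp add: vimage_def)
      also have "\<dots> = measure_pmf.prob (random_subset ?R p) {L. P D L}"
      proof (rule prob_cong)
        fix X assume "X \<in> set_pmf (random_subset ?R p)"
        then have "X \<subseteq> ?R" by (rule random_subsetD)
        then have "insert v l - {v} = l" if "l \<in> X" for l using that notin[of l v] v by auto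
        then have "?L v (insert v ` X) = X" by (simp add: image_image)
        then show "X \<in> {X. P D (?L v (insert v ` X))} \<longleftrightarrow> X \<in> {L. P D L}" by simp
      qed
      finally show "measure_pmf.prob (random_subset (S v) p) {X. P D (?L v X)} =
          measure_pmf.prob (random_subset ?R p) {L. P D L}" .
    qed
    finally show "measure_pmf.prob (random_subset ?B p) {X. \<forall>v\<in>W. P D (?L v (X \<inter> S v))} =
        measure_pmf.prob (random_subset ?R p) {L. P D L} ^ card W" by simp
  qed
  finally show ?thesis .
qed

section \<open>The survival fixed point\<close>

text \<open>This is 1 - F(1 - a): the chance that a Poisson number of links with mean d, each
  consisting of m random vertices, meets a set of density a.\<close>

definition survival :: "nat \<Rightarrow> real \<Rightarrow> real \<Rightarrow> real" where
  "survival m d a = 1 - exp (- d * (1 - (1 - a) ^ m))"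

lemma continuous_survival [continuous_intros]: "continuous_on S (survival m d)"
  unfolding survival_def by (intro continuous_intros)

lemma survival_mono:
  assumes "0 \<le> d" "0 \<le> a" "a \<le> b" "b \<le> 1"
  shows "survival m d a \<le> survival m d b"
proof -
  have "(1 - b) ^ m \<le> (1 - a) ^ m" using assms by (intro power_mono) auto
  then have "d * (1 - (1 - a) ^ m) \<le> d * (1 - (1 - b) ^ m)" using assms by (intro mult_left_mono) auto
  then show ?thesis by (simp add: survival_def)
qed

lemma survival_bounds:
  assumes "0 \<le> d" "0 \<le> a" "a \<le> 1"
  shows "0 \<le> survival m d a" "survival m d a < 1"
proof -
  have "(1 - a) ^ m \<le> 1" using assms by (intro power_le_one) auto
  then have "0 \<le> d * (1 - (1 - a) ^ m)" using assms by simp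
  then show "0 \<le> survival m d a" by (simp add: survival_def)
  show "survival m d a < 1" by (simp add: survival_def)
qed

locale fixpoint =
  fixes m :: nat and d :: real
  assumes m: "2 \<le> m" and d: "0 < d"
begin

definition \<rho> :: real where "\<rho> = rho_star (Suc m) d"

lemma
  shows rho_fixed: "survival m d \<rho> = \<rho>"
    and rho_upper: "a \<le> 1 \<Longrightarrow> survival m d a = a \<Longrightarrow> a \<le> \<rho>"
    and rho_nonneg: "0 \<le> \<rho>" and rho_less: "\<rho> < 1"
proof -
  have eq: "1 - a = fixpoint_map (Suc m) d (1 - a) \<longleftrightarrow> survival m d a = a" for a
    by (auto simp: fixpoint_map_def survival_def)
  have zero: "survival m d 0 = 0" by (simp add: survival_def)
  let ?S = "{a \<in> {0..1}. survival m d a - a = 0}"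
  have "closed ?S"
    by (intro continuous_closed_preimage_constant continuous_intros)
  moreover have "bounded ?S" by (rule bounded_subset[of "{0..1}"]) auto
  moreover have "0 \<in> ?S" using zero by simp
  then have "?S \<noteq> {}" by blast
  ultimately obtain b where b: "b \<in> ?S" "\<And>a. a \<in> ?S \<Longrightarrow> a \<le> b"
    using compact_attains_sup[of ?S] unfolding compact_eq_bounded_closed by blast
  \<comment> \<open>The value 0 is a solution, so negative solutions cannot exceed the maximum over
    the unit interval.\<close>
  have ub: "a \<le> b" if "a \<le> 1" "survival m d a = a" for a
    using b(2)[of a] b(2)[of 0] that zero by (cases "0 \<le> a") auto
  have "rho_star (Suc m) d = b"
    unfolding rho_star_def eq using b(1) ub by (intro Greatest_equality) auto
  then have \<rho>: "\<rho> = b" by (simp add: \<rho>_def)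
  show "survival m d \<rho> = \<rho>" "0 \<le> \<rho>" using b(1) by (auto simp: \<rho>)
  moreover have "survival m d \<rho> < 1" by (simp add: survival_def)
  ultimately show "\<rho> < 1" by simp
  show "a \<le> 1 \<Longrightarrow> survival m d a = a \<Longrightarrow> a \<le> \<rho>" using ub by (simp add: \<rho>)
qed

text \<open>At 1 the map lies below the diagonal, so there is a fixed point between a and 1, and
  \<rho> is the largest one.\<close>

lemma le_rho_if_le_survival:
  assumes "0 \<le> a" "a \<le> 1" "a \<le> survival m d a"
  shows "a \<le> \<rho>"
proof -
  have "\<exists>t\<ge>a. t \<le> 1 \<and> t - survival m d t = 0"
    using assms survival_bounds[of d 1 m] d
    by (intro IVT' continuous_intros) auto
  then show ?thesis using rho_upper by fastforce
qed

text \<open>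
  The function \<open>y \<mapsto> d (1 - y\<^sup>m) + ln y\<close> vanishes at \<open>1 - \<rho>\<close> and at \<open>1\<close> and is
  increasing, then decreasing in between.
\<close>

lemma log_gap_pos:
  assumes "1 - \<rho> < y" "y < 1"
  shows "0 < d * (1 - y ^ m) + ln y"
proof -
  define h where "h = (\<lambda>y. d * (1 - y ^ m) + ln y)"
  define h' where "h' = (\<lambda>y. 1 / y - d * real m * y ^ (m - 1))"
  let ?x = "1 - \<rho>"
  have x: "0 < ?x" using rho_less by simp
  have der: "(h has_real_derivative h' t) (at t)" if "0 < t" for t
    unfolding h_def h'_def using that by (auto intro!: derivative_eq_intros simp: field_simps)
  have "exp (- d * (1 - ?x ^ m)) = ?x" using rho_fixed by (simp add: survival_def)
  then have "ln ?x = - d * (1 - ?x ^ m)" by (metis ln_exp)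
  then have hx: "h ?x = 0" by (simp add: h_def)
  have h1: "h 1 = 0" by (simp add: h_def)
  have h't: "h' t = (1 - d * real m * t ^ m) / t" if "0 < t" for t
    using that m by (simp add: h'_def field_simps power_eq_if)
  have "0 < h y"
  \<comment> \<open>The derivative has the sign of 1 - d m t^m, which decreases in t. So h increases
    from its zero at \<open>1 - \<rho>\<close> up to y, or it decreases from y to its zero at
    1.\<close>
  proof (cases "d * real m * y ^ m \<le> 1")
    case True
    have "h ?x < h y"
    proof (rule DERIV_pos_imp_increasing_open[OF assms(1)])
      fix t assume t: "?x < t" "t < y"
      have "t ^ m < y ^ m" using t x m by (intro power_strict_mono) auto
      then have "d * real m * t ^ m < d * real m * y ^ m" using d m by (intro mult_strict_left_mono) auto
      then have "0 < h' t" using True t x by (simp add: h't)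
      then show "\<exists>z. (h has_real_derivative z) (at t) \<and> 0 < z" using der[of t] t x by auto
    next
      show "continuous_on {?x..y} h"
        using x by (intro continuous_at_imp_continuous_on ballI DERIV_isCont[OF der]) auto
    qed
    with hx show ?thesis by simp
  next
    case False
    have "h 1 < h y"
    proof (rule DERIV_neg_imp_decreasing_open[OF assms(2)])
      fix t assume t: "y < t" "t < 1"
      have "y ^ m < t ^ m" using t x assms m by (intro power_strict_mono) auto
      then have "d * real m * y ^ m < d * real m * t ^ m" using d m by (intro mult_strict_left_mono) auto
      then have "h' t < 0" using False t x assms by (simp add: h't divide_neg_pos)
      then show "\<exists>z. (h has_real_derivative z) (at t) \<and> z < 0" using der[of t] t x assms by auto
    next
      show "continuous_on {y..1} h"
        using x assms by (intro continuous_at_imp_continuous_on ballI DERIV_isCont[OF der]) auto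
    qed
    with h1 show ?thesis by simp
  qed
  then show ?thesis by (simp add: h_def)
qed

text \<open>Together with monotonicity this leaves no stopping point between 0 and \<rho> for the
  iteration that improves a lower bound.\<close>

lemma survival_gt:
  assumes "0 < a" "a < \<rho>"
  shows "a < survival m d a"
proof -
  have "0 < d * (1 - (1 - a) ^ m) + ln (1 - a)" using log_gap_pos[of "1 - a"] assms by simp
  then have "exp (- d * (1 - (1 - a) ^ m)) < exp (ln (1 - a))" by (subst exp_less_cancel_iff) simp
  also have "\<dots> = 1 - a" using assms rho_less by simp
  finally show ?thesis by (simp add: survival_def)
qed

lemma survival_le_rho: "0 \<le> a \<Longrightarrow> a \<le> \<rho> \<Longrightarrow> survival m d a \<le> \<rho>"
  using survival_mono[of d a \<rho> m] rho_fixed rho_less d by simp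

text \<open>The bound integrates the inequality of \<open>log_gap_pos\<close> over the interval from \<open>1 - \<rho>\<close> to \<open>1\<close>.\<close>

lemma excess_pos:
  assumes "0 < \<rho>"
  shows "real (Suc m) * \<rho> < real m * d * (1 - (1 - \<rho>) ^ Suc m)"
proof -
  \<comment> \<open>The integral of \<open>d * (1 - t ^ m) + ln t\<close> over t from y to 1, in
    closed form. Its positivity at \<open>1 - \<rho>\<close> becomes the claim after the logarithm
    is eliminated by the fixed point equation.\<close>
  define J where "J = (\<lambda>y. d * (1 - y) - d * (1 - y ^ Suc m) / real (Suc m) - (1 - y + y * ln y))"
  let ?x = "1 - \<rho>"
  have x: "0 < ?x" using rho_less by simp
  have der: "(J has_real_derivative - (d * (1 - t ^ m) + ln t)) (at t)" if "0 < t" for t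
  proof -
    have p: "((\<lambda>y. y ^ Suc m) has_real_derivative real (Suc m) * t ^ m) (at t)"
      using DERIV_pow[of "Suc m" t] by simp
    have "(J has_real_derivative - d - (- (real (Suc m) * t ^ m) * d) / real (Suc m) - (- 1 + (ln t + 1))) (at t)"
      unfolding J_def using that by (auto intro!: derivative_eq_intros p simp del: power_Suc of_nat_Suc)
    moreover have "- d - (- (real (Suc m) * t ^ m) * d) / real (Suc m) - (- 1 + (ln t + 1)) = - (d * (1 - t ^ m) + ln t)"
      by (simp add: algebra_simps del: of_nat_Suc)
    ultimately show ?thesis by simp
  qed
  have "J 1 < J ?x"
  proof (rule DERIV_neg_imp_decreasing_open[where f = J and a = ?x and b = 1])
    show "?x < 1" using assms by simp
    show "\<exists>z. (J has_real_derivative z) (at t) \<and> z < 0" if "?x < t" "t < 1" for t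
      using der[of t] log_gap_pos[OF that] that x by (intro exI[of _ "- (d * (1 - t ^ m) + ln t)"]) auto
    show "continuous_on {?x..1} J"
      using x by (intro continuous_at_imp_continuous_on ballI DERIV_isCont[OF der]) auto
  qed
  moreover have "J 1 = 0" by (simp add: J_def)
  moreover have "exp (- d * (1 - ?x ^ m)) = ?x" using rho_fixed by (simp add: survival_def)
  then have "ln ?x = - d * (1 - ?x ^ m)" by (metis ln_exp)
  then have "J ?x = d * \<rho> - d * (1 - ?x ^ Suc m) / real (Suc m) - \<rho> + ?x * d * (1 - ?x ^ m)"
    by (simp add: J_def)
  ultimately have "0 < d * \<rho> - d * (1 - ?x ^ Suc m) / real (Suc m) - \<rho> + ?x * d * (1 - ?x ^ m)" by simp
  also have "\<dots> = d * (1 - ?x ^ Suc m) - d * (1 - ?x ^ Suc m) / real (Suc m) - \<rho>"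
    by (simp add: algebra_simps)
  also have "\<dots> = (real m * d * (1 - ?x ^ Suc m) - real (Suc m) * \<rho>) / real (Suc m)"
    by (simp add: field_simps del: power_Suc)
  finally show ?thesis by (simp add: zero_less_divide_iff del: power_Suc)
qed

end

section \<open>Poisson tails\<close>

text \<open>The probability that a Poisson variable of rate l is at least i. In this form it is
  visibly continuous in l, and rate 0 is covered because \<open>0 ^ 0 = 1\<close>.\<close>

definition poisson_tail :: "real \<Rightarrow> nat \<Rightarrow> real" where
  "poisson_tail l i = 1 - (\<Sum>k<i. l ^ k / fact k * exp (- l))"

lemma poisson_tail_0 [simp]: "poisson_tail l 0 = 1"
  by (simp add: poisson_tail_def)

lemma poisson_tail_1 [simp]: "poisson_tail l (Suc 0) = 1 - exp (- l)"
  by (simp add: poisson_tail_def)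

lemma poisson_tail_Suc: "poisson_tail l (Suc i) = poisson_tail l i - l ^ i / fact i * exp (- l)"
  by (simp add: poisson_tail_def)

lemma poisson_sums_1:
  fixes l :: real
  shows "(\<lambda>k. l ^ k / fact k * exp (- l)) sums 1"
proof -
  have "(\<lambda>k. l ^ k / fact k) sums exp l"
    using exp_converges[of l] by (simp add: divide_inverse_commute)
  then have "(\<lambda>k. l ^ k / fact k * exp (- l)) sums (exp l * exp (- l))" by (rule sums_mult2)
  then show ?thesis by (simp add: exp_minus)
qed

lemma poisson_tail_eq_suminf: "poisson_tail l i = (\<Sum>k. l ^ (k + i) / fact (k + i) * exp (- l))"
  using suminf_minus_initial_segment[OF sums_summable[OF poisson_sums_1[of l]], of i]
    sums_unique[OF poisson_sums_1[of l]]
  by (simp add: poisson_tail_def)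

lemma summable_poisson:
  fixes l :: real
  shows "summable (\<lambda>k. l ^ (k + i) / fact (k + i) * exp (- l))"
  using summable_iff_shift[of "\<lambda>k. l ^ k / fact k * exp (- l)" i] poisson_sums_1[of l]
  by (simp add: sums_iff)

lemma poisson_tail_nonneg: "0 \<le> l \<Longrightarrow> 0 \<le> poisson_tail l i"
  unfolding poisson_tail_eq_suminf by (intro suminf_nonneg summable_poisson) auto

lemma poisson_tail_tendsto_0: "(\<lambda>i. poisson_tail l i) \<longlonglongrightarrow> 0"
proof -
  have "(\<lambda>i. 1 - (\<Sum>k<i. l ^ k / fact k * exp (- l))) \<longlonglongrightarrow> 1 - 1"
    using poisson_sums_1[of l] unfolding sums_def by (intro tendsto_intros)
  then show ?thesis by (simp add: poisson_tail_def[abs_def])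
qed

lemma poisson_tail_sums:
  assumes "0 \<le> l"
  shows "(\<lambda>i. poisson_tail l (Suc i)) sums l"
proof -
  \<comment> \<open>For a Poisson variable Y both sides equal the mean of min(Y, b + 1). On the
    right it is split at Y = b, and the part below is evaluated by shifting the index of the Poisson
    weights.\<close>
  have eq: "(\<Sum>i<Suc b. poisson_tail l (Suc i)) = l * (1 - poisson_tail l b) + real (Suc b) * poisson_tail l (Suc b)" for b
  proof (induction b)
    case (Suc b)
    have q: "real (Suc b) * (l ^ Suc b / fact (Suc b) * exp (- l)) = l * (l ^ b / fact b * exp (- l))"
      by (simp add: divide_simps del: of_nat_Suc)
    have "real (Suc b) * poisson_tail l (Suc b) =
        real (Suc b) * (poisson_tail l (Suc (Suc b)) + l ^ Suc b / fact (Suc b) * exp (- l))"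
      by (simp add: poisson_tail_Suc[of l "Suc b"])
    also have "\<dots> = real (Suc b) * poisson_tail l (Suc (Suc b)) + l * (l ^ b / fact b * exp (- l))"
      by (simp only: distrib_left q)
    finally have "real (Suc b) * poisson_tail l (Suc b) =
        real (Suc b) * poisson_tail l (Suc (Suc b)) + l * (l ^ b / fact b * exp (- l))" .
    moreover have "l * (1 - poisson_tail l (Suc b)) = l * (1 - poisson_tail l b) + l * (l ^ b / fact b * exp (- l))"
      unfolding poisson_tail_Suc[of l b] by (simp add: algebra_simps)
    ultimately show ?case using Suc by (simp add: algebra_simps)
  qed simp
  \<comment> \<open>The same index shift, compared term by term. It bounds the boundary term of
    \<open>eq\<close> and so keeps the partial sums below l.\<close>
  have up: "real (Suc b) * poisson_tail l (Suc b) \<le> l * poisson_tail l b" for b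
  proof -
    have "real (Suc b) * poisson_tail l (Suc b) = (\<Sum>k. real (Suc b) * (l ^ (k + Suc b) / fact (k + Suc b) * exp (- l)))"
      unfolding poisson_tail_eq_suminf by (intro suminf_mult[symmetric] summable_poisson)
    also have "\<dots> \<le> (\<Sum>k. l * (l ^ (k + b) / fact (k + b) * exp (- l)))"
    proof (intro suminf_le summable_mult summable_poisson)
      fix k
      have "real (Suc b) * (l ^ (k + Suc b) / fact (k + Suc b) * exp (- l)) \<le>
          real (Suc (k + b)) * (l ^ (k + Suc b) / fact (k + Suc b) * exp (- l))"
        using assms by (intro mult_right_mono) auto
      also have "\<dots> = l * (l ^ (k + b) / fact (k + b) * exp (- l))" by (simp add: divide_simps del: of_nat_Suc)
      finally show "real (Suc b) * (l ^ (k + Suc b) / fact (k + Suc b) * exp (- l)) \<le>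
          l * (l ^ (k + b) / fact (k + b) * exp (- l))" .
    qed
    also have "\<dots> = l * poisson_tail l b"
      unfolding poisson_tail_eq_suminf by (intro suminf_mult summable_poisson)
    finally show ?thesis .
  qed
  have "(\<lambda>b. \<Sum>i<Suc b. poisson_tail l (Suc i)) \<longlonglongrightarrow> l"
  proof (rule tendsto_sandwich)
    show "\<forall>\<^sub>F b in sequentially. l * (1 - poisson_tail l b) \<le> (\<Sum>i<Suc b. poisson_tail l (Suc i))"
      unfolding eq using assms by (simp add: poisson_tail_nonneg)
    show "\<forall>\<^sub>F b in sequentially. (\<Sum>i<Suc b. poisson_tail l (Suc i)) \<le> l"
      unfolding eq using up by (simp add: algebra_simps)
    have "(\<lambda>b. l * (1 - poisson_tail l b)) \<longlonglongrightarrow> l * (1 - 0)"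
      by (intro tendsto_intros poisson_tail_tendsto_0)
    then show "(\<lambda>b. l * (1 - poisson_tail l b)) \<longlonglongrightarrow> l" by simp
  qed simp
  then show ?thesis unfolding sums_def by (subst (asm) filterlim_sequentially_Suc)
qed

text \<open>The law of small numbers along an arbitrary filter, because it will be applied to
  hypergraphs whose ground set and edge probability vary together.\<close>

lemma binomial_pmf_tendsto_poisson:
  fixes M :: "'a \<Rightarrow> nat" and p :: "'a \<Rightarrow> real"
  assumes Mp: "((\<lambda>x. real (M x) * p x) \<longlongrightarrow> l) F" and p: "(p \<longlongrightarrow> 0) F" "\<forall>\<^sub>F x in F. 0 \<le> p x"
  shows "((\<lambda>x. pmf (binomial_pmf (M x) (p x)) k) \<longlongrightarrow> l ^ k / fact k * exp (- l)) F"
proof -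
  have small: "\<forall>\<^sub>F x in F. 0 \<le> p x \<and> p x \<le> 1/2"
  proof -
    have "\<forall>\<^sub>F x in F. p x < 1/2" by (rule order_tendstoD(2)[OF p(1)]) simp
    with p(2) show ?thesis by eventually_elim auto
  qed
  have "((\<lambda>x. real (M x) * ln (1 - p x)) \<longlongrightarrow> - l) F"
  proof (rule tendsto_sandwich)
    show "\<forall>\<^sub>F x in F. - (real (M x) * p x) - 2 * (real (M x) * p x) * p x \<le> real (M x) * ln (1 - p x)"
      using small
    proof eventually_elim
      case (elim x)
      then have "- p x - 2 * (p x)\<^sup>2 \<le> ln (1 - p x)" by (intro ln_one_minus_pos_lower_bound) auto
      then have "real (M x) * (- p x - 2 * (p x)\<^sup>2) \<le> real (M x) * ln (1 - p x)" by (intro mult_left_mono) auto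
      then show ?case by (simp add: algebra_simps power2_eq_square)
    qed
    show "\<forall>\<^sub>F x in F. real (M x) * ln (1 - p x) \<le> - (real (M x) * p x)"
      using small
    proof eventually_elim
      case (elim x)
      then have "ln (1 - p x) \<le> - p x" using ln_one_minus_pos_upper_bound[of "p x"] by simp
      then have "real (M x) * ln (1 - p x) \<le> real (M x) * (- p x)" by (intro mult_left_mono) auto
      then show ?case by simp
    qed
    have "((\<lambda>x. - (real (M x) * p x) - 2 * (real (M x) * p x) * p x) \<longlongrightarrow> - l - 2 * l * 0) F"
      by (intro tendsto_intros Mp p)
    then show "((\<lambda>x. - (real (M x) * p x) - 2 * (real (M x) * p x) * p x) \<longlongrightarrow> - l) F" by simp
    show "((\<lambda>x. - (real (M x) * p x)) \<longlongrightarrow> - l) F" by (intro tendsto_intros Mp)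
  qed
  then have e: "((\<lambda>x. exp (real (M x) * ln (1 - p x))) \<longlongrightarrow> exp (- l)) F" by (rule tendsto_exp)
  have "((\<lambda>x. (\<Prod>i = 0..<k. real (M x) * p x - real i * p x) / fact k) \<longlongrightarrow> (\<Prod>i = 0..<k. l - real i * 0) / fact k) F"
    by (intro tendsto_intros Mp p) simp
  then have "((\<lambda>x. (\<Prod>i = 0..<k. real (M x) * p x - real i * p x) / fact k * exp (real (M x) * ln (1 - p x)) / (1 - p x) ^ k)
      \<longlongrightarrow> (\<Prod>i = 0..<k. l - real i * 0) / fact k * exp (- l) / (1 - 0) ^ k) F"
    by (intro tendsto_mult tendsto_divide tendsto_power tendsto_diff tendsto_const tendsto_prod e p Mp) auto
  then have lim: "((\<lambda>x. (\<Prod>i = 0..<k. real (M x) * p x - real i * p x) / fact k * exp (real (M x) * ln (1 - p x)) / (1 - p x) ^ k)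
      \<longlongrightarrow> l ^ k / fact k * exp (- l)) F" by simp
  show ?thesis
  proof (rule Lim_transform_eventually[OF lim])
    show "\<forall>\<^sub>F x in F. (\<Prod>i = 0..<k. real (M x) * p x - real i * p x) / fact k * exp (real (M x) * ln (1 - p x)) / (1 - p x) ^ k
        = pmf (binomial_pmf (M x) (p x)) k"
      using small
    proof eventually_elim
      case (elim x)
      have ex: "exp (real (M x) * ln (1 - p x)) = (1 - p x) ^ M x"
        using elim by (simp add: exp_of_nat_mult)
      have "(\<Prod>i = 0..<k. real (M x) * p x - real i * p x) = (\<Prod>i = 0..<k. p x * (real (M x) - real i))"
        by (simp add: algebra_simps)
      also have "\<dots> = p x ^ k * (\<Prod>i = 0..<k. real (M x) - real i)" by (simp add: prod.distrib)
      also have "(\<Prod>i = 0..<k. real (M x) - real i) = real (M x choose k) * fact k"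
        by (simp add: binomial_gbinomial gbinomial_prod_rev)
      finally have "(\<Prod>i = 0..<k. real (M x) * p x - real i * p x) / fact k * exp (real (M x) * ln (1 - p x)) / (1 - p x) ^ k
          = real (M x choose k) * p x ^ k * ((1 - p x) ^ M x / (1 - p x) ^ k)" by (simp add: ex)
      also have "\<dots> = real (M x choose k) * p x ^ k * (1 - p x) ^ (M x - k)"
      proof (cases "k \<le> M x")
        case True
        then show ?thesis using elim by (simp add: power_diff)
      qed (simp add: binomial_eq_0)
      finally show ?case using elim by simp
    qed
  qed
qed

section \<open>Sparse limits\<close>

text \<open>
  Ground sets \<open>V\<close> of growing size and edge probabilities \<open>p\<close> for which the expected number of
  links of a vertex tends to \<open>d\<close>. Working with this filter makes all estimates uniform in the
  ground set, so that they survive the deletion of a bounded number of vertices.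
\<close>

definition sparse :: "nat \<Rightarrow> real \<Rightarrow> (nat set \<times> real) filter" where
  "sparse m d = inf (filtercomap (\<lambda>(V, p). card V) at_top)
     (filtercomap (\<lambda>(V, p). p * real (card V choose m)) (nhds d))"

text \<open>Nothing is required of the subset A, so a property that holds eventually here holds
  uniformly over all subsets. In \<open>sparse_at\<close> the density of A is made to converge to
  a.\<close>

definition sparse_sub :: "nat \<Rightarrow> real \<Rightarrow> (nat set \<times> real \<times> nat set) filter" where
  "sparse_sub m d = inf (filtercomap (\<lambda>(V, p, A). (V, p)) (sparse m d)) (principal {(V, p, A). A \<subseteq> V})"

definition sparse_at :: "nat \<Rightarrow> real \<Rightarrow> real \<Rightarrow> (nat set \<times> real \<times> nat set) filter" where
  "sparse_at m d a = inf (filtercomap (\<lambda>(V, p, A). real (card A) / real (card V)) (nhds a)) (sparse_sub m d)"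

lemma eventually_sparse:
  "eventually P (sparse m d) \<longleftrightarrow> (\<exists>N \<delta>. 0 < \<delta> \<and>
     (\<forall>V p. N \<le> card V \<longrightarrow> \<bar>p * real (card V choose m) - d\<bar> < \<delta> \<longrightarrow> P (V, p)))" (is "?l \<longleftrightarrow> ?r")
proof
  assume ?l
  then obtain Q R where "eventually Q (filtercomap (\<lambda>(V, p). card V) at_top)"
    and "eventually R (filtercomap (\<lambda>(V, p). p * real (card V choose m)) (nhds d))"
    and QR: "\<And>x. Q x \<Longrightarrow> R x \<Longrightarrow> P x"
    unfolding sparse_def eventually_inf by auto
  then obtain N \<delta> where "\<And>x. N \<le> card (fst x) \<Longrightarrow> Q x" "0 < \<delta>"
    "\<And>x. \<bar>snd x * real (card (fst x) choose m) - d\<bar> < \<delta> \<Longrightarrow> R x"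
    unfolding eventually_filtercomap eventually_at_top_linorder eventually_nhds_metric dist_real_def case_prod_unfold
    by blast
  with QR show ?r by (intro exI[of _ N] exI[of _ \<delta>]) auto
next
  assume ?r
  then obtain N \<delta> where *: "0 < \<delta>"
    "\<And>V p. N \<le> card V \<Longrightarrow> \<bar>p * real (card V choose m) - d\<bar> < \<delta> \<Longrightarrow> P (V, p)" by blast
  have "eventually (\<lambda>n. N \<le> n) at_top" by (rule eventually_ge_at_top)
  moreover have "eventually (\<lambda>c. \<bar>c - d\<bar> < \<delta>) (nhds d)"
    unfolding eventually_nhds_metric dist_real_def using *(1) by auto
  ultimately show ?l
    unfolding sparse_def eventually_inf eventually_filtercomap case_prod_unfold
    by (intro exI[of _ "\<lambda>x. N \<le> card (fst x)"] exI[of _ "\<lambda>x. \<bar>snd x * real (card (fst x) choose m) - d\<bar> < \<delta>"] conjI)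
      (use *(2) in \<open>fastforce+\<close>)
qed

lemma eventually_sparse_sub:
  "eventually P (sparse_sub m d) \<longleftrightarrow> eventually (\<lambda>(V, p). \<forall>A\<subseteq>V. P (V, p, A)) (sparse m d)" (is "?l \<longleftrightarrow> ?r")
proof
  assume ?l
  then obtain Q where "eventually Q (sparse m d)" "\<And>V p A. Q (V, p) \<Longrightarrow> A \<subseteq> V \<Longrightarrow> P (V, p, A)"
    unfolding sparse_sub_def eventually_inf_principal eventually_filtercomap by auto
  then show ?r by (auto elim!: eventually_mono)
next
  assume ?r
  then show ?l
    unfolding sparse_sub_def eventually_inf_principal eventually_filtercomap
    by (intro exI[of _ "\<lambda>(V, p). \<forall>A\<subseteq>V. P (V, p, A)"]) auto
qed

lemma filterlim_card_sparse: "filterlim (\<lambda>x. card (fst x)) at_top (sparse m d)"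
  unfolding filterlim_at_top eventually_sparse by (auto intro: zero_less_one)

lemma tendsto_sparse: "((\<lambda>x. snd x * real (card (fst x) choose m)) \<longlongrightarrow> d) (sparse m d)"
  unfolding tendsto_iff eventually_sparse dist_real_def by auto

lemma tendsto_choose:
  assumes N: "filterlim (N :: 'a \<Rightarrow> nat) at_top F" and s: "((\<lambda>x. real (s x) / real (N x)) \<longlongrightarrow> b) F"
  shows "((\<lambda>x. real (s x choose m) / real (N x) ^ m) \<longlongrightarrow> b ^ m / fact m) F"
proof -
  have N': "filterlim (\<lambda>x. real (N x)) at_top F"
    using filterlim_compose[OF filterlim_real_sequentially N] .
  have "((\<lambda>x. (\<Prod>i = 0..<m. real (s x) / real (N x) - real i / real (N x)) / fact m)
      \<longlongrightarrow> (\<Prod>i = 0..<m. b - 0) / fact m) F"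
    by (intro tendsto_divide tendsto_prod tendsto_diff s tendsto_const)
      (auto intro!: tendsto_divide_0[OF tendsto_const] filterlim_at_top_imp_at_infinity N')
  then have lim: "((\<lambda>x. (\<Prod>i = 0..<m. real (s x) / real (N x) - real i / real (N x)) / fact m)
      \<longlongrightarrow> b ^ m / fact m) F" by simp
  show ?thesis
  proof (rule Lim_transform_eventually[OF lim], intro always_eventually allI)
    fix x
    have "(\<Prod>i = 0..<m. real (s x) / real (N x) - real i / real (N x)) = (\<Prod>i = 0..<m. (real (s x) - real i) / real (N x))"
      by (simp add: diff_divide_distrib)
    also have "\<dots> = (\<Prod>i = 0..<m. real (s x) - real i) / real (N x) ^ m" by (simp add: prod_dividef)
    also have "(\<Prod>i = 0..<m. real (s x) - real i) = real (s x choose m) * fact m"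
      by (simp add: binomial_gbinomial gbinomial_prod_rev)
    finally show "(\<Prod>i = 0..<m. real (s x) / real (N x) - real i / real (N x)) / fact m
      = real (s x choose m) / real (N x) ^ m" by simp
  qed
qed

section \<open>Counting the links that meet a given vertex set\<close>

definition hits :: "'a set \<Rightarrow> nat \<Rightarrow> 'a set \<Rightarrow> 'a set set" where
  "hits V m A = {l \<in> rsets V m. l \<inter> A \<noteq> {}}"

definition single_hits :: "'a set \<Rightarrow> nat \<Rightarrow> 'a set \<Rightarrow> 'a set set" where
  "single_hits V m A = {l \<in> rsets V m. card (l \<inter> A) = 1}"

lemma finite_hits [simp]: "finite V \<Longrightarrow> finite (hits V m A)" "finite V \<Longrightarrow> finite (single_hits V m A)"
  by (auto simp: hits_def single_hits_def)

lemma card_hits: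
  assumes "finite V" "A \<subseteq> V"
  shows "real (card (hits V m A)) = real (card V choose m) - real ((card V - card A) choose m)"
proof -
  have "rsets V m = hits V m A \<union> rsets (V - A) m" "hits V m A \<inter> rsets (V - A) m = {}"
    by (auto simp: hits_def rsets_def)
  then have "card (rsets V m) = card (hits V m A) + card (rsets (V - A) m)"
    using assms by (simp add: card_Un_disjoint)
  then show ?thesis
    using assms finite_subset[OF assms(2,1)] by (simp add: card_rsets card_Diff_subset)
qed

lemma card_single_hits:
  assumes "finite V" "A \<subseteq> V" "1 \<le> m"
  shows "card (single_hits V m A) = card A * ((card V - card A) choose (m - 1))"
proof -
  have finA: "finite A" using assms finite_subset by blast
  have "bij_betw (\<lambda>(a, l). insert a l) (A \<times> rsets (V - A) (m - 1)) (single_hits V m A)"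
  proof (rule bij_betwI[where g = "\<lambda>l. (the_elem (l \<inter> A), l - A)"])
    show "(\<lambda>(a, l). insert a l) \<in> A \<times> rsets (V - A) (m - 1) \<rightarrow> single_hits V m A"
    proof safe
      fix a l assume "a \<in> A" "l \<in> rsets (V - A) (m - 1)"
      then have l: "a \<notin> l" "l \<subseteq> V - A" "card l = m - 1" "finite l"
        using assms(1) by (auto simp: rsets_def intro: finite_subset)
      moreover have "insert a l \<inter> A = {a}" using l \<open>a \<in> A\<close> by auto
      ultimately show "insert a l \<in> single_hits V m A"
        using assms \<open>a \<in> A\<close> by (auto simp: single_hits_def rsets_def)
    qed
    show "(\<lambda>l. (the_elem (l \<inter> A), l - A)) \<in> single_hits V m A \<rightarrow> A \<times> rsets (V - A) (m - 1)"
    proof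
      fix l assume l: "l \<in> single_hits V m A"
      then obtain a where a: "l \<inter> A = {a}" by (auto simp: single_hits_def card_1_singleton_iff)
      have "card (l - A) = card l - card (l \<inter> A)"
        using finA by (intro card_Diff_subset_Int) auto
      with l a show "(the_elem (l \<inter> A), l - A) \<in> A \<times> rsets (V - A) (m - 1)"
        by (auto simp: single_hits_def rsets_def)
    qed
    show "(the_elem ((case x of (a, l) \<Rightarrow> insert a l) \<inter> A), (case x of (a, l) \<Rightarrow> insert a l) - A) = x"
      if "x \<in> A \<times> rsets (V - A) (m - 1)" for x
    proof -
      obtain a l where x: "x = (a, l)" "a \<in> A" "l \<subseteq> V - A" using \<open>x \<in> _\<close> by (auto simp: rsets_def)
      then have "insert a l \<inter> A = {a}" "insert a l - A = l" by auto
      with x(1) show ?thesis by (simp only: prod.case the_elem_eq)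
    qed
    show "(case (the_elem (l \<inter> A), l - A) of (a, l) \<Rightarrow> insert a l) = l" if "l \<in> single_hits V m A" for l
    proof -
      have "card (l \<inter> A) = 1" using that by (simp add: single_hits_def)
      then obtain a where a: "l \<inter> A = {a}" by (rule card_1_singletonE)
      then show ?thesis by auto
    qed
  qed
  then have "card (single_hits V m A) = card (A \<times> rsets (V - A) (m - 1))"
    using bij_betw_same_card by metis
  then show ?thesis
    using assms finA by (simp add: card_cartesian_product card_rsets card_Diff_subset)
qed

lemma prob_card_Int_ge:
  assumes "finite S" "A \<subseteq> S" "0 \<le> p" "p \<le> 1"
  shows "measure_pmf.prob (random_subset S p) {X. i \<le> card (X \<inter> A)} = 1 - (\<Sum>k<i. pmf (binomial_pmf (card A) p) k)"
proof -
  have finA: "finite A" using assms finite_subset by blast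
  have "measure_pmf.prob (random_subset S p) {X. i \<le> card (X \<inter> A)} = measure_pmf.prob (random_subset A p) {X. i \<le> card X}"
    by (rule prob_random_subset_Int[OF assms(1,2)])
  also have "\<dots> = measure_pmf.prob (map_pmf card (random_subset A p)) {k. i \<le> k}"
    by (simp add: vimage_def)
  also have "\<dots> = measure_pmf.prob (binomial_pmf (card A) p) {k. \<not> k < i}"
    by (simp add: map_card_random_subset[OF finA assms(3,4)] not_less)
  also have "\<dots> = 1 - measure_pmf.prob (binomial_pmf (card A) p) {..<i}"
    unfolding prob_Not by (simp add: lessThan_def)
  finally show ?thesis by (simp add: measure_measure_pmf_finite)
qed

lemma prob_card_Int_tendsto:
  fixes S A :: "'x \<Rightarrow> 'a set"
  assumes ev: "\<forall>\<^sub>F x in F. finite (S x) \<and> A x \<subseteq> S x \<and> 0 \<le> p x \<and> p x \<le> 1"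
    and p: "(p \<longlongrightarrow> 0) F" and l: "((\<lambda>x. p x * real (card (A x))) \<longlongrightarrow> l) F"
  shows "((\<lambda>x. measure_pmf.prob (random_subset (S x) (p x)) {X. i \<le> card (X \<inter> A x)}) \<longlongrightarrow> poisson_tail l i) F"
proof -
  have "((\<lambda>x. 1 - (\<Sum>k<i. pmf (binomial_pmf (card (A x)) (p x)) k)) \<longlongrightarrow> 1 - (\<Sum>k<i. l ^ k / fact k * exp (- l))) F"
    using ev by (intro tendsto_intros binomial_pmf_tendsto_poisson p)
      (use l in \<open>auto elim: eventually_mono simp: mult.commute\<close>)
  then have lim: "((\<lambda>x. 1 - (\<Sum>k<i. pmf (binomial_pmf (card (A x)) (p x)) k)) \<longlongrightarrow> poisson_tail l i) F"
    by (simp add: poisson_tail_def)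
  show ?thesis
    by (rule Lim_transform_eventually[OF lim]) (use ev in eventually_elim, simp add: prob_card_Int_ge)
qed


text \<open>Powers in place of binomial coefficients: in this form the union bounds over links and
  the counts of links of a given type can be compared directly.\<close>

lemma sparse_power:
  "((\<lambda>x. snd x * real (card (fst x)) ^ m) \<longlongrightarrow> d * fact m) (sparse m d)"
proof -
  let ?N = "\<lambda>x::nat set \<times> real. card (fst x)"
  have pos: "\<forall>\<^sub>F x in sparse m d. 0 < ?N x"
    using filterlim_card_sparse[of m d] unfolding filterlim_at_top by (auto elim: eventually_mono simp: Suc_le_eq dest: spec[of _ 1])
  have "((\<lambda>x. real (?N x) / real (?N x)) \<longlongrightarrow> 1) (sparse m d)"
    by (rule Lim_transform_eventually[OF tendsto_const]) (use pos in eventually_elim, simp)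
  then have "((\<lambda>x. real (?N x choose m) / real (?N x) ^ m) \<longlongrightarrow> 1 ^ m / fact m) (sparse m d)"
    by (intro tendsto_choose filterlim_card_sparse)
  then have "((\<lambda>x. snd x * real (?N x choose m) / (real (?N x choose m) / real (?N x) ^ m)) \<longlongrightarrow> d / (1 ^ m / fact m)) (sparse m d)"
    by (rule tendsto_divide[OF tendsto_sparse]) simp
  then have lim: "((\<lambda>x. snd x * real (?N x choose m) / (real (?N x choose m) / real (?N x) ^ m)) \<longlongrightarrow> d * fact m) (sparse m d)"
    by simp
  have ge: "\<forall>\<^sub>F x in sparse m d. m \<le> ?N x"
    using filterlim_card_sparse[of m d] unfolding filterlim_at_top by blast
  show ?thesis
    by (rule Lim_transform_eventually[OF lim]) (use pos ge in eventually_elim, simp)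
qed

lemma sparse_pos:
  assumes "0 < d"
  shows "\<forall>\<^sub>F x in sparse m d. 0 < snd x"
  using order_tendstoD(1)[OF tendsto_sparse assms] by eventually_elim (simp add: zero_less_mult_iff)

lemma sparse_prob_tendsto:
  assumes "1 \<le> m"
  shows "(snd \<longlongrightarrow> 0) (sparse m d)"
proof -
  let ?N = "\<lambda>x::nat set \<times> real. real (card (fst x))"
  have N: "filterlim ?N at_top (sparse m d)"
    using filterlim_compose[OF filterlim_real_sequentially filterlim_card_sparse] .
  then have "filterlim (\<lambda>x. ?N x ^ m) at_top (sparse m d)"
    using assms by (intro filterlim_pow_at_top) auto
  then have "((\<lambda>x. snd x * ?N x ^ m / ?N x ^ m) \<longlongrightarrow> 0) (sparse m d)"
    by (intro tendsto_divide_0[OF sparse_power] filterlim_at_top_imp_at_infinity)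
  moreover have "\<forall>\<^sub>F x in sparse m d. 0 < ?N x"
    using N unfolding filterlim_at_top_dense by blast
  then have "\<forall>\<^sub>F x in sparse m d. snd x * ?N x ^ m / ?N x ^ m = snd x"
    by eventually_elim simp
  ultimately show ?thesis by (rule Lim_transform_eventually)
qed

lemma sparse_prob_range:
  assumes "0 < d" "1 \<le> m"
  shows "\<forall>\<^sub>F x in sparse m d. finite (fst x) \<and> 0 < snd x \<and> snd x \<le> 1"
proof -
  have "\<forall>\<^sub>F x in sparse m d. snd x < 1" using order_tendstoD(2)[OF sparse_prob_tendsto[OF assms(2)]] by simp
  moreover have "\<forall>\<^sub>F x in sparse m d. 1 \<le> card (fst x)"
    using filterlim_card_sparse[of m d] unfolding filterlim_at_top by blast
  ultimately show ?thesis using sparse_pos[OF assms(1)]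
    by eventually_elim (auto intro: card_ge_0_finite)
qed

section \<open>Limiting link probabilities for vertex sets of density a\<close>

locale sparse_limit = fixpoint +
  fixes a :: real
  assumes a: "0 \<le> a" "a \<le> 1"
begin

text \<open>The limiting mean number of links that meet A. Hence \<open>1 - exp (- lam)\<close> is
  \<open>survival m d a\<close>.\<close>

definition lam where "lam = d * (1 - (1 - a) ^ m)"

lemma sub: "filterlim (\<lambda>x. (fst x, fst (snd x))) (sparse m d) (sparse_at m d a)"
  unfolding filterlim_iff_le_filtercomap sparse_at_def sparse_sub_def case_prod_unfold
  by (intro le_infI2 le_infI1 order_refl)

lemma ratio: "((\<lambda>x. real (card (snd (snd x))) / real (card (fst x))) \<longlongrightarrow> a) (sparse_at m d a)"
  unfolding filterlim_iff_le_filtercomap sparse_at_def case_prod_unfold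
  by (intro le_infI1 order_refl)

lemma range: "\<forall>\<^sub>F x in sparse_at m d a. finite (fst x) \<and> 0 < fst (snd x) \<and> fst (snd x) \<le> 1 \<and>
    snd (snd x) \<subseteq> fst x \<and> finite (snd (snd x))"
proof -
  have "\<forall>\<^sub>F x in sparse_at m d a. snd (snd x) \<subseteq> fst x"
    unfolding sparse_at_def sparse_sub_def inf_assoc[symmetric] eventually_inf_principal
    by (intro always_eventually) (auto simp: case_prod_unfold)
  moreover have "\<forall>\<^sub>F x in sparse_at m d a. finite (fst x) \<and> 0 < fst (snd x) \<and> fst (snd x) \<le> 1"
    using eventually_compose_filterlim[OF sparse_prob_range sub] m d by simp
  ultimately show ?thesis by eventually_elim (auto intro: finite_subset)
qed

lemma p_tendsto: "((\<lambda>x. fst (snd x)) \<longlongrightarrow> 0) (sparse_at m d a)"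
  using filterlim_compose[OF sparse_prob_tendsto sub] m by simp

lemma card_at_top: "filterlim (\<lambda>x. card (fst x)) at_top (sparse_at m d a)"
  using filterlim_compose[OF filterlim_card_sparse sub] by simp

lemma power_tendsto: "((\<lambda>x. fst (snd x) * real (card (fst x)) ^ m) \<longlongrightarrow> d * fact m) (sparse_at m d a)"
  using filterlim_compose[OF sparse_power sub] by simp

lemma total_tendsto: "((\<lambda>x. fst (snd x) * real (card (rsets (fst x) m))) \<longlongrightarrow> d) (sparse_at m d a)"
proof -
  have "((\<lambda>x. fst (snd x) * real (card (fst x) choose m)) \<longlongrightarrow> d) (sparse_at m d a)"
    using filterlim_compose[OF tendsto_sparse sub] by simp
  then show ?thesis
    by (rule Lim_transform_eventually) (use range in eventually_elim, simp add: card_rsets)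
qed

lemma co_ratio: "((\<lambda>x. real (card (fst x) - card (snd (snd x))) / real (card (fst x))) \<longlongrightarrow> 1 - a) (sparse_at m d a)"
proof -
  have "\<forall>\<^sub>F x in sparse_at m d a. 1 \<le> card (fst x)"
    using card_at_top unfolding filterlim_at_top by blast
  then have "\<forall>\<^sub>F x in sparse_at m d a. 1 - real (card (snd (snd x))) / real (card (fst x)) =
      real (card (fst x) - card (snd (snd x))) / real (card (fst x))"
    using range by eventually_elim (auto simp: of_nat_diff card_mono diff_divide_distrib)
  then show ?thesis by (rule Lim_transform_eventually[OF tendsto_diff[OF tendsto_const ratio]])
qed

lemma choose_tendsto:
  assumes "k \<le> m"
  shows "((\<lambda>x. fst (snd x) * real (card (fst x)) ^ (m - k) * real ((card (fst x) - card (snd (snd x))) choose k))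
    \<longlongrightarrow> d * fact m * (1 - a) ^ k / fact k) (sparse_at m d a)"
proof -
  have "\<forall>\<^sub>F x in sparse_at m d a. 1 \<le> card (fst x)"
    using card_at_top unfolding filterlim_at_top by blast
  then have "\<forall>\<^sub>F x in sparse_at m d a. fst (snd x) * real (card (fst x)) ^ m * (real ((card (fst x) - card (snd (snd x))) choose k) / real (card (fst x)) ^ k)
      = fst (snd x) * real (card (fst x)) ^ (m - k) * real ((card (fst x) - card (snd (snd x))) choose k)"
    by eventually_elim (use assms in \<open>simp add: power_diff\<close>)
  from Lim_transform_eventually[OF tendsto_mult[OF power_tendsto tendsto_choose[OF card_at_top co_ratio]] this]
  show ?thesis by simp
qed

lemma miss_tendsto: "((\<lambda>x. fst (snd x) * real (card (rsets (fst x - snd (snd x)) m))) \<longlongrightarrow> d * (1 - a) ^ m) (sparse_at m d a)"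
proof -
  have "((\<lambda>x. fst (snd x) * real ((card (fst x) - card (snd (snd x))) choose m)) \<longlongrightarrow> d * (1 - a) ^ m) (sparse_at m d a)"
    using choose_tendsto[of m] by simp
  then show ?thesis
    by (rule Lim_transform_eventually) (use range in eventually_elim, simp add: card_rsets card_Diff_subset)
qed

lemma hits_tendsto: "((\<lambda>x. fst (snd x) * real (card (hits (fst x) m (snd (snd x))))) \<longlongrightarrow> lam) (sparse_at m d a)"
proof -
  have "((\<lambda>x. fst (snd x) * real (card (rsets (fst x) m)) - fst (snd x) * real (card (rsets (fst x - snd (snd x)) m)))
      \<longlongrightarrow> d - d * (1 - a) ^ m) (sparse_at m d a)"
    by (intro tendsto_diff total_tendsto miss_tendsto)
  moreover have "d - d * (1 - a) ^ m = lam" by (simp add: lam_def algebra_simps)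
  moreover have "\<forall>\<^sub>F x in sparse_at m d a. fst (snd x) * real (card (rsets (fst x) m)) - fst (snd x) * real (card (rsets (fst x - snd (snd x)) m))
    = fst (snd x) * real (card (hits (fst x) m (snd (snd x))))"
    using range by eventually_elim (simp add: card_rsets card_hits card_Diff_subset right_diff_distrib)
  ultimately show ?thesis using Lim_transform_eventually by fastforce
qed

lemma single_tendsto:
  "((\<lambda>x. fst (snd x) * real (card (single_hits (fst x) m (snd (snd x))))) \<longlongrightarrow> d * real m * a * (1 - a) ^ (m - 1)) (sparse_at m d a)"
proof -
  have *: "d * fact m * (1 - a) ^ (m - 1) / fact (m - 1) = d * real m * (1 - a) ^ (m - 1)"
    using m by (simp add: fact_reduce)
  have "((\<lambda>x. fst (snd x) * real (card (fst x)) ^ (m - (m - 1)) * real ((card (fst x) - card (snd (snd x))) choose (m - 1))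
      * (real (card (snd (snd x))) / real (card (fst x)))) \<longlongrightarrow> d * real m * (1 - a) ^ (m - 1) * a) (sparse_at m d a)"
    unfolding *[symmetric] by (intro tendsto_mult choose_tendsto ratio) simp
  moreover have "\<forall>\<^sub>F x in sparse_at m d a. 1 \<le> card (fst x)"
    using card_at_top unfolding filterlim_at_top by blast
  then have "\<forall>\<^sub>F x in sparse_at m d a. fst (snd x) * real (card (fst x)) ^ (m - (m - 1)) * real ((card (fst x) - card (snd (snd x))) choose (m - 1))
      * (real (card (snd (snd x))) / real (card (fst x))) = fst (snd x) * real (card (single_hits (fst x) m (snd (snd x))))"
    using range by eventually_elim (use m in \<open>simp add: card_single_hits\<close>)
  ultimately have "((\<lambda>x. fst (snd x) * real (card (single_hits (fst x) m (snd (snd x))))) \<longlongrightarrow> d * real m * (1 - a) ^ (m - 1) * a) (sparse_at m d a)"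
    by (rule Lim_transform_eventually)
  then show ?thesis by (simp add: mult_ac)
qed

lemma prob_hits_ge:
  "((\<lambda>(V, p, A). measure_pmf.prob (random_subset (rsets V m) p) {L. i \<le> card {l \<in> L. l \<inter> A \<noteq> {}}})
    \<longlongrightarrow> poisson_tail lam i) (sparse_at m d a)"
proof -
  have "((\<lambda>x. measure_pmf.prob (random_subset (rsets (fst x) m) (fst (snd x))) {X. i \<le> card (X \<inter> hits (fst x) m (snd (snd x)))})
      \<longlongrightarrow> poisson_tail lam i) (sparse_at m d a)"
    by (rule prob_card_Int_tendsto[OF _ p_tendsto hits_tendsto])
      (use range in eventually_elim, auto simp: hits_def)
  moreover have "measure_pmf.prob (random_subset (rsets V m) p) {X. i \<le> card (X \<inter> hits V m A)} =
      measure_pmf.prob (random_subset (rsets V m) p) {L. i \<le> card {l \<in> L. l \<inter> A \<noteq> {}}}" for V p and A :: "nat set"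
  proof (rule prob_cong)
    fix L assume "L \<in> set_pmf (random_subset (rsets V m) p)"
    then have "L \<inter> hits V m A = {l \<in> L. l \<inter> A \<noteq> {}}" using random_subsetD by (fastforce simp: hits_def)
    then show "L \<in> {X. i \<le> card (X \<inter> hits V m A)} \<longleftrightarrow> L \<in> {L. i \<le> card {l \<in> L. l \<inter> A \<noteq> {}}}" by simp
  qed
  ultimately show ?thesis by (simp add: case_prod_unfold)
qed

text \<open>From the event of at least i links the part without any hit is subtracted. That part
  factorizes, because links meeting A and links missing A are independent, with limiting rates
  \<open>lam\<close> and \<open>d * (1 - a) ^ m\<close>.\<close>

lemma prob_hit_and_ge:
  "((\<lambda>(V, p, A). measure_pmf.prob (random_subset (rsets V m) p) {L. (\<exists>l\<in>L. l \<inter> A \<noteq> {}) \<and> i \<le> card L})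
    \<longlongrightarrow> poisson_tail d i - exp (- lam) * poisson_tail (d * (1 - a) ^ m) i) (sparse_at m d a)"
proof -
  let ?S = "\<lambda>x. rsets (fst x) m" and ?p = "\<lambda>x::nat set \<times> real \<times> nat set. fst (snd x)"
  let ?H = "\<lambda>x. hits (fst x) m (snd (snd x))" and ?M = "\<lambda>x. rsets (fst x - snd (snd x)) m"
  have 1: "((\<lambda>x. measure_pmf.prob (random_subset (?S x) (?p x)) {X. i \<le> card (X \<inter> ?S x)}) \<longlongrightarrow> poisson_tail d i) (sparse_at m d a)"
    by (rule prob_card_Int_tendsto[OF _ p_tendsto total_tendsto]) (use range in eventually_elim, auto)
  have 2: "((\<lambda>x. measure_pmf.prob (random_subset (?H x) (?p x)) {X. 1 \<le> card (X \<inter> ?H x)}) \<longlongrightarrow> poisson_tail lam 1) (sparse_at m d a)"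
    by (rule prob_card_Int_tendsto[OF _ p_tendsto hits_tendsto]) (use range in eventually_elim, auto)
  have 3: "((\<lambda>x. measure_pmf.prob (random_subset (?M x) (?p x)) {X. i \<le> card (X \<inter> ?M x)}) \<longlongrightarrow> poisson_tail (d * (1 - a) ^ m) i) (sparse_at m d a)"
    by (rule prob_card_Int_tendsto[OF _ p_tendsto miss_tendsto]) (use range in eventually_elim, auto)
  have lim: "((\<lambda>x. measure_pmf.prob (random_subset (?S x) (?p x)) {X. i \<le> card (X \<inter> ?S x)} -
      (1 - measure_pmf.prob (random_subset (?H x) (?p x)) {X. 1 \<le> card (X \<inter> ?H x)}) *
      measure_pmf.prob (random_subset (?M x) (?p x)) {X. i \<le> card (X \<inter> ?M x)})
      \<longlongrightarrow> poisson_tail d i - (1 - poisson_tail lam 1) * poisson_tail (d * (1 - a) ^ m) i) (sparse_at m d a)"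
    by (intro tendsto_intros 1 2 3)
  have "\<forall>\<^sub>F x in sparse_at m d a.
      measure_pmf.prob (random_subset (?S x) (?p x)) {X. i \<le> card (X \<inter> ?S x)} -
      (1 - measure_pmf.prob (random_subset (?H x) (?p x)) {X. 1 \<le> card (X \<inter> ?H x)}) *
      measure_pmf.prob (random_subset (?M x) (?p x)) {X. i \<le> card (X \<inter> ?M x)} =
      (case x of (V, p, A) \<Rightarrow> measure_pmf.prob (random_subset (rsets V m) p) {L. (\<exists>l\<in>L. l \<inter> A \<noteq> {}) \<and> i \<le> card L})"
    using range
  proof eventually_elim
    case (elim x)
    obtain V p A where x: "x = (V, p, A)" by (cases x)
    with elim have V: "finite V" "A \<subseteq> V" by auto
    let ?P = "measure_pmf.prob (random_subset (rsets V m) p)"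
    have sub: "hits V m A \<subseteq> rsets V m" "rsets (V - A) m \<subseteq> rsets V m" "hits V m A \<inter> rsets (V - A) m = {}"
      by (auto simp: hits_def rsets_def)
    have "?P {L. L \<inter> hits V m A = {} \<and> i \<le> card (L \<inter> rsets (V - A) m)} =
      measure_pmf.prob (random_subset (hits V m A) p) {X. X = {}} * measure_pmf.prob (random_subset (rsets (V - A) m) p) {X. i \<le> card X}"
      using V sub by (intro prob_random_subset_indep) auto
    moreover have "measure_pmf.prob (random_subset (hits V m A) p) {X. X = {}} =
        measure_pmf.prob (random_subset (hits V m A) p) {X. \<not> 1 \<le> card (X \<inter> hits V m A)}"
    proof (rule prob_cong)
      fix X assume "X \<in> set_pmf (random_subset (hits V m A) p)"
      then have X: "X \<subseteq> hits V m A" by (rule random_subsetD)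
      then have "finite X" by (rule finite_subset) (simp add: V)
      with X have "X \<inter> hits V m A = X" "finite X" by auto
      then show "X \<in> {X. X = {}} \<longleftrightarrow> X \<in> {X. \<not> 1 \<le> card (X \<inter> hits V m A)}" by (auto simp: Suc_le_eq card_gt_0_iff)
    qed
    moreover have "measure_pmf.prob (random_subset (rsets (V - A) m) p) {X. i \<le> card X} =
        measure_pmf.prob (random_subset (rsets (V - A) m) p) {X. i \<le> card (X \<inter> rsets (V - A) m)}"
      by (rule prob_cong) (use random_subsetD in \<open>fastforce simp: Int_absorb2\<close>)
    moreover have "?P {L. L \<inter> hits V m A = {} \<and> i \<le> card (L \<inter> rsets (V - A) m)} =
        ?P ({X. i \<le> card (X \<inter> rsets V m)} - {L. (\<exists>l\<in>L. l \<inter> A \<noteq> {}) \<and> i \<le> card L})"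
    proof (rule prob_cong)
      fix L assume "L \<in> set_pmf (random_subset (rsets V m) p)"
      then have L: "L \<subseteq> rsets V m" by (rule random_subsetD)
      then have "L \<inter> hits V m A = {} \<longleftrightarrow> \<not> (\<exists>l\<in>L. l \<inter> A \<noteq> {})" by (auto simp: hits_def)
      moreover have "L \<inter> rsets (V - A) m = L" if "\<not> (\<exists>l\<in>L. l \<inter> A \<noteq> {})" using L that by (auto simp: rsets_def)
      moreover have "L \<inter> rsets V m = L" using L by auto
      ultimately show "L \<in> {L. L \<inter> hits V m A = {} \<and> i \<le> card (L \<inter> rsets (V - A) m)} \<longleftrightarrow>
        L \<in> {X. i \<le> card (X \<inter> rsets V m)} - {L. (\<exists>l\<in>L. l \<inter> A \<noteq> {}) \<and> i \<le> card L}" by auto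
    qed
    moreover have "?P ({X. i \<le> card (X \<inter> rsets V m)} - {L. (\<exists>l\<in>L. l \<inter> A \<noteq> {}) \<and> i \<le> card L}) =
        ?P {X. i \<le> card (X \<inter> rsets V m)} - ?P {L. (\<exists>l\<in>L. l \<inter> A \<noteq> {}) \<and> i \<le> card L}"
    proof -
      have "?P {L. (\<exists>l\<in>L. l \<inter> A \<noteq> {}) \<and> i \<le> card L} = ?P ({X. i \<le> card (X \<inter> rsets V m)} \<inter> {L. (\<exists>l\<in>L. l \<inter> A \<noteq> {}) \<and> i \<le> card L})"
        by (rule prob_cong) (use random_subsetD in \<open>fastforce simp: Int_absorb2\<close>)
      then show ?thesis by (simp add: measure_pmf.finite_measure_Diff')
    qed
    ultimately show ?case by (simp add: x prob_Not)
  qed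
  from Lim_transform_eventually[OF lim this] show ?thesis by simp
qed

text \<open>The complementary event says that no link has two elements in A and that at most one
  link has exactly one. With l1 the rate of the latter kind, independence gives the limit
  \<open>exp (- (lam - l1))\<close> times \<open>exp (- l1) * (1 + l1)\<close>.\<close>

lemma prob_core_hit:
  "((\<lambda>(V, p, A). measure_pmf.prob (random_subset (rsets V m) p)
      {L. 2 \<le> card {l \<in> L. l \<inter> A \<noteq> {}} \<or> (\<exists>l\<in>L. 2 \<le> card (l \<inter> A))})
    \<longlongrightarrow> 1 - exp (- lam) * (1 + d * real m * a * (1 - a) ^ (m - 1))) (sparse_at m d a)"
proof -
  define l1 where "l1 = d * real m * a * (1 - a) ^ (m - 1)"
  let ?p = "\<lambda>x::nat set \<times> real \<times> nat set. fst (snd x)"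
  let ?H = "\<lambda>x. hits (fst x) m (snd (snd x)) - single_hits (fst x) m (snd (snd x))"
  let ?M = "\<lambda>x. single_hits (fst x) m (snd (snd x))"
  have sh: "single_hits V m A \<subseteq> hits V m A" for V and A :: "nat set"
    by (auto simp: single_hits_def hits_def card_1_singleton_iff)
  have "((\<lambda>x. ?p x * real (card (hits (fst x) m (snd (snd x)))) - ?p x * real (card (?M x))) \<longlongrightarrow> lam - l1) (sparse_at m d a)"
    unfolding l1_def by (intro tendsto_diff hits_tendsto single_tendsto)
  moreover have "\<forall>\<^sub>F x in sparse_at m d a. ?p x * real (card (hits (fst x) m (snd (snd x)))) - ?p x * real (card (?M x)) = ?p x * real (card (?H x))"
    using range
  proof eventually_elim
    case (elim x)
    then have "finite (hits (fst x) m (snd (snd x)))" by simp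
    then have "real (card (?H x)) = real (card (hits (fst x) m (snd (snd x)))) - real (card (?M x))"
      using sh by (subst card_Diff_subset) (auto intro: finite_subset simp: of_nat_diff card_mono)
    then show ?case by (simp add: right_diff_distrib)
  qed
  ultimately have H: "((\<lambda>x. ?p x * real (card (?H x))) \<longlongrightarrow> lam - l1) (sparse_at m d a)"
    by (rule Lim_transform_eventually)
  have 2: "((\<lambda>x. measure_pmf.prob (random_subset (?H x) (?p x)) {X. 1 \<le> card (X \<inter> ?H x)}) \<longlongrightarrow> poisson_tail (lam - l1) 1) (sparse_at m d a)"
    by (rule prob_card_Int_tendsto[OF _ p_tendsto H]) (use range in eventually_elim, auto)
  have 3: "((\<lambda>x. measure_pmf.prob (random_subset (?M x) (?p x)) {X. 2 \<le> card (X \<inter> ?M x)}) \<longlongrightarrow> poisson_tail l1 2) (sparse_at m d a)"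
    unfolding l1_def by (rule prob_card_Int_tendsto[OF _ p_tendsto single_tendsto]) (use range in eventually_elim, auto)
  have lim: "((\<lambda>x. 1 - (1 - measure_pmf.prob (random_subset (?H x) (?p x)) {X. 1 \<le> card (X \<inter> ?H x)}) *
      (1 - measure_pmf.prob (random_subset (?M x) (?p x)) {X. 2 \<le> card (X \<inter> ?M x)}))
      \<longlongrightarrow> 1 - (1 - poisson_tail (lam - l1) 1) * (1 - poisson_tail l1 2)) (sparse_at m d a)"
    by (intro tendsto_intros 2 3)
  have "(1 - poisson_tail (lam - l1) 1) * (1 - poisson_tail l1 2) = exp (- lam) * (1 + l1)"
  proof -
    have "1 - poisson_tail l1 2 = exp (- l1) * (1 + l1)"
      by (simp add: poisson_tail_def numeral_2_eq_2 algebra_simps)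
    moreover have "exp (- (lam - l1)) * exp (- l1) = exp (- lam)" by (simp flip: exp_add)
    ultimately show ?thesis by simp
  qed
  with lim have lim: "((\<lambda>x. 1 - (1 - measure_pmf.prob (random_subset (?H x) (?p x)) {X. 1 \<le> card (X \<inter> ?H x)}) *
      (1 - measure_pmf.prob (random_subset (?M x) (?p x)) {X. 2 \<le> card (X \<inter> ?M x)}))
      \<longlongrightarrow> 1 - exp (- lam) * (1 + l1)) (sparse_at m d a)" by simp
  have "\<forall>\<^sub>F x in sparse_at m d a.
      1 - (1 - measure_pmf.prob (random_subset (?H x) (?p x)) {X. 1 \<le> card (X \<inter> ?H x)}) *
      (1 - measure_pmf.prob (random_subset (?M x) (?p x)) {X. 2 \<le> card (X \<inter> ?M x)}) =
      (case x of (V, p, A) \<Rightarrow> measure_pmf.prob (random_subset (rsets V m) p)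
        {L. 2 \<le> card {l \<in> L. l \<inter> A \<noteq> {}} \<or> (\<exists>l\<in>L. 2 \<le> card (l \<inter> A))})"
    using range
  proof eventually_elim
    case (elim x)
    obtain V p A where x: "x = (V, p, A)" by (cases x)
    with elim have V: "finite V" "A \<subseteq> V" by auto
    let ?P = "measure_pmf.prob (random_subset (rsets V m) p)"
    define G where "G = hits V m A - single_hits V m A"
    define T where "T = single_hits V m A"
    have finG: "finite G" "finite T" using V by (auto simp: G_def T_def)
    have "?P {L. L \<inter> G = {} \<and> \<not> 2 \<le> card (L \<inter> T)} =
      measure_pmf.prob (random_subset G p) {X. X = {}} * measure_pmf.prob (random_subset T p) {X. \<not> 2 \<le> card X}"
      using V by (intro prob_random_subset_indep) (auto simp: G_def T_def hits_def single_hits_def)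
    moreover have "measure_pmf.prob (random_subset G p) {X. X = {}} = measure_pmf.prob (random_subset G p) {X. \<not> 1 \<le> card (X \<inter> G)}"
    proof (rule prob_cong)
      fix X assume "X \<in> set_pmf (random_subset G p)"
      then have X: "X \<subseteq> G" by (rule random_subsetD)
      then have "finite X" by (rule finite_subset) (rule finG)
      with X have "X \<inter> G = X" "finite X" by auto
      then show "X \<in> {X. X = {}} \<longleftrightarrow> X \<in> {X. \<not> 1 \<le> card (X \<inter> G)}" by (auto simp: Suc_le_eq card_gt_0_iff)
    qed
    moreover have "measure_pmf.prob (random_subset T p) {X. \<not> 2 \<le> card X} = measure_pmf.prob (random_subset T p) {X. \<not> 2 \<le> card (X \<inter> T)}"
    proof (rule prob_cong)
      fix X assume "X \<in> set_pmf (random_subset T p)"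
      then have "X \<inter> T = X" using random_subsetD[of X T p] by auto
      then show "X \<in> {X. \<not> 2 \<le> card X} \<longleftrightarrow> X \<in> {X. \<not> 2 \<le> card (X \<inter> T)}" by simp
    qed
    moreover have "?P {L. L \<inter> G = {} \<and> \<not> 2 \<le> card (L \<inter> T)} =
      ?P {L. \<not> (2 \<le> card {l \<in> L. l \<inter> A \<noteq> {}} \<or> (\<exists>l\<in>L. 2 \<le> card (l \<inter> A)))}"
    proof (rule prob_cong)
      fix L assume "L \<in> set_pmf (random_subset (rsets V m) p)"
      then have L: "L \<subseteq> rsets V m" by (rule random_subsetD)
      have "l \<in> hits V m A \<longleftrightarrow> 1 \<le> card (l \<inter> A)" if "l \<in> L" for l
      proof -
        have "finite A" by (rule finite_subset[OF V(2,1)])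
        then show ?thesis using L that by (auto simp: hits_def Suc_le_eq card_gt_0_iff)
      qed
      then have "l \<in> G \<longleftrightarrow> 2 \<le> card (l \<inter> A)" if "l \<in> L" for l
        using that L by (auto simp: G_def single_hits_def)
      then have 1: "L \<inter> G = {} \<longleftrightarrow> \<not> (\<exists>l\<in>L. 2 \<le> card (l \<inter> A))" by blast
      have "L \<inter> T = {l \<in> L. l \<inter> A \<noteq> {}}" if "L \<inter> G = {}"
      proof -
        have "{l \<in> L. l \<inter> A \<noteq> {}} = L \<inter> hits V m A" using L by (auto simp: hits_def)
        then show ?thesis using that sh[of V A] by (auto simp: G_def T_def)
      qed
      with 1 show "L \<in> {L. L \<inter> G = {} \<and> \<not> 2 \<le> card (L \<inter> T)} \<longleftrightarrow>
        L \<in> {L. \<not> (2 \<le> card {l \<in> L. l \<inter> A \<noteq> {}} \<or> (\<exists>l\<in>L. 2 \<le> card (l \<inter> A)))}" by auto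
    qed
    moreover have "?P {L. \<not> (2 \<le> card {l \<in> L. l \<inter> A \<noteq> {}} \<or> (\<exists>l\<in>L. 2 \<le> card (l \<inter> A)))} =
      1 - ?P {L. 2 \<le> card {l \<in> L. l \<inter> A \<noteq> {}} \<or> (\<exists>l\<in>L. 2 \<le> card (l \<inter> A))}"
      by (rule prob_Not)
    ultimately have "?P {L. 2 \<le> card {l \<in> L. l \<inter> A \<noteq> {}} \<or> (\<exists>l\<in>L. 2 \<le> card (l \<inter> A))} =
      1 - (1 - measure_pmf.prob (random_subset G p) {X. 1 \<le> card (X \<inter> G)}) *
        (1 - measure_pmf.prob (random_subset T p) {X. 2 \<le> card (X \<inter> T)})"
      unfolding prob_Not by (smt (verit, best))
    then show ?case unfolding x prod.case fst_conv snd_conv G_def T_def by (rule sym)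
  qed
  from Lim_transform_eventually[OF lim this] show ?thesis by (simp add: l1_def)
qed

end

section \<open>Limits along links\<close>

text \<open>Compactness of the unit interval: convergence at each limiting density a, together with
  continuity of \<pi>, yields a neighbourhood of a on which the error is small, and finitely many of
  these cover all densities. The actual density of A need not converge.\<close>

lemma sparse_uniform:
  fixes f :: "nat set \<times> real \<times> nat set \<Rightarrow> real"
  assumes lim: "\<And>a. 0 \<le> a \<Longrightarrow> a \<le> 1 \<Longrightarrow> (f \<longlongrightarrow> \<pi> a) (sparse_at m d a)"
    and cont: "continuous_on {0..1} \<pi>" and \<epsilon>: "0 < \<epsilon>"
  shows "\<forall>\<^sub>F x in sparse_sub m d. \<bar>f x - \<pi> (real (card (snd (snd x))) / real (card (fst x)))\<bar> < \<epsilon>"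
proof -
  let ?z = "\<lambda>x::nat set \<times> real \<times> nat set. real (card (snd (snd x))) / real (card (fst x))"
  have "\<forall>\<^sub>F x in sparse m d. 1 \<le> card (fst x)"
    using filterlim_card_sparse[of m d] unfolding filterlim_at_top by blast
  then have z: "\<forall>\<^sub>F x in sparse_sub m d. ?z x \<in> {0..1}"
    unfolding eventually_sparse_sub
    by eventually_elim (auto simp: Suc_le_eq divide_le_eq_1 card_gt_0_iff intro: card_mono)
  have "\<exists>U. open U \<and> a \<in> U \<and> (\<forall>\<^sub>F x in sparse_sub m d. ?z x \<in> U \<longrightarrow> \<bar>f x - \<pi> (?z x)\<bar> < \<epsilon>)"
    if a: "a \<in> {0..1}" for a
  proof -
    have "\<forall>\<^sub>F x in sparse_at m d a. dist (f x) (\<pi> a) < \<epsilon> / 2"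
      using a \<epsilon> by (intro tendstoD lim) auto
    then obtain Q R where Q: "eventually Q (filtercomap ?z (nhds a))"
      and R: "eventually R (sparse_sub m d)" and QR: "\<And>x. Q x \<Longrightarrow> R x \<Longrightarrow> dist (f x) (\<pi> a) < \<epsilon> / 2"
      unfolding sparse_at_def eventually_inf case_prod_unfold by auto
    from Q obtain S where S: "eventually S (nhds a)" "\<And>x. S (?z x) \<Longrightarrow> Q x"
      unfolding eventually_filtercomap by auto
    then obtain U where U: "open U" "a \<in> U" "\<And>t. t \<in> U \<Longrightarrow> S t"
      unfolding eventually_nhds by auto
    from cont a \<epsilon> obtain \<delta> where \<delta>: "0 < \<delta>" "\<And>t. t \<in> {0..1} \<Longrightarrow> dist t a < \<delta> \<Longrightarrow> dist (\<pi> t) (\<pi> a) < \<epsilon> / 2"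
      unfolding continuous_on_iff by (metis half_gt_zero)
    show ?thesis
    proof (intro exI[of _ "U \<inter> ball a \<delta>"] conjI)
      show "open (U \<inter> ball a \<delta>)" "a \<in> U \<inter> ball a \<delta>" using U \<delta> by auto
      show "\<forall>\<^sub>F x in sparse_sub m d. ?z x \<in> U \<inter> ball a \<delta> \<longrightarrow> \<bar>f x - \<pi> (?z x)\<bar> < \<epsilon>"
        using R z
      proof eventually_elim
        case (elim x)
        show ?case
        proof
          assume "?z x \<in> U \<inter> ball a \<delta>"
          then have "Q x" "dist (?z x) a < \<delta>" using U(3) S(2) by (auto simp: dist_commute)
          then have "dist (f x) (\<pi> a) < \<epsilon> / 2" "dist (\<pi> (?z x)) (\<pi> a) < \<epsilon> / 2"
            using QR \<delta>(2) elim by auto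
          then show "\<bar>f x - \<pi> (?z x)\<bar> < \<epsilon>" unfolding dist_real_def by linarith
        qed
      qed
    qed
  qed
  then have "\<exists>U. \<forall>a\<in>{0..1}. open (U a) \<and> a \<in> U a \<and>
      (\<forall>\<^sub>F x in sparse_sub m d. ?z x \<in> U a \<longrightarrow> \<bar>f x - \<pi> (?z x)\<bar> < \<epsilon>)"
    by (intro bchoice) blast
  then obtain U where U: "\<And>a. a \<in> {0..1} \<Longrightarrow> open (U a)" "\<And>a. a \<in> {0..1} \<Longrightarrow> a \<in> U a"
    and ev: "\<And>a. a \<in> {0..1} \<Longrightarrow> \<forall>\<^sub>F x in sparse_sub m d. ?z x \<in> U a \<longrightarrow> \<bar>f x - \<pi> (?z x)\<bar> < \<epsilon>"
    by blast
  have "{0..1} \<subseteq> (\<Union>a\<in>{0..1}. U a)" using U(2) by auto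
  then obtain K where K: "K \<subseteq> {0..1::real}" "finite K" "{0..1} \<subseteq> (\<Union>a\<in>K. U a)"
    by (rule compactE_image[OF compact_Icc U(1), rotated 1])
  have "\<forall>\<^sub>F x in sparse_sub m d. \<forall>a\<in>K. ?z x \<in> U a \<longrightarrow> \<bar>f x - \<pi> (?z x)\<bar> < \<epsilon>"
    using K ev by (intro eventually_ball_finite) auto
  with z show ?thesis
  proof eventually_elim
    case (elim x)
    then obtain a where "a \<in> K" "?z x \<in> U a" using K(3) by blast
    with elim show ?case by blast
  qed
qed

text \<open>Deleting k vertices multiplies the binomial coefficient by a factor tending to 1 that
  depends only on k, so the estimate is uniform in the deleted set W.\<close>

lemma eventually_sparse_delete:
  assumes "eventually P (sparse m d)"
  shows "\<forall>\<^sub>F x in sparse m d. \<forall>W\<subseteq>fst x. card W = k \<longrightarrow> P (fst x - W, snd x)"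
proof -
  let ?N = "\<lambda>x::nat set \<times> real. card (fst x)"
  from assms obtain N \<delta> where \<delta>: "0 < \<delta>"
    and P: "\<And>V p. N \<le> card V \<Longrightarrow> \<bar>p * real (card V choose m) - d\<bar> < \<delta> \<Longrightarrow> P (V, p)"
    unfolding eventually_sparse by blast
  have large: "\<forall>\<^sub>F x in sparse m d. N + k + 1 \<le> ?N x"
    using filterlim_card_sparse[of m d] unfolding filterlim_at_top by blast
  have "filterlim (\<lambda>x. real (?N x)) at_top (sparse m d)"
    using filterlim_compose[OF filterlim_real_sequentially filterlim_card_sparse] .
  then have "((\<lambda>x. 1 - real k / real (?N x)) \<longlongrightarrow> 1 - 0) (sparse m d)"
    by (intro tendsto_diff tendsto_const tendsto_divide_0[OF tendsto_const] filterlim_at_top_imp_at_infinity)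
  moreover have "\<forall>\<^sub>F x in sparse m d. 1 - real k / real (?N x) = real (?N x - k) / real (?N x)"
    using large by eventually_elim (simp add: of_nat_diff diff_divide_distrib)
  ultimately have "((\<lambda>x. real (?N x - k) / real (?N x)) \<longlongrightarrow> 1 - 0) (sparse m d)"
    by (rule Lim_transform_eventually)
  then have "((\<lambda>x. real (?N x - k) / real (?N x)) \<longlongrightarrow> 1) (sparse m d)" by simp
  then have "((\<lambda>x. snd x * real (?N x) ^ m * (real ((?N x - k) choose m) / real (?N x) ^ m))
      \<longlongrightarrow> d * fact m * (1 ^ m / fact m)) (sparse m d)"
    by (intro tendsto_mult sparse_power tendsto_choose filterlim_card_sparse)
  moreover have "d * fact m * (1 ^ m / fact m) = d" by simp
  ultimately have "((\<lambda>x. snd x * real (?N x) ^ m * (real ((?N x - k) choose m) / real (?N x) ^ m)) \<longlongrightarrow> d) (sparse m d)"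
    by (simp only:)
  then have "((\<lambda>x. snd x * real ((?N x - k) choose m)) \<longlongrightarrow> d) (sparse m d)"
    by (rule Lim_transform_eventually) (use large in eventually_elim, simp)
  then have "\<forall>\<^sub>F x in sparse m d. dist (snd x * real ((?N x - k) choose m)) d < \<delta>"
    using \<delta> by (rule tendstoD)
  then show ?thesis
    using large
  proof eventually_elim
    case (elim x)
    show ?case
    proof (intro allI impI P)
      fix W assume W: "W \<subseteq> fst x" "card W = k"
      have "finite (fst x)" using elim by (auto intro: card_ge_0_finite)
      then have c: "card (fst x - W) = ?N x - k"
        using W by (simp add: card_Diff_subset finite_subset)
      show "N \<le> card (fst x - W)" using c elim by simp
      show "\<bar>snd x * real (card (fst x - W) choose m) - d\<bar> < \<delta>" using elim by (simp add: c dist_real_def)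
    qed
  qed
qed

text \<open>The condition concerns a vertex set and a random family of links, and \<pi> is its
  limiting probability as a function of the density of the set. Monotonicity in the set is what
  turns one-sided information on the density into one-sided information on the probability.\<close>

definition link_limit :: "nat \<Rightarrow> real \<Rightarrow> (nat set \<Rightarrow> nat set set \<Rightarrow> bool) \<Rightarrow> (real \<Rightarrow> real) \<Rightarrow> bool" where
  "link_limit m d cond \<pi> \<longleftrightarrow> continuous_on {0..1} \<pi> \<and> (\<forall>a\<in>{0..1}. \<pi> a \<le> 1) \<and>
     (\<forall>A B L. finite B \<longrightarrow> A \<subseteq> B \<longrightarrow> finite L \<longrightarrow> cond A L \<longrightarrow> cond B L) \<and>
     (\<forall>a\<in>{0..1}. ((\<lambda>(V, p, A). measure_pmf.prob (random_subset (rsets V m) p) {L. cond A L}) \<longlongrightarrow> \<pi> a) (sparse_at m d a))"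

lemma link_uniform:
  assumes "link_limit m d cond \<pi>" "0 < \<epsilon>"
  shows "\<forall>\<^sub>F x in sparse m d. \<forall>A\<subseteq>fst x.
    \<bar>measure_pmf.prob (random_subset (rsets (fst x) m) (snd x)) {L. cond A L} - \<pi> (real (card A) / real (card (fst x)))\<bar> < \<epsilon>"
proof -
  have "\<forall>\<^sub>F x in sparse_sub m d. \<bar>(\<lambda>(V, p, A). measure_pmf.prob (random_subset (rsets V m) p) {L. cond A L}) x
      - \<pi> (real (card (snd (snd x))) / real (card (fst x)))\<bar> < \<epsilon>"
    using assms by (intro sparse_uniform) (auto simp: link_limit_def)
  then show ?thesis unfolding eventually_sparse_sub by (auto simp: case_prod_unfold)
qed

lemma prob_link_mono:
  assumes "link_limit m d cond \<pi>" "finite V" "A \<subseteq> B" "B \<subseteq> V"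
  shows "measure_pmf.prob (random_subset (rsets V m) p) {L. cond A L} \<le> measure_pmf.prob (random_subset (rsets V m) p) {L. cond B L}"
proof (rule prob_mono)
  fix L assume "L \<in> set_pmf (random_subset (rsets V m) p)" "L \<in> {L. cond A L}"
  moreover from this have "finite L" using random_subsetD finite_rsets[OF assms(2)] by (metis finite_subset)
  moreover have "finite B" using assms finite_subset by blast
  ultimately show "L \<in> {L. cond B L}" using assms unfolding link_limit_def by blast
qed

lemma sparse_large: "\<forall>\<^sub>F x in sparse m d. c < real (card (fst x))"
  using filterlim_compose[OF filterlim_real_sequentially filterlim_card_sparse, of m d]
  unfolding filterlim_at_top_dense by blast

lemma continuous_on_unit_near:
  fixes \<pi> :: "real \<Rightarrow> real"
  assumes "continuous_on {0..1} \<pi>" "0 \<le> q" "q \<le> 1" "0 < \<epsilon>"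
  obtains \<delta> where "0 < \<delta>" "\<And>t. 0 \<le> t \<Longrightarrow> t \<le> 1 \<Longrightarrow> \<bar>t - q\<bar> \<le> \<delta> \<Longrightarrow> \<bar>\<pi> t - \<pi> q\<bar> < \<epsilon>"
proof -
  from assms obtain \<delta> where "0 < \<delta>" "\<And>t. t \<in> {0..1} \<Longrightarrow> dist t q < \<delta> \<Longrightarrow> dist (\<pi> t) (\<pi> q) < \<epsilon>"
    unfolding continuous_on_iff by (metis atLeastAtMost_iff)
  then show ?thesis by (intro that[of "\<delta> / 2"]) (auto simp: dist_real_def)
qed

text \<open>Continuity controls \<pi> only near q, while A may be far denser. Such a set is first
  thinned to a subset of density about q, and monotonicity of the condition transfers the bound back
  to A.\<close>

lemma link_lower:
  assumes lim: "link_limit m d cond \<pi>" and q: "0 \<le> q" "q \<le> 1" and \<epsilon>: "0 < \<epsilon>"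
  obtains \<delta> where "0 < \<delta>" "\<forall>\<^sub>F x in sparse m d. \<forall>A\<subseteq>fst x. (q - \<delta>) * real (card (fst x)) \<le> real (card A) \<longrightarrow>
    \<pi> q - \<epsilon> \<le> measure_pmf.prob (random_subset (rsets (fst x) m) (snd x)) {L. cond A L}"
proof -
  have "continuous_on {0..1} \<pi>" using lim by (simp add: link_limit_def)
  then obtain \<delta> where \<delta>: "0 < \<delta>" "\<And>t. 0 \<le> t \<Longrightarrow> t \<le> 1 \<Longrightarrow> \<bar>t - q\<bar> \<le> \<delta> \<Longrightarrow> \<bar>\<pi> t - \<pi> q\<bar> < \<epsilon> / 2"
    using continuous_on_unit_near[of \<pi> q "\<epsilon> / 2"] q \<epsilon> by auto
  have "\<forall>\<^sub>F x in sparse m d. max 0 (1 / \<delta>) < real (card (fst x))" by (rule sparse_large)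
  moreover have "\<forall>\<^sub>F x in sparse m d. \<forall>A\<subseteq>fst x.
    \<bar>measure_pmf.prob (random_subset (rsets (fst x) m) (snd x)) {L. cond A L} - \<pi> (real (card A) / real (card (fst x)))\<bar> < \<epsilon> / 2"
    using \<epsilon> by (intro link_uniform[OF lim]) auto
  ultimately have "\<forall>\<^sub>F x in sparse m d. \<forall>A\<subseteq>fst x. (q - \<delta>) * real (card (fst x)) \<le> real (card A) \<longrightarrow>
    \<pi> q - \<epsilon> \<le> measure_pmf.prob (random_subset (rsets (fst x) m) (snd x)) {L. cond A L}"
  proof eventually_elim
    case (elim x)
    define V p where "V = fst x" and "p = snd x"
    have N: "0 < real (card V)" "1 / \<delta> < real (card V)" and finV: "finite V"
      using elim by (auto simp: V_def intro: card_ge_0_finite)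
    let ?P = "\<lambda>A. measure_pmf.prob (random_subset (rsets V m) p) {L. cond A L}"
    have near: "\<pi> q - \<epsilon> \<le> ?P A" if A: "A \<subseteq> V" "\<bar>real (card A) / real (card V) - q\<bar> \<le> \<delta>" for A
    proof -
      have "card A \<le> card V" using A finV by (simp add: card_mono)
      then have "\<bar>\<pi> (real (card A) / real (card V)) - \<pi> q\<bar> < \<epsilon> / 2"
        using A N by (intro \<delta>(2)) (auto simp: divide_le_eq_1)
      moreover have "\<bar>?P A - \<pi> (real (card A) / real (card V))\<bar> < \<epsilon> / 2"
        using elim(2) A by (simp add: V_def p_def)
      ultimately show ?thesis by linarith
    qed
    have "\<pi> q - \<epsilon> \<le> ?P A" if A: "A \<subseteq> V" "(q - \<delta>) * real (card V) \<le> real (card A)" for A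
    proof (cases "real (card A) \<le> (q + \<delta>) * real (card V)")
      case True
      with A N show ?thesis by (intro near) (auto simp: abs_le_iff field_simps)
    next
      case False
      let ?k = "nat \<lceil>q * real (card V)\<rceil>"
      have "0 \<le> q * real (card V)" using q by simp
      then have k: "q * real (card V) \<le> real ?k" "real ?k \<le> q * real (card V) + 1" by linarith+
      have "q * real (card V) < real (card A)" using False mult_pos_pos[OF \<delta>(1) N(1)] by (simp add: algebra_simps)
      then have "?k \<le> card A" by linarith
      then obtain B where B: "B \<subseteq> A" "card B = ?k" by (meson obtain_subset_with_card_n)
      have "1 \<le> \<delta> * real (card V)" using N \<delta>(1) by (simp add: field_simps)
      with k B N have "\<bar>real (card B) / real (card V) - q\<bar> \<le> \<delta>" by (auto simp: abs_le_iff field_simps)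
      with B A have "\<pi> q - \<epsilon> \<le> ?P B" by (intro near) auto
      also have "\<dots> \<le> ?P A" using B A finV by (intro prob_link_mono[OF lim]) auto
      finally show ?thesis .
    qed
    then show ?case by (simp add: V_def p_def)
  qed
  with \<delta>(1) that show thesis by blast
qed

text \<open>The mirror image: a set that is too sparse is enlarged to density about q.\<close>

lemma link_upper:
  assumes lim: "link_limit m d cond \<pi>" and q: "0 \<le> q" "q \<le> 1" and \<epsilon>: "0 < \<epsilon>"
  obtains \<delta> where "0 < \<delta>" "\<forall>\<^sub>F x in sparse m d. \<forall>A\<subseteq>fst x. real (card A) \<le> (q + \<delta>) * real (card (fst x)) \<longrightarrow>
    measure_pmf.prob (random_subset (rsets (fst x) m) (snd x)) {L. cond A L} \<le> \<pi> q + \<epsilon>"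
proof -
  have "continuous_on {0..1} \<pi>" using lim by (simp add: link_limit_def)
  then obtain \<delta> where \<delta>: "0 < \<delta>" "\<And>t. 0 \<le> t \<Longrightarrow> t \<le> 1 \<Longrightarrow> \<bar>t - q\<bar> \<le> \<delta> \<Longrightarrow> \<bar>\<pi> t - \<pi> q\<bar> < \<epsilon> / 2"
    using continuous_on_unit_near[of \<pi> q "\<epsilon> / 2"] q \<epsilon> by auto
  have "\<forall>\<^sub>F x in sparse m d. max 0 (1 / \<delta>) < real (card (fst x))" by (rule sparse_large)
  moreover have "\<forall>\<^sub>F x in sparse m d. \<forall>A\<subseteq>fst x.
    \<bar>measure_pmf.prob (random_subset (rsets (fst x) m) (snd x)) {L. cond A L} - \<pi> (real (card A) / real (card (fst x)))\<bar> < \<epsilon> / 2"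
    using \<epsilon> by (intro link_uniform[OF lim]) auto
  ultimately have "\<forall>\<^sub>F x in sparse m d. \<forall>A\<subseteq>fst x. real (card A) \<le> (q + \<delta>) * real (card (fst x)) \<longrightarrow>
    measure_pmf.prob (random_subset (rsets (fst x) m) (snd x)) {L. cond A L} \<le> \<pi> q + \<epsilon>"
  proof eventually_elim
    case (elim x)
    define V p where "V = fst x" and "p = snd x"
    have N: "0 < real (card V)" "1 / \<delta> < real (card V)" and finV: "finite V"
      using elim by (auto simp: V_def intro: card_ge_0_finite)
    let ?P = "\<lambda>A. measure_pmf.prob (random_subset (rsets V m) p) {L. cond A L}"
    have near: "?P A \<le> \<pi> q + \<epsilon>" if A: "A \<subseteq> V" "\<bar>real (card A) / real (card V) - q\<bar> \<le> \<delta>" for A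
    proof -
      have "card A \<le> card V" using A finV by (simp add: card_mono)
      then have "\<bar>\<pi> (real (card A) / real (card V)) - \<pi> q\<bar> < \<epsilon> / 2"
        using A N by (intro \<delta>(2)) (auto simp: divide_le_eq_1)
      moreover have "\<bar>?P A - \<pi> (real (card A) / real (card V))\<bar> < \<epsilon> / 2"
        using elim(2) A by (simp add: V_def p_def)
      ultimately show ?thesis by linarith
    qed
    have "?P A \<le> \<pi> q + \<epsilon>" if A: "A \<subseteq> V" "real (card A) \<le> (q + \<delta>) * real (card V)" for A
    proof (cases "(q - \<delta>) * real (card V) \<le> real (card A)")
      case True
      with A N show ?thesis by (intro near) (auto simp: abs_le_iff field_simps)
    next
      case False
      let ?k = "nat \<lfloor>q * real (card V)\<rfloor>"
      have "0 \<le> q * real (card V)" using q by simp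
      then have k: "real ?k \<le> q * real (card V)" "q * real (card V) \<le> real ?k + 1" by linarith+
      have "real (card A) < q * real (card V)" using False mult_pos_pos[OF \<delta>(1) N(1)] by (simp add: algebra_simps)
      then have ge: "card A \<le> ?k" by linarith
      have "q * real (card V) \<le> real (card V)" using q by (simp add: mult_left_le_one_le)
      then have "?k \<le> card V" using k(1) by linarith
      then obtain B where B: "A \<subseteq> B" "B \<subseteq> V" "card B = ?k"
        using exists_subset_between[OF ge _ A(1) finV] by blast
      have "1 \<le> \<delta> * real (card V)" using N \<delta>(1) by (simp add: field_simps)
      with k B N have "\<bar>real (card B) / real (card V) - q\<bar> \<le> \<delta>" by (auto simp: abs_le_iff field_simps)
      with B have "?P B \<le> \<pi> q + \<epsilon>" by (intro near) auto
      moreover have "?P A \<le> ?P B" using B finV by (intro prob_link_mono[OF lim]) auto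
      ultimately show ?thesis by simp
    qed
    then show ?case by (simp add: V_def p_def)
  qed
  with \<delta>(1) that show thesis by blast
qed

section \<open>Transfer of densities\<close>

abbreviation hypergraph_pmf :: "nat \<Rightarrow> nat set \<Rightarrow> real \<Rightarrow> nat set set pmf" where
  "hypergraph_pmf m V p \<equiv> random_subset (rsets V (Suc m)) p"

definition lower_density :: "nat \<Rightarrow> real \<Rightarrow> (nat set \<Rightarrow> nat set set \<Rightarrow> nat set) \<Rightarrow> real \<Rightarrow> bool" where
  "lower_density m d Q q \<longleftrightarrow> (\<forall>\<epsilon>>0. \<forall>\<eta>>0. \<forall>\<^sub>F x in sparse m d.
     measure_pmf.prob (hypergraph_pmf m (fst x) (snd x)) {E. real (card (Q (fst x) E)) < (q - \<epsilon>) * real (card (fst x))} < \<eta>)"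

text \<open>The falling factorials are compared factor by factor; the loss of k in the hypothesis
  absorbs the shifts by i < k.\<close>

lemma choose_ratio_le:
  assumes "0 \<le> c" "k \<le> f" "c * real n \<le> real f - real k"
  shows "c ^ k * real (n choose k) \<le> real (f choose k)"
proof -
  have "c ^ k * real (n choose k) = c ^ k * (\<Prod>i = 0..<k. real n - real i) / fact k"
    by (simp add: binomial_gbinomial gbinomial_prod_rev)
  also have "\<dots> \<le> (\<Prod>i = 0..<k. real f - real i) / fact k"
  proof (cases "k \<le> n")
    case True
    have "c ^ k * (\<Prod>i = 0..<k. real n - real i) = (\<Prod>i = 0..<k. c * (real n - real i))"
      by (simp add: prod.distrib)
    also have "\<dots> \<le> (\<Prod>i = 0..<k. real f - real i)"
    proof (intro prod_mono conjI)
      fix i assume i: "i \<in> {0..<k}"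
      show "0 \<le> c * (real n - real i)" using assms i True by auto
      have "c * (real n - real i) \<le> c * real n" using assms by (intro mult_left_mono) auto
      then show "c * (real n - real i) \<le> real f - real i" using assms i by auto
    qed
    finally show ?thesis by (simp add: divide_right_mono)
  next
    case False
    then have zero: "(\<Prod>i = 0..<k. real n - real i) = 0" by (intro prod_zero) (auto intro!: bexI[of _ n])
    have "0 \<le> (\<Prod>i = 0..<k. real f - real i)" using assms by (intro prod_nonneg) auto
    then show ?thesis unfolding zero by simp
  qed
  also have "\<dots> = real (f choose k)" by (simp add: binomial_gbinomial gbinomial_prod_rev)
  finally show ?thesis .
qed

text \<open>
  Markov's inequality for the number of \<open>k\<close>-sets of failing vertices. Removing all \<open>k\<close> vertices
  at once makes their links independent given the rest, so the expected number of such sets is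
  about \<open>(1 - \<pi> q)\<^sup>k (n choose k)\<close>.
\<close>

lemma lower_density_transfer:
  assumes Q: "lower_density m d Q q" "0 \<le> q" "q \<le> 1" "\<And>V E. Q V E \<subseteq> V"
    and lim: "link_limit m d cond \<pi>" and m: "1 \<le> m" and d: "0 < d"
    and Q': "\<And>V E. Q' V E \<subseteq> V"
    and step: "\<And>V W v E. finite V \<Longrightarrow> E \<subseteq> rsets V (Suc m) \<Longrightarrow> W \<subseteq> V \<Longrightarrow> v \<in> W \<Longrightarrow>
      cond (Q (V - W) (avoid E W)) (links E W v) \<Longrightarrow> v \<in> Q' V E"
  shows "lower_density m d Q' (\<pi> q)"
  unfolding lower_density_def
proof (intro allI impI)
  fix \<epsilon> \<eta> :: real assume \<epsilon>: "0 < \<epsilon>" and \<eta>: "0 < \<eta>"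
  \<comment> \<open>In the limit a vertex fails with probability at most \<theta>. A bad outcome has
    at least (\<theta> + 4e) n failing vertices, hence at least (\<theta> + 2e)^k times n choose k
    failing k-sets, whereas their mean is about (\<theta> + e)^k times n choose k. The gap between
    2e and e makes the quotient small for large k.\<close>
  define \<theta> where "\<theta> = 1 - \<pi> q"
  define e where "e = \<epsilon> / 4"
  have \<theta>: "0 \<le> \<theta>" using lim Q by (simp add: \<theta>_def link_limit_def)
  have e: "0 < e" using \<epsilon> by (simp add: e_def)
  have "(\<theta> + e) / (\<theta> + 2 * e) < 1" "0 \<le> (\<theta> + e) / (\<theta> + 2 * e)" using \<theta> e by auto
  then have "(\<lambda>k. ((\<theta> + e) / (\<theta> + 2 * e)) ^ k) \<longlonglongrightarrow> 0" by (intro LIMSEQ_realpow_zero) auto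
  then obtain k where k: "((\<theta> + e) / (\<theta> + 2 * e)) ^ k < \<eta> / 2"
    using \<eta> by (metis half_gt_zero order_tendstoD(2) eventually_sequentially order_refl)
  define c where "c = (\<theta> + 2 * e) ^ k"
  have c: "0 < c" using \<theta> e by (simp add: c_def)
  obtain \<delta> where \<delta>: "0 < \<delta>" and good: "\<forall>\<^sub>F x in sparse m d. \<forall>A\<subseteq>fst x. (q - \<delta>) * real (card (fst x)) \<le> real (card A) \<longrightarrow>
    \<pi> q - e \<le> measure_pmf.prob (random_subset (rsets (fst x) m) (snd x)) {L. cond A L}"
    by (rule link_lower[OF lim Q(2,3) e])
  \<comment> \<open>Markov's inequality will divide by c, so the exceptional event for Q is given
    probability below c times \<eta> / 2.\<close>
  have dens: "\<forall>\<^sub>F x in sparse m d. measure_pmf.prob (hypergraph_pmf m (fst x) (snd x))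
      {E. real (card (Q (fst x) E)) < (q - \<delta>) * real (card (fst x))} < \<eta> / 2 * c"
  proof -
    have "0 < \<eta> / 2 * c" using \<eta> c by simp
    with Q(1) \<delta> show ?thesis unfolding lower_density_def by blast
  qed
  \<comment> \<open>This size gives both k \<le> n and k \<le> 2 e n, the loss that turns 4e into
    2e.\<close>
  have "\<forall>\<^sub>F x in sparse m d. real k / (2 * e) + real k < real (card (fst x))" by (rule sparse_large)
  with sparse_prob_range[OF d m] eventually_sparse_delete[OF good, of k] eventually_sparse_delete[OF dens, of k]
  show "\<forall>\<^sub>F x in sparse m d. measure_pmf.prob (hypergraph_pmf m (fst x) (snd x))
      {E. real (card (Q' (fst x) E)) < (\<pi> q - \<epsilon>) * real (card (fst x))} < \<eta>"
  proof eventually_elim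
    case (elim x)
    define V p n where "V = fst x" and "p = snd x" and "n = card V"
    have V: "finite V" using elim by (simp add: V_def)
    have n: "real k / (2 * e) + real k < real n" using elim by (simp add: V_def n_def)
    have "0 \<le> real k / (2 * e)" using e by simp
    with n have kn: "k \<le> n" "real k / (2 * e) < real n" by linarith+
    let ?M = "hypergraph_pmf m V p"
    have W: "measure_pmf.prob ?M {E. \<forall>v\<in>W. v \<notin> Q' V E} \<le> \<eta> / 2 * c + (\<theta> + e) ^ k"
      if W: "W \<in> rsets V k" for W
    proof -
      have WV: "W \<subseteq> V" "card W = k" using W by (auto simp: rsets_def)
      let ?D = "hypergraph_pmf m (V - W) p"
      let ?low = "{D. real (card (Q (V - W) D)) < (q - \<delta>) * real (card (V - W))}"
      have "measure_pmf.prob ?M {E. \<forall>v\<in>W. v \<notin> Q' V E} \<le>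
          measure_pmf.prob ?M {E. \<forall>v\<in>W. (\<lambda>D L. \<not> cond (Q (V - W) D) L) (avoid E W) (links E W v)}"
        using step[OF V random_subsetD WV(1)] by (intro prob_mono) blast
      also have "\<dots> = measure_pmf.expectation ?D
          (\<lambda>D. measure_pmf.prob (random_subset (rsets (V - W) m) p) {L. \<not> cond (Q (V - W) D) L} ^ k)"
        using prob_links[OF V WV(1), where P = "\<lambda>D L. \<not> cond (Q (V - W) D) L"] WV by simp
      also have "\<dots> \<le> measure_pmf.expectation ?D (\<lambda>D. indicator ?low D + (\<theta> + e) ^ k)"
      proof (rule expectation_mono)
        fix D
        show "measure_pmf.prob (random_subset (rsets (V - W) m) p) {L. \<not> cond (Q (V - W) D) L} ^ k
          \<le> indicator ?low D + (\<theta> + e) ^ k"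
        proof (cases "D \<in> ?low")
          case True
          have "measure_pmf.prob (random_subset (rsets (V - W) m) p) {L. \<not> cond (Q (V - W) D) L} ^ k \<le> 1"
            by (intro power_le_one) auto
          with True \<theta> e show ?thesis by (simp add: add_increasing2)
        next
          case False
          then have "(q - \<delta>) * real (card (V - W)) \<le> real (card (Q (V - W) D))" by simp
          then have "\<pi> q - e \<le> measure_pmf.prob (random_subset (rsets (V - W) m) p) {L. cond (Q (V - W) D) L}"
            using elim(2) WV Q(4)[of "V - W" D] by (simp add: V_def p_def)
          then have "measure_pmf.prob (random_subset (rsets (V - W) m) p) {L. \<not> cond (Q (V - W) D) L} \<le> \<theta> + e"
            by (simp add: prob_Not \<theta>_def)
          then show ?thesis using False by (simp add: power_mono)
        qed
      qed (use V in simp)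
      also have "\<dots> = measure_pmf.prob ?D ?low + (\<theta> + e) ^ k"
        using V by simp
      also have "\<dots> \<le> \<eta> / 2 * c + (\<theta> + e) ^ k"
        using elim(3) WV by (simp add: V_def p_def less_imp_le)
      finally show ?thesis .
    qed
    let ?bad = "{E. real (card (Q' V E)) < (\<pi> q - \<epsilon>) * real n}"
    let ?f = "\<lambda>E. real (card {W \<in> rsets V k. \<forall>v\<in>W. v \<notin> Q' V E})"
    have sub: "?bad \<subseteq> {E. c * real (n choose k) \<le> ?f E}"
    proof
      fix E assume E: "E \<in> ?bad"
      have "card (V - Q' V E) = n - card (Q' V E)"
        using V Q' finite_subset[OF Q' V] by (simp add: card_Diff_subset n_def)
      moreover have "card (Q' V E) \<le> n" using V Q' by (simp add: card_mono n_def)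
      ultimately have "(\<theta> + 4 * e) * real n \<le> real (card (V - Q' V E))"
        using E by (simp add: of_nat_diff \<theta>_def e_def algebra_simps)
      moreover have "real k \<le> 2 * e * real n" using kn e by (simp add: field_simps)
      ultimately have ge: "(\<theta> + 2 * e) * real n \<le> real (card (V - Q' V E)) - real k"
        by (simp add: algebra_simps)
      moreover have "0 \<le> (\<theta> + 2 * e) * real n" using \<theta> e by simp
      ultimately have "k \<le> card (V - Q' V E)" by linarith
      with ge have "c * real (n choose k) \<le> real (card (V - Q' V E) choose k)"
        unfolding c_def using \<theta> e by (intro choose_ratio_le) auto
      also have "real (card (V - Q' V E) choose k) = real (card (rsets (V - Q' V E) k))"
        using V by (simp add: card_rsets)
      also have "rsets (V - Q' V E) k = {W \<in> rsets V k. \<forall>v\<in>W. v \<notin> Q' V E}"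
        by (auto simp: rsets_def)
      finally show "E \<in> {E. c * real (n choose k) \<le> ?f E}" by simp
    qed
    have cn: "0 < c * real (n choose k)" using c kn by simp
    have "measure_pmf.prob ?M ?bad \<le> measure_pmf.prob ?M {E. c * real (n choose k) \<le> ?f E}"
      using sub by (intro prob_mono) blast
    also have "\<dots> \<le> measure_pmf.expectation ?M ?f / (c * real (n choose k))"
      using V cn by (intro markov) auto
    also have "measure_pmf.expectation ?M ?f = (\<Sum>W\<in>rsets V k. measure_pmf.prob ?M {E. \<forall>v\<in>W. v \<notin> Q' V E})"
      using V by (intro expectation_card) simp
    also have "\<dots> \<le> (\<Sum>W\<in>rsets V k. \<eta> / 2 * c + (\<theta> + e) ^ k)"
      by (intro sum_mono W)
    also have "\<dots> = real (n choose k) * (\<eta> / 2 * c + (\<theta> + e) ^ k)"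
      using V by (simp add: card_rsets n_def)
    also have "real (n choose k) * (\<eta> / 2 * c + (\<theta> + e) ^ k) / (c * real (n choose k)) = \<eta> / 2 + ((\<theta> + e) / (\<theta> + 2 * e)) ^ k"
    proof -
      have "real (n choose k) * (\<eta> / 2 * c + (\<theta> + e) ^ k) / (c * real (n choose k)) = (\<eta> / 2 * c + (\<theta> + e) ^ k) / c"
        using kn by simp
      also have "\<dots> = \<eta> / 2 + (\<theta> + e) ^ k / c" using c by (simp add: add_divide_distrib)
      finally show ?thesis by (simp add: c_def power_divide)
    qed
    also have "\<dots> < \<eta>" using k by simp
    finally show ?case using cn by (simp add: V_def p_def n_def divide_right_mono)
  qed
qed

section \<open>Exposing one vertex\<close>

lemma poisson_tail_le_1: "0 \<le> l \<Longrightarrow> poisson_tail l i \<le> 1"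
  unfolding poisson_tail_def by (simp add: sum_nonneg)

lemma continuous_poisson_tail [continuous_intros]:
  "continuous_on S f \<Longrightarrow> continuous_on S (\<lambda>a. poisson_tail (f a) i)"
  unfolding poisson_tail_def by (intro continuous_intros) auto

lemma hits_mono:
  "finite L \<Longrightarrow> A \<subseteq> B \<Longrightarrow> card {l \<in> L. l \<inter> A \<noteq> {}} \<le> card {l \<in> L. l \<inter> B \<noteq> {}}"
  by (intro card_mono) auto

context fixpoint
begin

lemma rate_nonneg: "0 \<le> a \<Longrightarrow> a \<le> 1 \<Longrightarrow> 0 \<le> d * (1 - (1 - a) ^ m)"
  using d by (intro mult_nonneg_nonneg) (auto intro: power_le_one)

lemma sparse_limit: "0 \<le> a \<Longrightarrow> a \<le> 1 \<Longrightarrow> sparse_limit m d a"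
  by unfold_locales

section \<open>The three link conditions: many hits, a hit with many links, a core hit\<close>

lemma link_limit_hits:
  "link_limit m d (\<lambda>A L. i \<le> card {l \<in> L. l \<inter> A \<noteq> {}}) (\<lambda>a. poisson_tail (d * (1 - (1 - a) ^ m)) i)"
  unfolding link_limit_def
proof (intro conjI ballI allI impI)
  show "continuous_on {0..1} (\<lambda>a. poisson_tail (d * (1 - (1 - a) ^ m)) i)" by (intro continuous_intros)
  fix a :: real assume a: "a \<in> {0..1}"
  then show "poisson_tail (d * (1 - (1 - a) ^ m)) i \<le> 1" by (intro poisson_tail_le_1 rate_nonneg) auto
  interpret sparse_limit m d a using a by (intro sparse_limit) auto
  show "((\<lambda>(V, p, A). measure_pmf.prob (random_subset (rsets V m) p) {L. i \<le> card {l \<in> L. l \<inter> A \<noteq> {}}})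
      \<longlongrightarrow> poisson_tail (d * (1 - (1 - a) ^ m)) i) (sparse_at m d a)"
    using prob_hits_ge by (simp add: lam_def)
next
  fix A B :: "nat set" and L :: "nat set set"
  assume "A \<subseteq> B" "finite L" "i \<le> card {l \<in> L. l \<inter> A \<noteq> {}}"
  then show "i \<le> card {l \<in> L. l \<inter> B \<noteq> {}}" using hits_mono order_trans by blast
qed

lemma link_limit_hit_and_ge:
  "link_limit m d (\<lambda>A L. (\<exists>l\<in>L. l \<inter> A \<noteq> {}) \<and> i \<le> card L)
    (\<lambda>a. poisson_tail d i - exp (- (d * (1 - (1 - a) ^ m))) * poisson_tail (d * (1 - a) ^ m) i)"
  unfolding link_limit_def
proof (intro conjI ballI allI impI)
  show "continuous_on {0..1} (\<lambda>a. poisson_tail d i - exp (- (d * (1 - (1 - a) ^ m))) * poisson_tail (d * (1 - a) ^ m) i)"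
    by (intro continuous_intros)
  fix a :: real assume a: "a \<in> {0..1}"
  have "0 \<le> exp (- (d * (1 - (1 - a) ^ m))) * poisson_tail (d * (1 - a) ^ m) i"
    using a d by (intro mult_nonneg_nonneg poisson_tail_nonneg) auto
  moreover have "poisson_tail d i \<le> 1" using d by (intro poisson_tail_le_1) auto
  ultimately show "poisson_tail d i - exp (- (d * (1 - (1 - a) ^ m))) * poisson_tail (d * (1 - a) ^ m) i \<le> 1"
    by linarith
  interpret sparse_limit m d a using a by (intro sparse_limit) auto
  show "((\<lambda>(V, p, A). measure_pmf.prob (random_subset (rsets V m) p) {L. (\<exists>l\<in>L. l \<inter> A \<noteq> {}) \<and> i \<le> card L})
      \<longlongrightarrow> poisson_tail d i - exp (- (d * (1 - (1 - a) ^ m))) * poisson_tail (d * (1 - a) ^ m) i) (sparse_at m d a)"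
    using prob_hit_and_ge by (simp add: lam_def)
qed auto

lemma link_limit_core_hit:
  "link_limit m d (\<lambda>A L. 2 \<le> card {l \<in> L. l \<inter> A \<noteq> {}} \<or> (\<exists>l\<in>L. finite l \<and> 2 \<le> card (l \<inter> A)))
    (\<lambda>a. 1 - exp (- (d * (1 - (1 - a) ^ m))) * (1 + d * real m * a * (1 - a) ^ (m - 1)))"
  unfolding link_limit_def
proof (intro conjI ballI allI impI)
  show "continuous_on {0..1} (\<lambda>a. 1 - exp (- (d * (1 - (1 - a) ^ m))) * (1 + d * real m * a * (1 - a) ^ (m - 1)))"
    by (intro continuous_intros)
  fix a :: real assume a: "a \<in> {0..1}"
  have "0 \<le> exp (- (d * (1 - (1 - a) ^ m))) * (1 + d * real m * a * (1 - a) ^ (m - 1))"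
    using a d by (intro mult_nonneg_nonneg add_nonneg_nonneg) auto
  then show "1 - exp (- (d * (1 - (1 - a) ^ m))) * (1 + d * real m * a * (1 - a) ^ (m - 1)) \<le> 1" by simp
  interpret sparse_limit m d a using a by (intro sparse_limit) auto
  have "\<forall>\<^sub>F x in sparse_at m d a.
    (case x of (V, p, A) \<Rightarrow> measure_pmf.prob (random_subset (rsets V m) p)
      {L. 2 \<le> card {l \<in> L. l \<inter> A \<noteq> {}} \<or> (\<exists>l\<in>L. 2 \<le> card (l \<inter> A))}) =
    (case x of (V, p, A) \<Rightarrow> measure_pmf.prob (random_subset (rsets V m) p)
      {L. 2 \<le> card {l \<in> L. l \<inter> A \<noteq> {}} \<or> (\<exists>l\<in>L. finite l \<and> 2 \<le> card (l \<inter> A))})"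
    using range
  proof eventually_elim
    case (elim x)
    obtain V p A where x: "x = (V, p, A)" by (cases x)
    with elim have V: "finite V" by simp
    show ?case
      unfolding x prod.case
    proof (rule prob_cong)
      fix L assume "L \<in> set_pmf (random_subset (rsets V m) p)"
      then have "L \<subseteq> rsets V m" by (rule random_subsetD)
      then have "finite l" if "l \<in> L" for l using that V by (auto simp: rsets_def intro: finite_subset)
      then show "L \<in> {L. 2 \<le> card {l \<in> L. l \<inter> A \<noteq> {}} \<or> (\<exists>l\<in>L. 2 \<le> card (l \<inter> A))} \<longleftrightarrow>
        L \<in> {L. 2 \<le> card {l \<in> L. l \<inter> A \<noteq> {}} \<or> (\<exists>l\<in>L. finite l \<and> 2 \<le> card (l \<inter> A))}" by auto
    qed
  qed
  from Lim_transform_eventually[OF prob_core_hit this]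
  show "((\<lambda>(V, p, A). measure_pmf.prob (random_subset (rsets V m) p)
      {L. 2 \<le> card {l \<in> L. l \<inter> A \<noteq> {}} \<or> (\<exists>l\<in>L. finite l \<and> 2 \<le> card (l \<inter> A))})
      \<longlongrightarrow> 1 - exp (- (d * (1 - (1 - a) ^ m))) * (1 + d * real m * a * (1 - a) ^ (m - 1))) (sparse_at m d a)"
    by (simp add: lam_def)
next
  fix A B :: "nat set" and L :: "nat set set"
  assume "finite B" "A \<subseteq> B" "finite L" "2 \<le> card {l \<in> L. l \<inter> A \<noteq> {}} \<or> (\<exists>l\<in>L. finite l \<and> 2 \<le> card (l \<inter> A))"
  then show "2 \<le> card {l \<in> L. l \<inter> B \<noteq> {}} \<or> (\<exists>l\<in>L. finite l \<and> 2 \<le> card (l \<inter> B))"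
  proof (elim disjE bexE conjE)
    assume "2 \<le> card {l \<in> L. l \<inter> A \<noteq> {}}"
    then show ?thesis using hits_mono[OF \<open>finite L\<close> \<open>A \<subseteq> B\<close>] by linarith
  next
    fix l assume l: "l \<in> L" "finite l" "2 \<le> card (l \<inter> A)"
    have "card (l \<inter> A) \<le> card (l \<inter> B)" using l \<open>A \<subseteq> B\<close> by (intro card_mono) auto
    with l show ?thesis by (meson order_trans)
  qed
qed

lemma power_tangent:
  fixes y z :: real
  assumes "0 \<le> y" "0 \<le> z"
  shows "z ^ m + real m * z ^ (m - 1) * (y - z) \<le> y ^ m"
proof (cases "z = 0")
  case True
  then show ?thesis using assms m by (simp add: power_0_left)
next
  case False
  then have z: "0 < z" using assms by simp
  have "1 + real m * (y / z - 1) \<le> (1 + (y / z - 1)) ^ m"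
    using assms z by (intro Bernoulli_inequality) auto
  then have "z ^ m * (1 + real m * (y / z - 1)) \<le> z ^ m * (y / z) ^ m"
    using z by (intro mult_left_mono) auto
  moreover have "z ^ m * (y / z) ^ m = y ^ m" using z by (simp add: power_divide)
  moreover have "z ^ m = z * z ^ (m - 1)" using m by (simp add: power_eq_if)
  then have "z ^ m * (1 + real m * (y / z - 1)) = z ^ m + real m * z ^ (m - 1) * (y - z)"
    using z by (simp add: field_simps)
  ultimately show ?thesis by simp
qed

text \<open>Concavity as a supporting line: convexity of the m-th power and
  \<open>exp x \<ge> 1 + x\<close> are combined. The existence of some slope suffices for Jensen's
  inequality and for a linear bound near 0.\<close>

lemma survival_tangent:
  assumes "0 \<le> b" "b \<le> 1"
  obtains c where "\<And>a. 0 \<le> a \<Longrightarrow> a \<le> 1 \<Longrightarrow> survival m d a \<le> survival m d b + c * (a - b)"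
proof
  fix a :: real assume a: "0 \<le> a" "a \<le> 1"
  let ?e = "exp (- d * (1 - (1 - b) ^ m))"
  have "(1 - b) ^ m + real m * (1 - b) ^ (m - 1) * ((1 - a) - (1 - b)) \<le> (1 - a) ^ m"
    using a assms by (intro power_tangent) auto
  then have "d * (real m * (1 - b) ^ (m - 1) * (b - a)) \<le> d * ((1 - a) ^ m - (1 - b) ^ m)"
    using d by (intro mult_left_mono) (auto simp: algebra_simps)
  also have "1 + \<dots> \<le> exp (d * ((1 - a) ^ m - (1 - b) ^ m))" by (rule exp_ge_add_one_self)
  finally have "?e * (1 + d * (real m * (1 - b) ^ (m - 1) * (b - a))) \<le> ?e * exp (d * ((1 - a) ^ m - (1 - b) ^ m))"
    by (intro mult_left_mono) auto
  also have "\<dots> = exp (- d * (1 - (1 - a) ^ m))" by (simp flip: exp_add add: algebra_simps)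
  finally show "survival m d a \<le> survival m d b + ?e * d * real m * (1 - b) ^ (m - 1) * (a - b)"
    by (simp add: survival_def algebra_simps)
qed

lemma survival_jensen:
  assumes fin: "finite (set_pmf M)" and X: "\<And>x. x \<in> set_pmf M \<Longrightarrow> 0 \<le> X x \<and> X x \<le> 1"
  shows "measure_pmf.expectation M (\<lambda>x. survival m d (X x)) \<le> survival m d (measure_pmf.expectation M X)"
proof -
  let ?b = "measure_pmf.expectation M X"
  have "0 \<le> ?b" using X by (intro integral_nonneg_AE) (auto simp: AE_measure_pmf_iff)
  moreover have "?b \<le> measure_pmf.expectation M (\<lambda>_. 1)" using X by (intro expectation_mono fin) auto
  ultimately obtain c where c: "\<And>a. 0 \<le> a \<Longrightarrow> a \<le> 1 \<Longrightarrow> survival m d a \<le> survival m d ?b + c * (a - ?b)"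
    using survival_tangent[of ?b] by auto
  have "measure_pmf.expectation M (\<lambda>x. survival m d (X x)) \<le> measure_pmf.expectation M (\<lambda>x. survival m d ?b + c * (X x - ?b))"
    using c X by (intro expectation_mono fin) auto
  also have "\<dots> = survival m d ?b"
    using integrable_measure_pmf_finite[OF fin, of X] by simp
  finally show ?thesis .
qed

lemma prob_link:
  assumes "finite V" "v \<in> V"
  shows "measure_pmf.prob (hypergraph_pmf m V p) {E. P (avoid E {v}) (links E {v} v)} =
    measure_pmf.expectation (hypergraph_pmf m (V - {v}) p)
      (\<lambda>D. measure_pmf.prob (random_subset (rsets (V - {v}) m) p) {L. P D L})"
  using prob_links[of V "{v}" m p P] assms by simp

section \<open>Mean densities and their bounds by exposing one vertex\<close>

definition mean :: "(nat set \<Rightarrow> nat set set \<Rightarrow> nat set) \<Rightarrow> nat set \<times> real \<Rightarrow> real" where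
  "mean Q x = measure_pmf.expectation (hypergraph_pmf m (fst x) (snd x)) (\<lambda>E. real (card (Q (fst x) E))) / real (card (fst x))"

text \<open>The probability that \<open>P\<close> holds for a vertex added to \<open>V\<close>.\<close>

definition one_step :: "(nat set \<Rightarrow> nat set set \<Rightarrow> nat set set \<Rightarrow> bool) \<Rightarrow> nat set \<times> real \<Rightarrow> real" where
  "one_step P x = measure_pmf.expectation (hypergraph_pmf m (fst x) (snd x))
     (\<lambda>D. measure_pmf.prob (random_subset (rsets (fst x) m) (snd x)) {L. P (fst x) D L})"

lemma finite_sparse: "\<forall>\<^sub>F x in sparse m d. finite (fst x) \<and> 0 < card (fst x) \<and> 0 < snd x \<and> snd x \<le> 1"
proof -
  have "\<forall>\<^sub>F x in sparse m d. 0 < real (card (fst x))" by (rule sparse_large)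
  moreover have "\<forall>\<^sub>F x in sparse m d. finite (fst x) \<and> 0 < snd x \<and> snd x \<le> 1"
    using sparse_prob_range m d by simp
  ultimately show ?thesis by eventually_elim simp
qed

lemma mean_nonneg: "0 \<le> mean Q x"
  unfolding mean_def by (intro divide_nonneg_nonneg integral_nonneg_AE) auto

text \<open>Linearity of expectation reduces the mean density to a single vertex. After its deletion
  the rest is again a sparse random hypergraph, and the bound on \<open>one_step\<close> is uniform
  over the vertex deleted.\<close>

lemma mean_le_one_step:
  assumes Q: "\<And>V E. Q V E \<subseteq> V"
    and step: "\<And>V E v. finite V \<Longrightarrow> E \<subseteq> rsets V (Suc m) \<Longrightarrow> v \<in> Q V E \<Longrightarrow> P (V - {v}) (avoid E {v}) (links E {v} v)"
    and bound: "\<forall>\<^sub>F x in sparse m d. one_step P x \<le> b"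
  shows "\<forall>\<^sub>F x in sparse m d. mean Q x \<le> b"
  using finite_sparse eventually_sparse_delete[OF bound, of 1]
proof eventually_elim
  case (elim x)
  obtain V p where x: "x = (V, p)" by (cases x)
  with elim have V: "finite V" "0 < card V" by auto
  let ?M = "hypergraph_pmf m V p"
  have "{v \<in> V. v \<in> Q V E} = Q V E" for E using Q[of V E] by auto
  then have "measure_pmf.expectation ?M (\<lambda>E. real (card (Q V E))) = (\<Sum>v\<in>V. measure_pmf.prob ?M {E. v \<in> Q V E})"
    using expectation_card[OF V(1), of ?M "\<lambda>v E. v \<in> Q V E"] by simp
  also have "\<dots> \<le> (\<Sum>v\<in>V. b)"
  proof (rule sum_mono)
    fix v assume v: "v \<in> V"
    have "measure_pmf.prob ?M {E. v \<in> Q V E} \<le> measure_pmf.prob ?M {E. P (V - {v}) (avoid E {v}) (links E {v} v)}"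
      using step[OF V(1) random_subsetD] by (intro prob_mono) blast
    also have "\<dots> = one_step P (V - {v}, p)"
      by (simp add: prob_link[OF V(1) v, of p "P (V - {v})"] one_step_def)
    also have "\<dots> \<le> b" using elim(2) v by (auto simp: x)
    finally show "measure_pmf.prob ?M {E. v \<in> Q V E} \<le> b" .
  qed
  finally show ?case using V by (simp add: mean_def x divide_le_eq mult.commute)
qed

lemma one_step_or:
  "finite (fst x) \<Longrightarrow> one_step (\<lambda>V D L. P V D L \<or> R V D L) x \<le> one_step P x + one_step R x"
proof -
  assume V: "finite (fst x)"
  let ?M = "hypergraph_pmf m (fst x) (snd x)" and ?L = "random_subset (rsets (fst x) m) (snd x)"
  have "one_step (\<lambda>V D L. P V D L \<or> R V D L) x \<le> measure_pmf.expectation ?M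
      (\<lambda>D. measure_pmf.prob ?L {L. P (fst x) D L} + measure_pmf.prob ?L {L. R (fst x) D L})"
    unfolding one_step_def using V by (intro expectation_mono prob_Un_le) simp
  also have "\<dots> = one_step P x + one_step R x"
    unfolding one_step_def using V by (intro Bochner_Integration.integral_add) auto
  finally show ?thesis .
qed

text \<open>Jensen's inequality allows a bound in mean to be passed on without any concentration of
  \<open>card (Q V D)\<close>.\<close>

lemma one_step_hits:
  assumes Q: "\<And>V E. Q V E \<subseteq> V" and b: "0 \<le> b" "b \<le> 1" and \<epsilon>: "0 < \<epsilon>"
    and mean: "\<forall>\<^sub>F x in sparse m d. mean Q x \<le> b"
  shows "\<forall>\<^sub>F x in sparse m d. one_step (\<lambda>V D L. 1 \<le> card {l \<in> L. l \<inter> Q V D \<noteq> {}}) x \<le> survival m d b + \<epsilon>"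
  using finite_sparse mean link_uniform[OF link_limit_hits \<epsilon>, of 1]
proof eventually_elim
  case (elim x)
  obtain V p where x: "x = (V, p)" by (cases x)
  with elim have V: "finite V" "0 < card V" by auto
  let ?M = "hypergraph_pmf m V p"
  let ?X = "\<lambda>D. real (card (Q V D)) / real (card V)"
  have X: "0 \<le> ?X D \<and> ?X D \<le> 1" for D
    using Q[of V D] V by (auto simp: divide_le_eq_1 intro: card_mono)
  have "one_step (\<lambda>V D L. 1 \<le> card {l \<in> L. l \<inter> Q V D \<noteq> {}}) x \<le> measure_pmf.expectation ?M (\<lambda>D. survival m d (?X D) + \<epsilon>)"
    unfolding one_step_def x fst_conv snd_conv
  proof (rule expectation_mono)
    fix D
    have "\<bar>measure_pmf.prob (random_subset (rsets V m) p) {L. 1 \<le> card {l \<in> L. l \<inter> Q V D \<noteq> {}}} - survival m d (?X D)\<bar> < \<epsilon>"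
      using elim(3) Q[of V D] by (simp add: x survival_def)
    then show "measure_pmf.prob (random_subset (rsets V m) p) {L. 1 \<le> card {l \<in> L. l \<inter> Q V D \<noteq> {}}} \<le> survival m d (?X D) + \<epsilon>"
      by linarith
  qed (use V in simp)
  also have "\<dots> = measure_pmf.expectation ?M (\<lambda>D. survival m d (?X D)) + \<epsilon>" using V by simp
  also have "measure_pmf.expectation ?M (\<lambda>D. survival m d (?X D)) \<le> survival m d (measure_pmf.expectation ?M ?X)"
    using V X by (intro survival_jensen) auto
  also have "measure_pmf.expectation ?M ?X = mean Q x" by (simp add: mean_def x)
  also have "survival m d (mean Q x) \<le> survival m d b"
    using elim(2) b d mean_nonneg by (intro survival_mono) auto
  finally show ?case by simp
qed

lemma sparse_bound: "\<forall>\<^sub>F x in sparse m d. snd x * real (card (fst x)) ^ m \<le> d * fact m + 1"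
proof -
  have "\<forall>\<^sub>F x in sparse m d. snd x * real (card (fst x)) ^ m < d * fact m + 1"
    by (rule order_tendstoD(2)[OF sparse_power]) simp
  then show ?thesis by (auto elim: eventually_mono)
qed

lemma one_step_many_links:
  assumes "0 < y"
  shows "\<forall>\<^sub>F x in sparse m d. one_step (\<lambda>V D L. y \<le> real (card L)) x \<le> (d + 1) / y"
proof -
  have "\<forall>\<^sub>F x in sparse m d. snd x * real (card (fst x) choose m) < d + 1"
    by (rule order_tendstoD(2)[OF tendsto_sparse]) simp
  then show ?thesis
    using finite_sparse
  proof eventually_elim
    case (elim x)
    obtain V p where x: "x = (V, p)" by (cases x)
    with elim have V: "finite V" "0 \<le> p" "p \<le> 1" by auto
    let ?L = "random_subset (rsets V m) p"
    have "measure_pmf.prob ?L {L. y \<le> real (card L)} \<le> measure_pmf.expectation ?L (\<lambda>L. real (card L)) / y"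
      using V assms by (intro markov) auto
    also have "measure_pmf.expectation ?L (\<lambda>L. real (card L)) = measure_pmf.expectation ?L (\<lambda>L. \<Sum>e\<in>L. 1)" by simp
    also have "\<dots> = p * real (card V choose m)"
      using V by (subst expectation_sum_random_subset) (auto simp: card_rsets)
    also have "\<dots> / y \<le> (d + 1) / y" using elim assms by (intro divide_right_mono) (auto simp: x)
    finally show ?case by (simp add: one_step_def x)
  qed
qed

lemma card_rsets_superset:
  assumes "finite V" "finite S" "card S \<le> m"
  shows "real (card {l \<in> rsets V m. S \<subseteq> l}) \<le> real (card V) ^ (m - card S)"
proof -
  have "card {l \<in> rsets V m. S \<subseteq> l} = card ((\<lambda>l. l - S) ` {l \<in> rsets V m. S \<subseteq> l})"
    by (intro card_image[symmetric] inj_onI) (metis (no_types, lifting) Diff_partition mem_Collect_eq)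
  also have "\<dots> \<le> card (rsets V (m - card S))"
  proof (rule card_mono)
    show "(\<lambda>l. l - S) ` {l \<in> rsets V m. S \<subseteq> l} \<subseteq> rsets V (m - card S)"
      using assms by (auto simp: rsets_def card_Diff_subset)
  qed (use assms in simp)
  also have "\<dots> = card V choose (m - card S)" using assms by (simp add: card_rsets)
  also have "\<dots> \<le> card V ^ (m - card S)"
    by (cases "m - card S \<le> card V") (auto simp: binomial_le_pow binomial_eq_0)
  finally show ?thesis by (metis of_nat_le_iff of_nat_power)
qed

text \<open>A union bound over u and over w in its cluster. Either one link contains both, with at
  most N^(m-2) choices, or two different links contain one each, with at most N^(m-1) choices
  apiece. Since p N^m stays bounded, each pair costs O(1/N^2).\<close>

lemma prob_entangled_le:
  assumes V: "finite V" and D: "D \<subseteq> rsets V (Suc m)" and p: "0 \<le> p" "p \<le> 1"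
  shows "measure_pmf.prob (random_subset (rsets V m) p) {L. entangled X D L} \<le>
    (\<Sum>u\<in>V \<inter> X. real (card (cluster D u))) * (p * real (card V) ^ (m - 2) + (p * real (card V) ^ (m - 1)) ^ 2)"
proof -
  let ?S = "rsets V m" and ?P = "measure_pmf.prob (random_subset (rsets V m) p)"
  let ?t = "p * real (card V) ^ (m - 2) + (p * real (card V) ^ (m - 1)) ^ 2"
  have clV: "cluster D u \<subseteq> V" if "u \<in> V" for u
    using cluster_subset[of D u] that D by (auto simp: rsets_def)
  have finc: "finite (cluster D u)" if "u \<in> V" for u using clV[OF that] V finite_subset by blast
  \<comment> \<open>J collects the single links through two distinct vertices, I the pairs of links.
    In I the case u = w is retained: two links may share a vertex.\<close>
  define J where "J u w = {l \<in> ?S. u \<noteq> w \<and> {u, w} \<subseteq> l}" for u w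
  define I where "I u w = {l \<in> ?S. {u} \<subseteq> l} \<times> {l \<in> ?S. {w} \<subseteq> l}" for u w
  have finI: "finite (J u w)" "finite (I u w)" for u w using V by (auto simp: J_def I_def)
  have cJ: "real (card (J u w)) \<le> real (card V) ^ (m - 2)" for u w
  proof (cases "u = w")
    case False
    then have "J u w = {l \<in> ?S. {u, w} \<subseteq> l}" by (auto simp: J_def)
    then show ?thesis using card_rsets_superset[OF V, of "{u, w}"] False m by (simp add: numeral_2_eq_2)
  qed (simp add: J_def)
  have cI: "real (card (I u w)) \<le> (real (card V) ^ (m - 1)) ^ 2" for u w
  proof -
    have "real (card {l \<in> ?S. {z} \<subseteq> l}) \<le> real (card V) ^ (m - 1)" for z
      using card_rsets_superset[OF V, of "{z}"] m by simp
    then show ?thesis unfolding I_def card_cartesian_product power2_eq_square of_nat_mult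
      by (intro mult_mono) auto
  qed
  have one: "?P {L. l \<in> L} = p" if "l \<in> ?S" for l
    using prob_random_subset_superset[of ?S "{l}" p] that V p by simp
  have two: "?P {L. l \<noteq> k \<and> l \<in> L \<and> k \<in> L} \<le> p ^ 2" if "l \<in> ?S" "k \<in> ?S" for l k
  proof (cases "l = k")
    case False
    then have "?P {L. l \<noteq> k \<and> l \<in> L \<and> k \<in> L} = ?P {L. {l, k} \<subseteq> L}" by simp
    also have "\<dots> = p ^ card {l, k}" using that V p by (intro prob_random_subset_superset) auto
    finally show ?thesis using False by (simp add: numeral_2_eq_2)
  qed simp
  have pair: "?P {L. (\<exists>l\<in>J u w. l \<in> L) \<or> (\<exists>lk\<in>I u w. fst lk \<noteq> snd lk \<and> fst lk \<in> L \<and> snd lk \<in> L)} \<le> ?t" for u w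
  proof -
    have "?P {L. \<exists>l\<in>J u w. l \<in> L} \<le> (\<Sum>l\<in>J u w. ?P {L. l \<in> L})" by (intro prob_UN_le finI)
    also have "\<dots> = (\<Sum>l\<in>J u w. p)" by (intro sum.cong refl one) (auto simp: J_def)
    also have "\<dots> = p * real (card (J u w))" by simp
    also have "\<dots> \<le> p * real (card V) ^ (m - 2)" using cJ p by (intro mult_left_mono) auto
    finally have 1: "?P {L. \<exists>l\<in>J u w. l \<in> L} \<le> p * real (card V) ^ (m - 2)" .
    have "?P {L. \<exists>lk\<in>I u w. fst lk \<noteq> snd lk \<and> fst lk \<in> L \<and> snd lk \<in> L} \<le>
        (\<Sum>lk\<in>I u w. ?P {L. fst lk \<noteq> snd lk \<and> fst lk \<in> L \<and> snd lk \<in> L})" by (intro prob_UN_le finI)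
    also have "\<dots> \<le> (\<Sum>lk\<in>I u w. p ^ 2)" by (intro sum_mono two) (auto simp: I_def)
    also have "\<dots> = p ^ 2 * real (card (I u w))" by simp
    also have "\<dots> \<le> p ^ 2 * (real (card V) ^ (m - 1)) ^ 2" using cI p by (intro mult_left_mono) auto
    finally have "?P {L. \<exists>lk\<in>I u w. fst lk \<noteq> snd lk \<and> fst lk \<in> L \<and> snd lk \<in> L} \<le> (p * real (card V) ^ (m - 1)) ^ 2"
      by (simp add: power_mult_distrib)
    with 1 prob_Un_le[of "random_subset ?S p" "\<lambda>L. \<exists>l\<in>J u w. l \<in> L" "\<lambda>L. \<exists>lk\<in>I u w. fst lk \<noteq> snd lk \<and> fst lk \<in> L \<and> snd lk \<in> L"]
    show ?thesis by linarith
  qed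
  have "?P {L. entangled X D L} \<le> ?P {L. \<exists>u\<in>V \<inter> X. \<exists>w\<in>cluster D u.
      (\<exists>l\<in>J u w. l \<in> L) \<or> (\<exists>lk\<in>I u w. fst lk \<noteq> snd lk \<and> fst lk \<in> L \<and> snd lk \<in> L)}"
  proof (rule prob_mono, safe)
    fix L assume "L \<in> set_pmf (random_subset ?S p)" "entangled X D L"
    then have L: "L \<subseteq> ?S" by (simp add: random_subsetD)
    from \<open>entangled X D L\<close> obtain l k u w where *: "l \<in> L" "k \<in> L" "u \<in> l" "u \<in> X" "w \<in> k" "(l, u) \<noteq> (k, w)" "w \<in> cluster D u"
      unfolding entangled_def by blast
    have "u \<in> V \<inter> X" using * L by (auto simp: rsets_def)
    moreover have "(\<exists>l\<in>J u w. l \<in> L) \<or> (\<exists>lk\<in>I u w. fst lk \<noteq> snd lk \<and> fst lk \<in> L \<and> snd lk \<in> L)"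
    proof (cases "l = k")
      case True
      then have "l \<in> J u w" using * L by (auto simp: J_def)
      with * show ?thesis by blast
    next
      case False
      then have "(l, k) \<in> I u w" using * L by (auto simp: I_def)
      with False * show ?thesis by (intro disjI2 bexI[of _ "(l, k)"]) auto
    qed
    ultimately show "\<exists>u\<in>V \<inter> X. \<exists>w\<in>cluster D u.
      (\<exists>l\<in>J u w. l \<in> L) \<or> (\<exists>lk\<in>I u w. fst lk \<noteq> snd lk \<and> fst lk \<in> L \<and> snd lk \<in> L)" using *(7) by blast
  qed
  also have "\<dots> \<le> (\<Sum>u\<in>V \<inter> X. ?P {L. \<exists>w\<in>cluster D u.
      (\<exists>l\<in>J u w. l \<in> L) \<or> (\<exists>lk\<in>I u w. fst lk \<noteq> snd lk \<and> fst lk \<in> L \<and> snd lk \<in> L)})"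
    using V by (intro prob_UN_le) auto
  also have "\<dots> \<le> (\<Sum>u\<in>V \<inter> X. real (card (cluster D u)) * ?t)"
  proof (rule sum_mono)
    fix u assume "u \<in> V \<inter> X"
    then have "finite (cluster D u)" using finc by simp
    then have "?P {L. \<exists>w\<in>cluster D u. (\<exists>l\<in>J u w. l \<in> L) \<or> (\<exists>lk\<in>I u w. fst lk \<noteq> snd lk \<and> fst lk \<in> L \<and> snd lk \<in> L)}
      \<le> (\<Sum>w\<in>cluster D u. ?P {L. (\<exists>l\<in>J u w. l \<in> L) \<or> (\<exists>lk\<in>I u w. fst lk \<noteq> snd lk \<and> fst lk \<in> L \<and> snd lk \<in> L)})"
      by (rule prob_UN_le)
    also have "\<dots> \<le> (\<Sum>w\<in>cluster D u. ?t)" by (intro sum_mono pair)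
    finally show "?P {L. \<exists>w\<in>cluster D u. (\<exists>l\<in>J u w. l \<in> L) \<or> (\<exists>lk\<in>I u w. fst lk \<noteq> snd lk \<and> fst lk \<in> L \<and> snd lk \<in> L)}
      \<le> real (card (cluster D u)) * ?t" by simp
  qed
  also have "\<dots> = (\<Sum>u\<in>V \<inter> X. real (card (cluster D u))) * ?t" by (simp only: sum_distrib_right)
  finally show ?thesis .
qed

text \<open>Outside B the clusters have at most K elements, and their total contribution is O(K/N).
  A vertex of B is charged the trivial cluster size N, so B enters with its mean density. The factor
  bounds p N^m plus its square.\<close>

lemma one_step_entangled:
  fixes X :: "nat set \<Rightarrow> nat set set \<Rightarrow> nat set"
  assumes B: "\<And>V E. B V E \<subseteq> V" and XB: "\<And>V D u. u \<in> V \<Longrightarrow> u \<in> X V D \<Longrightarrow> u \<notin> B V D \<Longrightarrow> card (cluster D u) \<le> K"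
    and mean: "\<forall>\<^sub>F x in sparse m d. mean B x \<le> b" and \<epsilon>: "0 < \<epsilon>"
  shows "\<forall>\<^sub>F x in sparse m d. one_step (\<lambda>V D L. entangled (X V D) D L) x \<le>
    ((d * fact m + 1) + (d * fact m + 1) ^ 2) * b + \<epsilon>"
proof -
  define c where "c = (d * fact m + 1) + (d * fact m + 1) ^ 2"
  have "0 < d * fact m + 1" using d by (intro add_pos_pos mult_pos_pos) auto
  then have c: "0 < c" unfolding c_def by (rule add_pos_nonneg) simp
  have "\<forall>\<^sub>F x in sparse m d. c * real K / \<epsilon> < real (card (fst x))" by (rule sparse_large)
  then show ?thesis
    using finite_sparse mean sparse_bound
  proof eventually_elim
    case (elim x)
    obtain V p where x: "x = (V, p)" by (cases x)
    define N where "N = real (card V)"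
    have V: "finite V" "0 \<le> p" "p \<le> 1" and N: "0 < N" using elim by (auto simp: x N_def)
    let ?M = "hypergraph_pmf m V p"
    let ?t = "p * N ^ (m - 2) + (p * N ^ (m - 1)) ^ 2"
    have pN: "p * N ^ m \<le> d * fact m + 1" "0 \<le> p * N ^ m" using elim V N by (auto simp: x N_def)
    have e1: "N ^ (m - 2) * N ^ 2 = N ^ m" using m by (metis le_add_diff_inverse2 power_add)
    have e2: "N ^ (m - 1) * N = N ^ m" using power_minus_mult[of m N] m by simp
    have "p * N ^ (m - 2) * N ^ 2 = p * N ^ m" by (simp only: mult.assoc e1)
    moreover have "(p * N ^ (m - 1)) ^ 2 * N ^ 2 = (p * N ^ m) ^ 2"
      by (simp only: power_mult_distrib[symmetric] mult.assoc e2)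
    ultimately have eq: "p * N ^ (m - 2) * N ^ 2 = p * N ^ m" "(p * N ^ (m - 1)) ^ 2 * N ^ 2 = (p * N ^ m) ^ 2" .
    have "?t * N ^ 2 = p * N ^ m + (p * N ^ m) ^ 2" unfolding distrib_right eq ..
    also have "\<dots> \<le> c" unfolding c_def using pN by (intro add_mono power_mono)
    finally have t: "?t * N ^ 2 \<le> c" .
    have t0: "0 \<le> ?t" using V N by simp
    have "one_step (\<lambda>V D L. entangled (X V D) D L) x \<le> measure_pmf.expectation ?M (\<lambda>D. (N * real K + N * real (card (B V D))) * ?t)"
      unfolding one_step_def x fst_conv snd_conv
    proof (rule expectation_mono)
      fix D assume "D \<in> set_pmf ?M"
      then have D: "D \<subseteq> rsets V (Suc m)" by (rule random_subsetD)
      have "(\<Sum>u\<in>V \<inter> X V D. real (card (cluster D u))) \<le> (\<Sum>u\<in>V. real K + N * of_bool (u \<in> B V D))"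
      proof (rule sum_le_included[where i = "\<lambda>u. u"])
        show "\<forall>u\<in>V \<inter> X V D. \<exists>y\<in>V. y = u \<and> real (card (cluster D u)) \<le> real K + N * of_bool (y \<in> B V D)"
        proof
          fix u assume u: "u \<in> V \<inter> X V D"
          have "cluster D u \<subseteq> V" using cluster_subset[of D u] u D by (auto simp: rsets_def)
          then have "real (card (cluster D u)) \<le> N" using V by (simp add: N_def card_mono)
          then show "\<exists>y\<in>V. y = u \<and> real (card (cluster D u)) \<le> real K + N * of_bool (y \<in> B V D)"
            using u XB[of u V D] by (cases "u \<in> B V D") auto
        qed
      qed (use V N in auto)
      also have "\<dots> = N * real K + N * real (card (B V D))"
        using V B[of V D] by (simp add: sum.distrib N_def of_bool_def sum.If_cases Int_absorb1 flip: sum_distrib_left)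
      finally have "(\<Sum>u\<in>V \<inter> X V D. real (card (cluster D u))) * ?t \<le> (N * real K + N * real (card (B V D))) * ?t"
        using t0 by (rule mult_right_mono)
      with prob_entangled_le[OF V(1) D V(2,3), of "X V D"]
      show "measure_pmf.prob (random_subset (rsets V m) p) {L. entangled (X V D) D L} \<le> (N * real K + N * real (card (B V D))) * ?t"
        by (simp add: N_def)
    qed (use V in simp)
    also have "\<dots> = (N * real K + N * measure_pmf.expectation ?M (\<lambda>D. real (card (B V D)))) * ?t"
      using V by simp
    also have "\<dots> = (real K / N + mean B x) * (?t * N ^ 2)"
      using N by (simp add: mean_def x N_def field_simps power2_eq_square)
    also have "\<dots> \<le> (real K / N + mean B x) * c"
      using t N mean_nonneg[of B x] by (intro mult_left_mono) auto
    also have "\<dots> \<le> \<epsilon> + b * c"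
    proof -
      have "real K / N * c \<le> \<epsilon>" using elim(1) N \<epsilon> c by (simp add: x N_def field_simps)
      moreover have "mean B x * c \<le> b * c" using elim(3) c by (intro mult_right_mono) auto
      ultimately show ?thesis by (simp add: distrib_right)
    qed
    finally show ?case by (simp add: c_def mult.commute)
  qed
qed

end

section \<open>Large clusters and anchored vertices\<close>

lemma rsets_edges:
  assumes "finite V" "E \<subseteq> rsets V (Suc m)"
  shows "finite E" "finite (\<Union>E)" "\<Union>E \<subseteq> V" "e \<in> E \<Longrightarrow> finite e \<and> card e = Suc m"
proof -
  show "finite E" using assms finite_rsets finite_subset by blast
  show "\<Union>E \<subseteq> V" using assms(2) by (auto simp: rsets_def)
  then show "finite (\<Union>E)" using assms(1) finite_subset by blast
  show "e \<in> E \<Longrightarrow> finite e \<and> card e = Suc m"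
    using assms by (auto simp: rsets_def intro: finite_subset)
qed

lemma card_hits_ge1_iff: "finite L \<Longrightarrow> 1 \<le> card {l \<in> L. l \<inter> A \<noteq> {}} \<longleftrightarrow> (\<exists>l\<in>L. l \<inter> A \<noteq> {})"
  by (auto simp: Suc_le_eq card_gt_0_iff)

lemma card_links_le_edeg:
  assumes "finite E"
  shows "card (links E W v) \<le> edeg E v"
proof -
  have "card (links E W v) \<le> card {e \<in> E. e \<inter> W = {v}}"
    unfolding links_def using assms by (intro card_image_le) auto
  also have "\<dots> \<le> edeg E v"
    unfolding edeg_def using assms by (intro card_mono) auto
  finally show ?thesis .
qed

text \<open>A substitute for a second moment: if Y is rarely below q and its mean is hardly above q,
  then Y cannot often exceed q by \<epsilon>.\<close>

lemma squeeze_prob: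
  assumes fin: "finite (set_pmf M)" and Y: "\<And>x. x \<in> set_pmf M \<Longrightarrow> 0 \<le> Y x" and q: "0 \<le> q" and "0 \<le> \<delta>" "0 < \<epsilon>"
    and mean: "measure_pmf.expectation M Y \<le> q + \<delta>" and low: "measure_pmf.prob M {x. Y x < q - \<delta>} \<le> \<kappa>"
  shows "\<epsilon> * measure_pmf.prob M {x. q + \<epsilon> \<le> Y x} \<le> 2 * \<delta> + q * \<kappa>"
proof -
  let ?U = "{x. q + \<epsilon> \<le> Y x}" and ?L = "{x. Y x < q - \<delta>}"
  \<comment> \<open>The left side is a pointwise minorant of Y. The deduction of q on the lower
    event is enough because Y is nonnegative.\<close>
  have "measure_pmf.expectation M (\<lambda>x. (q - \<delta>) + (\<epsilon> + \<delta>) * indicator ?U x - q * indicator ?L x) \<le> measure_pmf.expectation M Y"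
  proof (intro expectation_mono fin)
    fix x assume "x \<in> set_pmf M"
    then show "(q - \<delta>) + (\<epsilon> + \<delta>) * indicator ?U x - q * indicator ?L x \<le> Y x"
      using Y[of x] assms(4,5) by (auto simp: indicator_def)
  qed
  also have "measure_pmf.expectation M (\<lambda>x. (q - \<delta>) + (\<epsilon> + \<delta>) * indicator ?U x - q * indicator ?L x)
      = (q - \<delta>) + (\<epsilon> + \<delta>) * measure_pmf.prob M ?U - q * measure_pmf.prob M ?L"
    using integrable_measure_pmf_finite[OF fin, of "indicator ?U :: _ \<Rightarrow> real"]
      integrable_measure_pmf_finite[OF fin, of "indicator ?L :: _ \<Rightarrow> real"] by simp
  finally have "(\<epsilon> + \<delta>) * measure_pmf.prob M ?U \<le> 2 * \<delta> + q * measure_pmf.prob M ?L"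
    using mean by linarith
  moreover have "q * measure_pmf.prob M ?L \<le> q * \<kappa>" using low q by (rule mult_left_mono)
  moreover have "\<epsilon> * measure_pmf.prob M ?U \<le> (\<epsilon> + \<delta>) * measure_pmf.prob M ?U"
    using assms(4) by (intro mult_right_mono) auto
  ultimately show ?thesis by linarith
qed

lemma lower_density_trivial:
  assumes "q \<le> 0"
  shows "lower_density m d Q q"
  unfolding lower_density_def
proof (intro allI impI always_eventually)
  fix \<epsilon> \<eta> :: real and x :: "nat set \<times> real" assume "0 < \<epsilon>" "0 < \<eta>"
  have "(q - \<epsilon>) * real (card (fst x)) \<le> 0" using assms \<open>0 < \<epsilon>\<close> by (intro mult_nonpos_nonneg) auto
  then have "{E. real (card (Q (fst x) E)) < (q - \<epsilon>) * real (card (fst x))} = {}"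
    by (auto simp: not_less intro: order_trans)
  then show "measure_pmf.prob (hypergraph_pmf m (fst x) (snd x))
      {E. real (card (Q (fst x) E)) < (q - \<epsilon>) * real (card (fst x))} < \<eta>" using \<open>0 < \<eta>\<close> by simp
qed

lemma lower_density_all:
  assumes "q \<le> 1"
  shows "lower_density m d (\<lambda>V E. V) q"
  unfolding lower_density_def
proof (intro allI impI always_eventually)
  fix \<epsilon> \<eta> :: real and x :: "nat set \<times> real" assume "0 < \<epsilon>" "0 < \<eta>"
  have "(q - \<epsilon>) * real (card (fst x)) \<le> 1 * real (card (fst x))" using assms \<open>0 < \<epsilon>\<close> by (intro mult_right_mono) auto
  then show "measure_pmf.prob (hypergraph_pmf m (fst x) (snd x))
      {E. real (card (fst x)) < (q - \<epsilon>) * real (card (fst x))} < \<eta>" using \<open>0 < \<eta>\<close> by simp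
qed

lemma lower_densityD:
  "lower_density m d Q q \<Longrightarrow> 0 < \<epsilon> \<Longrightarrow> 0 < \<eta> \<Longrightarrow> \<forall>\<^sub>F x in sparse m d.
     measure_pmf.prob (hypergraph_pmf m (fst x) (snd x)) {E. real (card (Q (fst x) E)) < (q - \<epsilon>) * real (card (fst x))} < \<eta>"
  by (simp add: lower_density_def)

lemma lower_density_sum:
  fixes B :: nat
  assumes "\<And>i. i < B \<Longrightarrow> lower_density m d (Q i) (q i)" "0 < \<epsilon>" "0 < \<eta>"
  shows "\<forall>\<^sub>F x in sparse m d. measure_pmf.prob (hypergraph_pmf m (fst x) (snd x))
    {E. real (\<Sum>i<B. card (Q i (fst x) E)) < ((\<Sum>i<B. q i) - \<epsilon>) * real (card (fst x))} < \<eta>"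
proof -
  define \<epsilon>' \<eta>' where "\<epsilon>' = \<epsilon> / real (Suc B)" and "\<eta>' = \<eta> / real (Suc B)"
  have pos: "0 < \<epsilon>'" "0 < \<eta>'" using assms by (auto simp: \<epsilon>'_def \<eta>'_def)
  have B: "real B * \<eta>' < \<eta>" "real B * \<epsilon>' \<le> \<epsilon>" using assms by (auto simp: \<epsilon>'_def \<eta>'_def field_simps)
  have "\<forall>\<^sub>F x in sparse m d. \<forall>i\<in>{..<B}. measure_pmf.prob (hypergraph_pmf m (fst x) (snd x))
      {E. real (card (Q i (fst x) E)) < (q i - \<epsilon>') * real (card (fst x))} < \<eta>'"
    using lower_densityD[OF assms(1) pos] by (intro eventually_ball_finite) auto
  then show ?thesis
  proof eventually_elim
    case (elim x)
    let ?N = "real (card (fst x))" and ?P = "measure_pmf.prob (hypergraph_pmf m (fst x) (snd x))"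
    have "?P {E. real (\<Sum>i<B. card (Q i (fst x) E)) < ((\<Sum>i<B. q i) - \<epsilon>) * ?N} \<le>
        ?P {E. \<exists>i\<in>{..<B}. real (card (Q i (fst x) E)) < (q i - \<epsilon>') * ?N}"
    proof (rule prob_mono, rule CollectI, rule ccontr)
      fix E assume less: "E \<in> {E. real (\<Sum>i<B. card (Q i (fst x) E)) < ((\<Sum>i<B. q i) - \<epsilon>) * ?N}"
        and "\<not> (\<exists>i\<in>{..<B}. real (card (Q i (fst x) E)) < (q i - \<epsilon>') * ?N)"
      then have "(\<Sum>i<B. (q i - \<epsilon>') * ?N) \<le> (\<Sum>i<B. real (card (Q i (fst x) E)))"
        by (intro sum_mono) (auto simp: not_less)
      also have "(\<Sum>i<B. (q i - \<epsilon>') * ?N) = ((\<Sum>i<B. q i) - real B * \<epsilon>') * ?N"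
        by (simp add: sum_subtractf flip: sum_distrib_right)
      finally have "((\<Sum>i<B. q i) - real B * \<epsilon>') * ?N < ((\<Sum>i<B. q i) - \<epsilon>) * ?N" using less by simp
      moreover have "((\<Sum>i<B. q i) - \<epsilon>) * ?N \<le> ((\<Sum>i<B. q i) - real B * \<epsilon>') * ?N"
        using B(2) by (intro mult_right_mono) auto
      ultimately show False by simp
    qed
    also have "\<dots> \<le> (\<Sum>i<B. ?P {E. real (card (Q i (fst x) E)) < (q i - \<epsilon>') * ?N})" by (rule prob_UN_le) simp
    also have "\<dots> \<le> (\<Sum>i<B. \<eta>')" using elim by (intro sum_mono) (auto intro: less_imp_le)
    also have "\<dots> < \<eta>" using B(1) by simp
    finally show ?case .
  qed
qed

context fixpoint
begin

definition large :: "nat \<Rightarrow> nat set \<Rightarrow> nat set set \<Rightarrow> nat set" where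
  "large K V E = {v \<in> V. K \<le> card (cluster E v)}"

definition small_anchored :: "nat \<Rightarrow> nat set \<Rightarrow> nat set set \<Rightarrow> nat set" where
  "small_anchored k V E = {v \<in> V. v \<in> anchored E \<and> card (cluster E v) \<le> k}"

definition anch :: "nat set \<Rightarrow> nat set set \<Rightarrow> nat set" where
  "anch V E = V \<inter> anchored E"

lemma survival_eq: "poisson_tail (d * (1 - (1 - a) ^ m)) 1 = survival m d a"
  by (simp add: survival_def)

text \<open>Each exposure raises the threshold on the cluster size by one. The density bound does
  not deteriorate because \<rho> is a fixed point; the start with all vertices has density 1 \<ge>
  \<rho>.\<close>

lemma lower_density_large: "lower_density m d (large K) \<rho>"
proof (induction K)
  case 0
  have "large 0 = (\<lambda>V E. V)" by (intro ext) (auto simp: large_def)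
  then show ?case using lower_density_all rho_less by simp
next
  case (Suc K)
  have "lower_density m d (large (Suc K)) (poisson_tail (d * (1 - (1 - \<rho>) ^ m)) 1)"
  proof (rule lower_density_transfer[OF Suc rho_nonneg _ _ link_limit_hits])
    fix V :: "nat set" and W v and E :: "nat set set"
    assume V: "finite V" and E: "E \<subseteq> rsets V (Suc m)" and W: "W \<subseteq> V" "v \<in> W"
      and hit: "1 \<le> card {l \<in> links E W v. l \<inter> large K (V - W) (avoid E W) \<noteq> {}}"
    have "\<exists>l\<in>links E W v. l \<inter> large K (V - W) (avoid E W) \<noteq> {}"
      using hit rsets_edges(1)[OF V E] by (subst (asm) card_hits_ge1_iff) auto
    then obtain l u where l: "l \<in> links E W v" "u \<in> l" "K \<le> card (cluster (avoid E W) u)"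
      by (auto simp: large_def)
    note L = linksD[OF l(1)]
    have "card (cluster (avoid E W) u) < card (cluster E v)"
      using L l W by (intro card_cluster_avoid_less[where e = "insert v l"] rsets_edges(2)[OF V E]) auto
    with l W show "v \<in> large (Suc K) V E" by (auto simp: large_def)
  qed (use rho_less m d in \<open>auto simp: large_def\<close>)
  then show ?case by (simp only: survival_eq rho_fixed)
qed

lemma mean_mono:
  assumes "\<And>V E. finite V \<Longrightarrow> E \<subseteq> rsets V (Suc m) \<Longrightarrow> card (Q V E) \<le> card (R V E)" "finite (fst x)"
  shows "mean Q x \<le> mean R x"
  unfolding mean_def using assms
  by (intro divide_right_mono expectation_mono) (auto dest: random_subsetD)

lemma mean_le_1:
  assumes "\<And>V E. Q V E \<subseteq> V"
  shows "\<forall>\<^sub>F x in sparse m d. mean Q x \<le> 1"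
  using finite_sparse
proof eventually_elim
  case (elim x)
  have "mean Q x \<le> mean (\<lambda>V E. V) x" using assms elim by (intro mean_mono card_mono) auto
  also have "\<dots> = 1" using elim by (auto simp: mean_def card_gt_0_iff)
  finally show ?case .
qed

lemma links_rsets:
  assumes "finite V" "E \<subseteq> rsets V (Suc m)" "v \<in> V" "l \<in> links E {v} v"
  shows "l \<subseteq> V - {v}" "finite l" "card l = m"
proof -
  have "l \<in> rsets (V - {v}) m" using links_subset_rsets[OF assms(2) _ assms(1), of v "{v}"] assms(4) by auto
  then show "l \<subseteq> V - {v}" "card l = m" by (auto simp: rsets_def)
  then show "finite l" using assms(1) by (auto intro: finite_subset)
qed

text \<open>A vertex with few links, none of which reaches a large cluster, has itself a bounded
  cluster. No acyclicity enters: the sizes of the clusters behind the links are simply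
  added.\<close>

lemma mean_large_step:
  assumes mean: "\<forall>\<^sub>F x in sparse m d. mean (large K) x \<le> b" and b: "0 \<le> b" "b \<le> 1" and \<epsilon>: "0 < \<epsilon>"
  shows "\<exists>K'. \<forall>\<^sub>F x in sparse m d. mean (large K') x \<le> survival m d b + \<epsilon>"
proof -
  \<comment> \<open>Markov's inequality makes y or more links have probability at most \<epsilon> /
    2, and K' exceeds the size attainable with fewer links.\<close>
  define y where "y = (d + 1) / (\<epsilon> / 2)"
  have y: "0 < y" using d \<epsilon> by (simp add: y_def)
  define K' where "K' = nat \<lceil>1 + y * real (m * K)\<rceil> + 1"
  have K': "1 + y * real (m * K) < real K'" unfolding K'_def by linarith
  let ?P = "\<lambda>V D L. 1 \<le> card {l \<in> L. l \<inter> large K V D \<noteq> {}} \<or> y \<le> real (card L)"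
  have eq: "(d + 1) / y = \<epsilon> / 2"
  proof -
    have "d + 1 \<noteq> 0" using d by simp
    then show ?thesis unfolding y_def divide_divide_eq_right by (rule mult_divide_mult_cancel_left)
  qed
  have "\<forall>\<^sub>F x in sparse m d. one_step (\<lambda>V D L. y \<le> real (card L)) x \<le> \<epsilon> / 2"
    using one_step_many_links[OF y] unfolding eq .
  moreover have "\<forall>\<^sub>F x in sparse m d. one_step (\<lambda>V D L. 1 \<le> card {l \<in> L. l \<inter> large K V D \<noteq> {}}) x \<le> survival m d b + \<epsilon> / 2"
    using \<epsilon> by (intro one_step_hits mean b) (auto simp: large_def)
  ultimately have "\<forall>\<^sub>F x in sparse m d. one_step ?P x \<le> survival m d b + \<epsilon>"
    using finite_sparse
  proof eventually_elim
    case (elim x)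
    then show ?case
      using one_step_or[of x "\<lambda>V D L. 1 \<le> card {l \<in> L. l \<inter> large K V D \<noteq> {}}" "\<lambda>V D L. y \<le> real (card L)"] by simp
  qed
  then have "\<forall>\<^sub>F x in sparse m d. mean (large K') x \<le> survival m d b + \<epsilon>"
  proof (rule mean_le_one_step[rotated 2])
    fix V :: "nat set" and E v
    assume V: "finite V" and E: "E \<subseteq> rsets V (Suc m)" and v: "v \<in> large K' V E"
    note finE = rsets_edges(1)[OF V E]
    have vV: "v \<in> V" using v by (simp add: large_def)
    show "1 \<le> card {l \<in> links E {v} v. l \<inter> large K (V - {v}) (avoid E {v}) \<noteq> {}} \<or> y \<le> real (card (links E {v} v))"
    proof (rule disjCI)
      assume "\<not> y \<le> real (card (links E {v} v))"
      then have "real (card (links E {v} v)) * real (m * K) \<le> y * real (m * K)" by (intro mult_right_mono) auto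
      with K' have "1 + real (card (links E {v} v)) * real (m * K) < real K'" by linarith
      then have small: "1 + card (links E {v} v) * (m * K) < K'"
        by (metis of_nat_1 of_nat_add of_nat_less_iff of_nat_mult)
      have "\<exists>l\<in>links E {v} v. l \<inter> large K (V - {v}) (avoid E {v}) \<noteq> {}"
      proof (rule ccontr)
        assume no: "\<not> ?thesis"
        have "card (cluster E v) \<le> 1 + card (links E {v} v) * (m * K)"
        proof (rule card_cluster_le_links[OF finE])
          fix l u assume l: "l \<in> links E {v} v" "u \<in> l"
          then have "u \<in> V - {v}" using links_rsets[OF V E vV] by blast
          with no l have "\<not> K \<le> card (cluster (avoid E {v}) u)" by (auto simp: large_def)
          then show "card (cluster (avoid E {v}) u) \<le> K" by simp
        qed (use links_rsets[OF V E vV] in blast)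
        with small v show False by (simp add: large_def)
      qed
      then show "1 \<le> card {l \<in> links E {v} v. l \<inter> large K (V - {v}) (avoid E {v}) \<noteq> {}}"
        using finE by (subst card_hits_ge1_iff) auto
    qed
  qed (auto simp: large_def)
  then show ?thesis by blast
qed

text \<open>The limit over thresholds is replaced by the infimum of all bounds that hold eventually
  for some threshold, so no limit of the mean densities has to exist.\<close>

lemma mean_large:
  assumes "\<rho> < b"
  shows "\<exists>K. \<forall>\<^sub>F x in sparse m d. mean (large K) x \<le> b"
proof -
  define B where "B = {b \<in> {0..1}. \<exists>K. \<forall>\<^sub>F x in sparse m d. mean (large K) x \<le> b}"
  have "\<forall>\<^sub>F x in sparse m d. mean (large 0) x \<le> 1" by (rule mean_le_1) (auto simp: large_def)
  then have one: "1 \<in> B" by (auto simp: B_def)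
  have bdd: "bdd_below B" by (rule bdd_belowI[of _ 0]) (auto simp: B_def)
  define \<beta> where "\<beta> = Inf B"
  have \<beta>: "0 \<le> \<beta>" "\<beta> \<le> 1"
    unfolding \<beta>_def using one bdd by (auto intro!: cInf_greatest cInf_lower simp: B_def)
  \<comment> \<open>Otherwise one step applied to a bound slightly above \<beta> would give the
    bound \<gamma> below the infimum.\<close>
  have "\<beta> \<le> survival m d \<beta>"
  proof (rule ccontr)
    assume "\<not> ?thesis"
    then have less: "survival m d \<beta> < \<beta>" by simp
    define \<gamma> where "\<gamma> = (survival m d \<beta> + \<beta>) / 2"
    have \<gamma>: "survival m d \<beta> < \<gamma>" "\<gamma> < \<beta>" "0 \<le> \<gamma>"
      using less survival_bounds[of d \<beta> m] \<beta> d by (auto simp: \<gamma>_def)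
    obtain \<delta> where \<delta>: "0 < \<delta>" "\<And>t. 0 \<le> t \<Longrightarrow> t \<le> 1 \<Longrightarrow> \<bar>t - \<beta>\<bar> \<le> \<delta> \<Longrightarrow> \<bar>survival m d t - survival m d \<beta>\<bar> < \<gamma> - survival m d \<beta>"
      using continuous_on_unit_near[OF continuous_survival \<beta>, of "\<gamma> - survival m d \<beta>" m d] \<gamma> by auto
    obtain c where c: "c \<in> B" "c < \<beta> + \<delta>"
      using cInf_lessD[of B "\<beta> + \<delta>"] one \<delta>(1) by (auto simp: \<beta>_def)
    have "\<beta> \<le> c" unfolding \<beta>_def using c bdd by (intro cInf_lower)
    then have "\<bar>survival m d c - survival m d \<beta>\<bar> < \<gamma> - survival m d \<beta>" using c by (intro \<delta>(2)) (auto simp: B_def)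
    then have "0 < \<gamma> - survival m d c" by linarith
    moreover obtain K where "\<forall>\<^sub>F x in sparse m d. mean (large K) x \<le> c" using c by (auto simp: B_def)
    ultimately have "\<exists>K'. \<forall>\<^sub>F x in sparse m d. mean (large K') x \<le> survival m d c + (\<gamma> - survival m d c)"
      using c by (intro mean_large_step) (auto simp: B_def)
    then have "\<gamma> \<in> B" using \<gamma> \<beta> by (simp add: B_def)
    then have "\<beta> \<le> \<gamma>" unfolding \<beta>_def using bdd by (intro cInf_lower)
    with \<gamma> show False by simp
  qed
  then have "\<beta> \<le> \<rho>" using \<beta> by (intro le_rho_if_le_survival)
  then have "Inf B < b" using assms by (simp add: \<beta>_def)
  then obtain c where "c < b" "c \<in> B" using cInf_lessD[of B b] one by blast
  then obtain K where "\<forall>\<^sub>F x in sparse m d. mean (large K) x \<le> c" by (auto simp: B_def)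
  with \<open>c < b\<close> show ?thesis by (intro exI[of _ K]) (auto elim: eventually_mono)
qed

lemma one_step_False: "one_step (\<lambda>V D L. False) x = 0"
  by (simp add: one_step_def)

text \<open>Finite trees have no anchored vertices, so an anchored vertex in a small cluster betrays
  a short cycle. Each induction step either moves to an anchored vertex with a smaller cluster or
  meets an entanglement confined to small clusters, which has probability O(1/N).\<close>

lemma mean_small_anchored:
  assumes "0 < \<epsilon>"
  shows "\<forall>\<^sub>F x in sparse m d. mean (small_anchored k) x \<le> \<epsilon>"
  using assms
proof (induction k arbitrary: \<epsilon>)
  case 0
  show ?case
  proof (rule mean_le_one_step[where P = "\<lambda>V D L. False"])
    fix V :: "nat set" and E v
    assume V: "finite V" and E: "E \<subseteq> rsets V (Suc m)" and v: "v \<in> small_anchored 0 V E"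
    have "finite (cluster E v)" by (rule finite_cluster[OF rsets_edges(2)[OF V E]])
    then have "0 < card (cluster E v)" using cluster_refl[of v E] card_gt_0_iff by blast
    with v show False by (simp add: small_anchored_def)
  qed (use 0 in \<open>auto simp: small_anchored_def one_step_False\<close>)
next
  case (Suc k)
  \<comment> \<open>The tangent at 0, where \<open>survival\<close> vanishes, bounds it by c times
    \<delta>. The sign of c is unknown, hence the denominator with \<bar>c\<bar> + 1; the cap at 1
    keeps \<delta> a density.\<close>
  obtain c where c: "\<And>a. 0 \<le> a \<Longrightarrow> a \<le> 1 \<Longrightarrow> survival m d a \<le> survival m d 0 + c * (a - 0)"
    using survival_tangent[of 0] by auto
  define \<delta> where "\<delta> = min 1 (\<epsilon> / (4 * (\<bar>c\<bar> + 1)))"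
  have \<delta>: "0 < \<delta>" "\<delta> \<le> 1" using Suc(2) by (auto simp: \<delta>_def)
  have "c * \<delta> \<le> (\<bar>c\<bar> + 1) * \<delta>" using \<delta> by (intro mult_right_mono) auto
  also have "\<dots> \<le> (\<bar>c\<bar> + 1) * (\<epsilon> / (4 * (\<bar>c\<bar> + 1)))" by (intro mult_left_mono) (auto simp: \<delta>_def)
  also have "\<dots> = \<epsilon> / 4" by (simp add: field_simps add_eq_0_iff)
  finally have s: "survival m d \<delta> \<le> \<epsilon> / 4" using c[of \<delta>] \<delta> by (simp add: survival_def)
  let ?X = "\<lambda>V D. {u. card (cluster D u) \<le> k}"
  let ?P1 = "\<lambda>V D L. 1 \<le> card {l \<in> L. l \<inter> small_anchored k V D \<noteq> {}}"
  let ?P2 = "\<lambda>V D L. entangled (?X V D) D L"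
  have "\<forall>\<^sub>F x in sparse m d. one_step ?P1 x \<le> survival m d \<delta> + \<epsilon> / 4"
    using \<delta> Suc by (intro one_step_hits) (auto simp: small_anchored_def)
  \<comment> \<open>The exceptional set B is empty, since X only contains vertices with clusters of
    size at most k.\<close>
  moreover have "\<forall>\<^sub>F x in sparse m d. one_step ?P2 x \<le> ((d * fact m + 1) + (d * fact m + 1) ^ 2) * 0 + \<epsilon> / 4"
    using Suc(2) by (intro one_step_entangled[where B = "\<lambda>_ _. {}" and K = k]) (auto simp: mean_def)
  ultimately have "\<forall>\<^sub>F x in sparse m d. one_step (\<lambda>V D L. ?P1 V D L \<or> ?P2 V D L) x \<le> \<epsilon>"
    using finite_sparse
  proof eventually_elim
    case (elim x)
    then have "one_step (\<lambda>V D L. ?P1 V D L \<or> ?P2 V D L) x \<le> one_step ?P1 x + one_step ?P2 x"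
      by (intro one_step_or) auto
    with elim s Suc(2) show ?case by linarith
  qed
  then show ?case
  proof (rule mean_le_one_step[rotated 2])
    fix V :: "nat set" and E v
    assume V: "finite V" and E: "E \<subseteq> rsets V (Suc m)" and v: "v \<in> small_anchored (Suc k) V E"
    note finE = rsets_edges(1,2)[OF V E]
    have vV: "v \<in> V" using v by (simp add: small_anchored_def)
    show "1 \<le> card {l \<in> links E {v} v. l \<inter> small_anchored k (V - {v}) (avoid E {v}) \<noteq> {}} \<or>
        entangled {u. card (cluster (avoid E {v}) u) \<le> k} (avoid E {v}) (links E {v} v)"
    proof (rule disjCI)
      assume not: "\<not> entangled {u. card (cluster (avoid E {v}) u) \<le> k} (avoid E {v}) (links E {v} v)"
      have "\<exists>l\<in>links E {v} v. l \<inter> (anchored (avoid E {v}) \<inter> {u. card (cluster (avoid E {v}) u) \<le> k}) \<noteq> {}"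
      proof (rule anchored_hits_or_entangled[OF finE(1) _ _ not])
        show "v \<in> anchored E" using v by (simp add: small_anchored_def)
        fix l u assume l: "l \<in> links E {v} v" "u \<in> l"
        note L = linksD[OF l(1)]
        have "card (cluster (avoid E {v}) u) < card (cluster E v)"
          using L l by (intro card_cluster_avoid_less[where e = "insert v l"] finE) auto
        then show "u \<in> {u. card (cluster (avoid E {v}) u) \<le> k}" using v by (simp add: small_anchored_def)
      qed
      then have "\<exists>l\<in>links E {v} v. l \<inter> small_anchored k (V - {v}) (avoid E {v}) \<noteq> {}"
        using links_rsets(1)[OF V E vV] unfolding small_anchored_def by blast
      then show "1 \<le> card {l \<in> links E {v} v. l \<inter> small_anchored k (V - {v}) (avoid E {v}) \<noteq> {}}"
        using finE by (subst card_hits_ge1_iff) auto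
    qed
  qed (auto simp: small_anchored_def)
qed

section \<open>Degree sums and the surplus of edges in large clusters\<close>

definition high_degree :: "nat \<Rightarrow> nat set \<Rightarrow> nat set set \<Rightarrow> nat set" where
  "high_degree i V E = {v \<in> V. i \<le> edeg E v}"

lemma lower_density_high_degree: "lower_density m d (high_degree i) (poisson_tail d i)"
proof -
  have "lower_density m d (high_degree i) (poisson_tail (d * (1 - (1 - 1) ^ m)) i)"
  proof (rule lower_density_transfer[OF lower_density_all _ _ _ link_limit_hits])
    fix V :: "nat set" and W v and E :: "nat set set"
    assume V: "finite V" and E: "E \<subseteq> rsets V (Suc m)" and W: "W \<subseteq> V" "v \<in> W"
      and hit: "i \<le> card {l \<in> links E W v. l \<inter> (V - W) \<noteq> {}}"
    note finE = rsets_edges(1)[OF V E]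
    have "card {l \<in> links E W v. l \<inter> (V - W) \<noteq> {}} \<le> card (links E W v)"
      using finE by (intro card_mono) auto
    also have "\<dots> \<le> edeg E v" by (rule card_links_le_edeg[OF finE])
    finally show "v \<in> high_degree i V E" using hit W by (auto simp: high_degree_def)
  qed (use m d in \<open>auto simp: high_degree_def\<close>)
  then show ?thesis using m by (simp add: power_0_left)
qed

lemma rho_exp: "exp (- (d * (1 - (1 - \<rho>) ^ m))) = 1 - \<rho>"
  using rho_fixed by (simp add: survival_def)

text \<open>Size of the cluster and degree depend on the same links, hence the joint limit. Summed
  over i \<ge> 1 these values give \<open>d * (1 - (1 - \<rho>) ^ Suc m)\<close>, the degree sum per
  vertex of the ground set that lies in large clusters.\<close>

lemma lower_density_large_high_degree:
  "lower_density m d (\<lambda>V E. large (Suc K) V E \<inter> high_degree i V E)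
    (poisson_tail d i - (1 - \<rho>) * poisson_tail (d * (1 - \<rho>) ^ m) i)"
proof -
  have "lower_density m d (\<lambda>V E. large (Suc K) V E \<inter> high_degree i V E)
    (poisson_tail d i - exp (- (d * (1 - (1 - \<rho>) ^ m))) * poisson_tail (d * (1 - \<rho>) ^ m) i)"
  proof (rule lower_density_transfer[OF lower_density_large[of K] rho_nonneg _ _ link_limit_hit_and_ge])
    fix V :: "nat set" and W v and E :: "nat set set"
    assume V: "finite V" and E: "E \<subseteq> rsets V (Suc m)" and W: "W \<subseteq> V" "v \<in> W"
      and hit: "(\<exists>l\<in>links E W v. l \<inter> large K (V - W) (avoid E W) \<noteq> {}) \<and> i \<le> card (links E W v)"
    from hit obtain l u where l: "l \<in> links E W v" "u \<in> l" "K \<le> card (cluster (avoid E W) u)"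
      by (auto simp: large_def)
    note L = linksD[OF l(1)]
    have "card (cluster (avoid E W) u) < card (cluster E v)"
      using L l W by (intro card_cluster_avoid_less[where e = "insert v l"] rsets_edges(2)[OF V E]) auto
    moreover have "i \<le> edeg E v" using hit card_links_le_edeg[OF rsets_edges(1)[OF V E]] order_trans by blast
    ultimately show "v \<in> large (Suc K) V E \<inter> high_degree i V E" using l W by (auto simp: large_def high_degree_def)
  qed (use rho_less m d in \<open>auto simp: large_def\<close>)
  then show ?thesis by (simp only: rho_exp)
qed

end

lemma lower_density_mono: "lower_density m d Q q \<Longrightarrow> q' \<le> q \<Longrightarrow> lower_density m d Q q'"
  unfolding lower_density_def
proof (intro allI impI)
  fix \<epsilon> \<eta> :: real
  assume *: "\<forall>\<epsilon>>0. \<forall>\<eta>>0. \<forall>\<^sub>F x in sparse m d.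
     measure_pmf.prob (hypergraph_pmf m (fst x) (snd x)) {E. real (card (Q (fst x) E)) < (q - \<epsilon>) * real (card (fst x))} < \<eta>"
    and "q' \<le> q" "0 < \<epsilon>" "0 < \<eta>"
  from * \<open>0 < \<epsilon>\<close> \<open>0 < \<eta>\<close> have "\<forall>\<^sub>F x in sparse m d.
     measure_pmf.prob (hypergraph_pmf m (fst x) (snd x)) {E. real (card (Q (fst x) E)) < (q - \<epsilon>) * real (card (fst x))} < \<eta>" by blast
  then show "\<forall>\<^sub>F x in sparse m d.
     measure_pmf.prob (hypergraph_pmf m (fst x) (snd x)) {E. real (card (Q (fst x) E)) < (q' - \<epsilon>) * real (card (fst x))} < \<eta>"
  proof eventually_elim
    case (elim x)
    have "(q' - \<epsilon>) * real (card (fst x)) \<le> (q - \<epsilon>) * real (card (fst x))"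
      using \<open>q' \<le> q\<close> by (intro mult_right_mono) auto
    then have "measure_pmf.prob (hypergraph_pmf m (fst x) (snd x)) {E. real (card (Q (fst x) E)) < (q' - \<epsilon>) * real (card (fst x))}
      \<le> measure_pmf.prob (hypergraph_pmf m (fst x) (snd x)) {E. real (card (Q (fst x) E)) < (q - \<epsilon>) * real (card (fst x))}"
      by (intro prob_mono) auto
    with elim show ?case by simp
  qed
qed

lemma lower_density_closed:
  assumes "\<And>q'. q' < q \<Longrightarrow> lower_density m d Q q'"
  shows "lower_density m d Q q"
  unfolding lower_density_def
proof (intro allI impI)
  fix \<epsilon> \<eta> :: real assume "0 < \<epsilon>" "0 < \<eta>"
  have "lower_density m d Q (q - \<epsilon> / 2)" using \<open>0 < \<epsilon>\<close> by (intro assms) simp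
  from lower_densityD[OF this, of "\<epsilon> / 2" \<eta>] \<open>0 < \<epsilon>\<close> \<open>0 < \<eta>\<close>
  show "\<forall>\<^sub>F x in sparse m d.
     measure_pmf.prob (hypergraph_pmf m (fst x) (snd x)) {E. real (card (Q (fst x) E)) < (q - \<epsilon>) * real (card (fst x))} < \<eta>" by simp
qed

context fixpoint
begin

lemma upper_tail_single:
  assumes low: "lower_density m d Q q" and q: "0 \<le> q" "q \<le> 1" and \<epsilon>: "0 < \<epsilon>" and \<eta>: "0 < \<eta>"
    and mean: "\<forall>\<^sub>F x in sparse m d. mean Q x \<le> q + \<epsilon> * \<eta> / 8"
  shows "\<forall>\<^sub>F x in sparse m d. measure_pmf.prob (hypergraph_pmf m (fst x) (snd x))
    {E. (q + \<epsilon>) * real (card (fst x)) \<le> real (card (Q (fst x) E))} < \<eta>"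
proof -
  \<comment> \<open>The bound of \<open>squeeze_prob\<close> becomes 2 \<delta> + q \<delta> \<le> 3
    \<delta>, which is below \<epsilon> \<eta>.\<close>
  define \<delta> where "\<delta> = \<epsilon> * \<eta> / 8"
  have \<delta>: "0 < \<delta>" using \<epsilon> \<eta> by (simp add: \<delta>_def)
  show ?thesis
    using finite_sparse mean lower_densityD[OF low \<delta> \<delta>]
  proof eventually_elim
    case (elim x)
    let ?M = "hypergraph_pmf m (fst x) (snd x)"
    define N where "N = real (card (fst x))"
    have N: "0 < N" using elim by (simp add: N_def)
    let ?Y = "\<lambda>E. real (card (Q (fst x) E)) / N"
    have "\<epsilon> * measure_pmf.prob ?M {E. q + \<epsilon> \<le> ?Y E} \<le> 2 * \<delta> + q * \<delta>"
    proof (rule squeeze_prob)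
      show "measure_pmf.expectation ?M ?Y \<le> q + \<delta>" using elim(2) by (simp add: mean_def N_def \<delta>_def)
      have "{E. ?Y E < q - \<delta>} = {E. real (card (Q (fst x) E)) < (q - \<delta>) * N}"
        using N by (simp add: divide_less_eq)
      then show "measure_pmf.prob ?M {E. ?Y E < q - \<delta>} \<le> \<delta>" using elim(3) by (simp add: N_def)
    qed (use elim N q \<delta> \<epsilon> in auto)
    also have "\<dots> \<le> 2 * \<delta> + 1 * \<delta>" using q \<delta> by (intro add_left_mono mult_right_mono) auto
    also have "\<dots> < \<epsilon> * \<eta>" using \<epsilon> \<eta> by (simp add: \<delta>_def)
    finally have "measure_pmf.prob ?M {E. q + \<epsilon> \<le> ?Y E} < \<eta>" using \<epsilon> by simp
    moreover have "{E. q + \<epsilon> \<le> ?Y E} = {E. (q + \<epsilon>) * N \<le> real (card (Q (fst x) E))}"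
      using N by (simp add: le_divide_eq)
    ultimately show ?case by (simp add: N_def)
  qed
qed

lemma mean_add:
  assumes "\<And>V E. finite V \<Longrightarrow> E \<subseteq> rsets V (Suc m) \<Longrightarrow> card (Q V E) + card (Q' V E) \<le> card (R V E) + card (R' V E)" "finite (fst x)"
  shows "mean Q x + mean Q' x \<le> mean R x + mean R' x"
proof -
  let ?M = "hypergraph_pmf m (fst x) (snd x)"
  have "measure_pmf.expectation ?M (\<lambda>E. real (card (Q (fst x) E)) + real (card (Q' (fst x) E))) \<le>
      measure_pmf.expectation ?M (\<lambda>E. real (card (R (fst x) E)) + real (card (R' (fst x) E)))"
    using assms(2)
  proof (intro expectation_mono)
    fix E assume "E \<in> set_pmf ?M"
    from assms(1)[OF assms(2) random_subsetD[OF this]]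
    show "real (card (Q (fst x) E)) + real (card (Q' (fst x) E)) \<le> real (card (R (fst x) E)) + real (card (R' (fst x) E))"
      by linarith
  qed simp
  then show ?thesis
    using assms(2) by (simp add: mean_def divide_right_mono flip: add_divide_distrib)
qed

lemma mean_empty [simp]: "mean (\<lambda>V E. {}) x = 0"
  by (simp add: mean_def)

lemma mean_lower:
  assumes low: "lower_density m d Q q" and q: "q \<le> 1" and \<delta>: "0 < \<delta>"
  shows "\<forall>\<^sub>F x in sparse m d. q - \<delta> \<le> mean Q x"
proof -
  have \<delta>2: "0 < \<delta> / 2" using \<delta> by simp
  show ?thesis
    using finite_sparse lower_densityD[OF low \<delta>2 \<delta>2]
  proof eventually_elim
    case (elim x)
    let ?M = "hypergraph_pmf m (fst x) (snd x)"
    define N where "N = real (card (fst x))"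
    have N: "0 < N" using elim by (simp add: N_def)
    let ?L = "{E. real (card (Q (fst x) E)) < (q - \<delta> / 2) * N}"
    have "q - \<delta> \<le> (q - \<delta> / 2) - measure_pmf.prob ?M ?L" using elim(2) by (simp add: N_def)
    also have "\<dots> = measure_pmf.expectation ?M (\<lambda>E. (q - \<delta> / 2) - indicator ?L E)"
      using elim(1) by simp
    also have "\<dots> \<le> measure_pmf.expectation ?M (\<lambda>E. real (card (Q (fst x) E)) / N)"
    proof (rule expectation_mono)
      fix E
      have "(q - \<delta> / 2) - 1 \<le> 0" using q \<delta> by simp
      moreover have "0 \<le> real (card (Q (fst x) E)) / N" using N by simp
      ultimately have "(q - \<delta> / 2) - 1 \<le> real (card (Q (fst x) E)) / N" by linarith
      moreover have "q - \<delta> / 2 \<le> real (card (Q (fst x) E)) / N" if "E \<notin> ?L"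
        using that N by (simp add: le_divide_eq not_less)
      ultimately show "(q - \<delta> / 2) - indicator ?L E \<le> real (card (Q (fst x) E)) / N"
        by (cases "E \<in> ?L") auto
    qed (use elim in simp)
    also have "\<dots> = mean Q x" by (simp add: mean_def N_def)
    finally show ?case .
  qed
qed

text \<open>Layer-cake summation. The truncation at B is needed because density bounds are available
  for only finitely many degrees at a time.\<close>

lemma sum_card_high_degree:
  assumes "finite V" "S \<subseteq> V"
  shows "(\<Sum>i<B. card (S \<inter> high_degree (Suc i) V E)) = (\<Sum>v\<in>S. min (edeg E v) B)"
proof -
  have finS: "finite S" using assms finite_subset by blast
  have "card (S \<inter> high_degree (Suc i) V E) = (\<Sum>v\<in>S. of_bool (i < edeg E v))" for i
  proof -
    have "S \<inter> high_degree (Suc i) V E = S \<inter> {v. i < edeg E v}" using assms by (auto simp: high_degree_def)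
    then show ?thesis using finS by (simp add: of_bool_def sum.If_cases)
  qed
  then have "(\<Sum>i<B. card (S \<inter> high_degree (Suc i) V E)) = (\<Sum>i<B. \<Sum>v\<in>S. of_bool (i < edeg E v))" by simp
  also have "\<dots> = (\<Sum>v\<in>S. \<Sum>i<B. of_bool (i < edeg E v))" by (rule sum.swap)
  also have "\<dots> = (\<Sum>v\<in>S. min (edeg E v) B)"
  proof (intro sum.cong refl)
    fix v
    have "{..<B} \<inter> {i. i < edeg E v} = {..<min (edeg E v) B}" by auto
    then show "(\<Sum>i<B. of_bool (i < edeg E v)) = min (edeg E v) B" by (simp add: of_bool_def sum.If_cases)
  qed
  finally show ?thesis .
qed

text \<open>The mean is computed from the number of potential edges, the lower tail comes from
  truncated degrees, and \<open>squeeze_prob\<close> turns the two into an upper tail.\<close>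

lemma sum_degree_upper_tail:
  assumes \<epsilon>: "0 < \<epsilon>" and \<eta>: "0 < \<eta>"
  shows "\<forall>\<^sub>F x in sparse m d. measure_pmf.prob (hypergraph_pmf m (fst x) (snd x))
    {E. (d + \<epsilon>) * real (card (fst x)) \<le> real (\<Sum>v\<in>fst x. edeg E v)} < \<eta>"
proof -
  define \<delta> where "\<delta> = \<epsilon> * \<eta> / 8"
  define \<kappa> where "\<kappa> = \<epsilon> * \<eta> / (8 * (d + 1))"
  have \<delta>: "0 < \<delta>" using \<epsilon> \<eta> by (simp add: \<delta>_def)
  have \<kappa>: "0 < \<kappa>" using \<epsilon> \<eta> d by (simp add: \<kappa>_def)
  have "(\<lambda>B. \<Sum>i<B. poisson_tail d (Suc i)) \<longlonglongrightarrow> d" using poisson_tail_sums[of d] d by (simp add: sums_def)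
  then have "\<forall>\<^sub>F B in sequentially. d - \<delta> / 2 < (\<Sum>i<B. poisson_tail d (Suc i))"
    using \<delta> by (intro order_tendstoD(1)) auto
  then obtain B where B: "d - \<delta> / 2 < (\<Sum>i<B. poisson_tail d (Suc i))"
    by (auto simp: eventually_sequentially)
  have "\<forall>\<^sub>F x in sparse m d. measure_pmf.prob (hypergraph_pmf m (fst x) (snd x))
      {E. real (\<Sum>i<B. card (high_degree (Suc i) (fst x) E)) < ((\<Sum>i<B. poisson_tail d (Suc i)) - \<delta> / 2) * real (card (fst x))} < \<kappa>"
    using \<delta> \<kappa> by (intro lower_density_sum lower_density_high_degree) auto
  moreover have "\<forall>\<^sub>F x in sparse m d. snd x * real (card (fst x) choose m) < d + \<delta>"
    by (rule order_tendstoD(2)[OF tendsto_sparse]) (use \<delta> in simp)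
  ultimately show ?thesis
    using finite_sparse
  proof eventually_elim
    case (elim x)
    obtain V p where x: "x = (V, p)" by (cases x)
    define N where "N = real (card V)"
    have V: "finite V" "0 < card V" "0 \<le> p" "p \<le> 1" and N: "0 < N" using elim by (auto simp: x N_def)
    let ?M = "hypergraph_pmf m V p"
    let ?Y = "\<lambda>E. real (\<Sum>v\<in>V. edeg E v) / N"
    have sum: "(\<Sum>v\<in>V. edeg E v) = (\<Sum>e\<in>E. Suc m)" if "E \<in> set_pmf ?M" for E
    proof -
      have E: "E \<subseteq> rsets V (Suc m)" using that by (rule random_subsetD)
      have "(\<Sum>v\<in>V. edeg E v) = (\<Sum>e\<in>E. card (e \<inter> V))"
        using rsets_edges(1)[OF V(1) E] V by (intro sum_edeg) auto
      also have "\<dots> = (\<Sum>e\<in>E. Suc m)"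
        using E by (intro sum.cong refl) (auto simp: rsets_def Int_absorb2)
      finally show ?thesis .
    qed
    have "measure_pmf.expectation ?M (\<lambda>E. real (\<Sum>v\<in>V. edeg E v)) = measure_pmf.expectation ?M (\<lambda>E. \<Sum>e\<in>E. real (Suc m))"
      by (intro integral_cong_AE) (auto simp: AE_measure_pmf_iff sum simp del: of_nat_Suc sum_constant of_nat_sum intro!: of_nat_sum)
    also have "\<dots> = p * (\<Sum>e\<in>rsets V (Suc m). real (Suc m))"
      using V by (intro expectation_sum_random_subset) auto
    also have "\<dots> = p * real (Suc m * (card V choose Suc m))"
      using V by (simp add: card_rsets algebra_simps del: binomial_Suc_Suc)
    \<comment> \<open>Double counting of incidences makes the mean degree appear.\<close>
    also have "Suc m * (card V choose Suc m) = card V * ((card V - 1) choose m)"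
      using Suc_times_binomial_eq[of "card V - 1" m] V by simp
    also have "p * real (card V * ((card V - 1) choose m)) \<le> N * (p * real (card V choose m))"
    proof -
      have "(card V - 1) choose m \<le> card V choose m" by (rule binomial_right_mono) simp
      then have "p * N * real ((card V - 1) choose m) \<le> p * N * real (card V choose m)"
        using V N by (intro mult_left_mono) auto
      then show ?thesis by (simp add: N_def mult_ac)
    qed
    also have "\<dots> \<le> N * (d + \<delta>)" using elim(2) N by (intro mult_left_mono) (auto simp: x)
    finally have mean: "measure_pmf.expectation ?M ?Y \<le> d + \<delta>"
      using N by (simp add: divide_le_eq mult.commute)
    have "\<epsilon> * measure_pmf.prob ?M {E. d + \<epsilon> \<le> ?Y E} \<le> 2 * \<delta> + d * \<kappa>"
    proof (rule squeeze_prob[OF _ _ _ _ _ mean])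
      have "measure_pmf.prob ?M {E. ?Y E < d - \<delta>} \<le> measure_pmf.prob ?M
        {E. real (\<Sum>i<B. card (high_degree (Suc i) V E)) < ((\<Sum>i<B. poisson_tail d (Suc i)) - \<delta> / 2) * N}"
      proof (rule prob_mono)
        fix E assume "E \<in> {E. ?Y E < d - \<delta>}"
        then have less: "real (\<Sum>v\<in>V. edeg E v) < (d - \<delta>) * N" using N by (simp add: divide_less_eq)
        have "(\<Sum>i<B. card (V \<inter> high_degree (Suc i) V E)) \<le> (\<Sum>v\<in>V. edeg E v)"
          unfolding sum_card_high_degree[OF V(1) order_refl] by (intro sum_mono) simp
        moreover have "V \<inter> high_degree i V E = high_degree i V E" for i by (auto simp: high_degree_def)
        ultimately have "(\<Sum>i<B. card (high_degree (Suc i) V E)) \<le> (\<Sum>v\<in>V. edeg E v)" by simp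
        then have "real (\<Sum>i<B. card (high_degree (Suc i) V E)) \<le> real (\<Sum>v\<in>V. edeg E v)" by (rule of_nat_mono)
        also note less
        also have "(d - \<delta>) * N \<le> ((\<Sum>i<B. poisson_tail d (Suc i)) - \<delta> / 2) * N"
          using B N by (intro mult_right_mono) auto
        finally show "E \<in> {E. real (\<Sum>i<B. card (high_degree (Suc i) V E)) < ((\<Sum>i<B. poisson_tail d (Suc i)) - \<delta> / 2) * N}" by simp
      qed
      then show "measure_pmf.prob ?M {E. ?Y E < d - \<delta>} \<le> \<kappa>" using elim(1) by (simp add: x N_def)
    qed (use V N d \<delta> \<epsilon> in \<open>auto intro!: divide_nonneg_nonneg sum_nonneg\<close>)
    also have "d * \<kappa> \<le> \<delta>"
    proof -
      have "z / 8 = y * (z / (8 * y))" if "0 < y" for y z :: real using that by simp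
      from this[of "d + 1" "\<epsilon> * \<eta>"] have "\<delta> = (d + 1) * \<kappa>"
        unfolding \<kappa>_def \<delta>_def using d by simp
      then show ?thesis using \<kappa> by (simp add: distrib_right)
    qed
    also have "2 * \<delta> + \<delta> < \<epsilon> * \<eta>" using \<epsilon> \<eta> by (simp add: \<delta>_def)
    finally have "measure_pmf.prob ?M {E. d + \<epsilon> \<le> ?Y E} < \<eta>" using \<epsilon> by simp
    moreover have "{E. d + \<epsilon> \<le> ?Y E} = {E. (d + \<epsilon>) * N \<le> real (\<Sum>v\<in>V. edeg E v)}"
      using N by (simp add: le_divide_eq)
    ultimately show ?case by (simp add: x N_def)
  qed
qed

text \<open>Few anchored vertices could still have a large degree sum. Their degrees are cut at B,
  and the excess over B is bounded by the excess over all vertices, which is small for large B. The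
  rest is the forest bound for edges that avoid the anchored vertices.\<close>

lemma anch_degree_bound:
  assumes V: "finite V" and E: "E \<subseteq> rsets V (Suc m)"
  shows "real m * real (\<Sum>i<B. card (large K V E \<inter> high_degree (Suc i) V E)) \<le>
    real (Suc m) * real (card (large K V E)) +
    real (Suc m) * real m * (real B * real (card (anch V E)) +
      (real (\<Sum>v\<in>V. edeg E v) - real (\<Sum>i<B. card (high_degree (Suc i) V E))))"
proof -
  note finE = rsets_edges[OF V E]
  have sub: "anchored E \<subseteq> V" by (rule subset_trans[OF anchored_subset finE(3)])
  have anch: "anch V E = anchored E" using sub by (auto simp: anch_def)
  have S: "large K V E \<subseteq> V" "finite (large K V E)" using V by (auto simp: large_def)
  have "(\<Sum>i<B. card (large K V E \<inter> high_degree (Suc i) V E)) \<le> (\<Sum>v\<in>large K V E. edeg E v)"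
    unfolding sum_card_high_degree[OF V S(1)] by (intro sum_mono) simp
  then have "m * (\<Sum>i<B. card (large K V E \<inter> high_degree (Suc i) V E)) \<le> m * (\<Sum>v\<in>large K V E. edeg E v)"
    by (rule mult_le_mono2)
  also have "\<dots> \<le> Suc m * card (large K V E) + Suc m * m * (\<Sum>v\<in>anchored E. edeg E v)"
  proof (rule sum_edeg_le_anchored[OF finE(1) S(2) finE(4)])
    fix e assume e: "e \<in> E" "e \<inter> large K V E \<noteq> {}"
    then obtain v where v: "v \<in> e" "v \<in> large K V E" by auto
    show "e \<subseteq> large K V E"
    proof
      fix u assume "u \<in> e"
      then have "cluster E u = cluster E v" using e v by (intro cluster_eq cluster_step[OF cluster_refl]) auto
      moreover have "u \<in> V" using \<open>u \<in> e\<close> e(1) finE(3) by blast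
      ultimately show "u \<in> large K V E" using v by (simp add: large_def)
    qed
  qed
  finally have "real (m * (\<Sum>i<B. card (large K V E \<inter> high_degree (Suc i) V E))) \<le>
      real (Suc m * card (large K V E) + Suc m * m * (\<Sum>v\<in>anchored E. edeg E v))"
    by (rule of_nat_mono)
  then have 1: "real m * real (\<Sum>i<B. card (large K V E \<inter> high_degree (Suc i) V E)) \<le>
      real (Suc m) * real (card (large K V E)) + real (Suc m) * real m * real (\<Sum>v\<in>anchored E. edeg E v)"
    by (simp only: of_nat_mult of_nat_add)
  \<comment> \<open>Each degree is at most B plus its excess over B, and the nonnegative excesses
    may be summed over all of V.\<close>
  have "real (\<Sum>v\<in>anchored E. edeg E v) = (\<Sum>v\<in>anchored E. real (edeg E v))" by simp
  also have "\<dots> \<le> (\<Sum>v\<in>anchored E. real B + (real (edeg E v) - real (min (edeg E v) B)))"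
    by (intro sum_mono) auto
  also have "\<dots> = real B * real (card (anchored E)) + (\<Sum>v\<in>anchored E. real (edeg E v) - real (min (edeg E v) B))"
    by (simp add: sum.distrib)
  also have "(\<Sum>v\<in>anchored E. real (edeg E v) - real (min (edeg E v) B)) \<le> (\<Sum>v\<in>V. real (edeg E v) - real (min (edeg E v) B))"
    using V sub by (intro sum_mono2) auto
  also have "\<dots> = real (\<Sum>v\<in>V. edeg E v) - real (\<Sum>v\<in>V. min (edeg E v) B)"
    by (simp add: sum_subtractf)
  also have "(\<Sum>v\<in>V. min (edeg E v) B) = (\<Sum>i<B. card (V \<inter> high_degree (Suc i) V E))"
    by (rule sum_card_high_degree[OF V order_refl, symmetric])
  also have "\<dots> = (\<Sum>i<B. card (high_degree (Suc i) V E))"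
    by (intro sum.cong refl arg_cong[where f = card]) (auto simp: high_degree_def)
  finally have "real (\<Sum>v\<in>anchored E. edeg E v) \<le> real B * real (card (anch V E)) +
      (real (\<Sum>v\<in>V. edeg E v) - real (\<Sum>i<B. card (high_degree (Suc i) V E)))" by (simp add: anch)
  then have "real (Suc m) * real m * real (\<Sum>v\<in>anchored E. edeg E v) \<le> real (Suc m) * real m * (real B * real (card (anch V E)) +
      (real (\<Sum>v\<in>V. edeg E v) - real (\<Sum>i<B. card (high_degree (Suc i) V E))))"
    by (intro mult_left_mono) auto
  with 1 show ?thesis by linarith
qed

text \<open>
  In the supercritical case the large clusters span too many edges to be forests, so a positive
  fraction of all vertices is anchored.
\<close>

lemma anch_nonvanishing:
  assumes \<rho>: "0 < \<rho>"
  obtains \<delta> where "0 < \<delta>" "lower_density m d anch \<delta>"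
proof -
  let ?x = "1 - \<rho>"
  \<comment> \<open>Up to the factor m (m + 1) this is the surplus: large clusters carry d (1 -
    x^(m+1)) / (m+1) edges per vertex of the ground set, while a forest on density \<rho> has at
    most \<rho> / m.\<close>
  define \<kappa> where "\<kappa> = real m * d * (1 - ?x ^ Suc m) - real (Suc m) * \<rho>"
  have \<kappa>: "0 < \<kappa>" using excess_pos[OF \<rho>] by (simp add: \<kappa>_def)
  have m0: "0 < real m" using m by simp
  define c where "c = real (Suc m) * real m"
  have c: "0 < c" using m0 by (simp add: c_def)
  define t where "t = (\<lambda>i. poisson_tail d i - ?x * poisson_tail (d * ?x ^ m) i)"
  have s: "(\<lambda>i. poisson_tail d (Suc i)) sums d" using d by (intro poisson_tail_sums) simp
  have "(\<lambda>i. t (Suc i)) sums (d - ?x * (d * ?x ^ m))"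
    unfolding t_def using d rho_less by (intro sums_diff sums_mult poisson_tail_sums) auto
  then have t: "(\<lambda>i. t (Suc i)) sums (d * (1 - ?x ^ Suc m))" by (simp add: algebra_simps)
  have "\<forall>\<^sub>F B in sequentially. d - \<kappa> / (8 * c) < (\<Sum>i<B. poisson_tail d (Suc i))"
    using s \<kappa> c unfolding sums_def by (intro order_tendstoD(1)) auto
  moreover have "\<forall>\<^sub>F B in sequentially. d * (1 - ?x ^ Suc m) - \<kappa> / (8 * real m) < (\<Sum>i<B. t (Suc i))"
    using t \<kappa> m0 unfolding sums_def by (intro order_tendstoD(1)) auto
  ultimately have "\<forall>\<^sub>F B in sequentially. d - \<kappa> / (8 * c) < (\<Sum>i<B. poisson_tail d (Suc i)) \<and>
    d * (1 - ?x ^ Suc m) - \<kappa> / (8 * real m) < (\<Sum>i<B. t (Suc i))" by (rule eventually_conj)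
  then obtain B where B1: "d - \<kappa> / (8 * c) < (\<Sum>i<B. poisson_tail d (Suc i))"
    and B2: "d * (1 - ?x ^ Suc m) - \<kappa> / (8 * real m) < (\<Sum>i<B. t (Suc i))"
    by (auto simp: eventually_sequentially)
  \<comment> \<open>One more than B, so that division is safe if B = 0.\<close>
  define b where "b = real B + 1"
  have b: "0 < b" "real B \<le> b" by (auto simp: b_def)
  define \<delta> where "\<delta> = \<kappa> / (4 * c * b)"
  have \<delta>: "0 < \<delta>" using \<kappa> c b by (simp add: \<delta>_def)
  have "lower_density m d anch \<delta>"
    unfolding lower_density_def
  proof (intro allI impI)
    fix \<epsilon> \<eta> :: real assume \<epsilon>: "0 < \<epsilon>" and \<eta>: "0 < \<eta>"
    define \<epsilon>2 where "\<epsilon>2 = \<kappa> / (8 * real (Suc m))"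
    have \<epsilon>2: "0 < \<epsilon>2" using \<kappa> by (simp add: \<epsilon>2_def)
    have e2: "0 < \<epsilon>2 * (\<eta> / 4) / 8" using \<epsilon>2 \<eta> by simp
    then obtain K where K: "\<forall>\<^sub>F x in sparse m d. mean (large K) x \<le> \<rho> + \<epsilon>2 * (\<eta> / 4) / 8"
      using mean_large[of "\<rho> + \<epsilon>2 * (\<eta> / 4) / 8"] by auto
    \<comment> \<open>The degree estimate for large clusters is stated for a successor threshold, so
      the upper bound is moved there as well.\<close>
    have "\<forall>\<^sub>F x in sparse m d. mean (large (Suc K)) x \<le> \<rho> + \<epsilon>2 * (\<eta> / 4) / 8"
      using K finite_sparse
    proof eventually_elim
      case (elim x)
      have "mean (large (Suc K)) x \<le> mean (large K) x"
        using elim by (intro mean_mono card_mono) (auto simp: large_def)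
      with elim show ?case by simp
    qed
    then have A2: "\<forall>\<^sub>F x in sparse m d. measure_pmf.prob (hypergraph_pmf m (fst x) (snd x))
      {E. (\<rho> + \<epsilon>2) * real (card (fst x)) \<le> real (card (large (Suc K) (fst x) E))} < \<eta> / 4"
      using rho_nonneg rho_less \<epsilon>2 \<eta> by (intro upper_tail_single lower_density_large) auto
    have A1: "\<forall>\<^sub>F x in sparse m d. measure_pmf.prob (hypergraph_pmf m (fst x) (snd x))
      {E. real (\<Sum>i<B. card (large (Suc K) (fst x) E \<inter> high_degree (Suc i) (fst x) E)) <
        ((\<Sum>i<B. t (Suc i)) - \<kappa> / (16 * real m)) * real (card (fst x))} < \<eta> / 4"
      unfolding t_def using \<kappa> m0 \<eta> by (intro lower_density_sum lower_density_large_high_degree) auto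
    have A3: "\<forall>\<^sub>F x in sparse m d. measure_pmf.prob (hypergraph_pmf m (fst x) (snd x))
      {E. (d + \<kappa> / (16 * c)) * real (card (fst x)) \<le> real (\<Sum>v\<in>fst x. edeg E v)} < \<eta> / 4"
      using \<kappa> c \<eta> by (intro sum_degree_upper_tail) auto
    have A4: "\<forall>\<^sub>F x in sparse m d. measure_pmf.prob (hypergraph_pmf m (fst x) (snd x))
      {E. real (\<Sum>i<B. card (high_degree (Suc i) (fst x) E)) <
        ((\<Sum>i<B. poisson_tail d (Suc i)) - \<kappa> / (16 * c)) * real (card (fst x))} < \<eta> / 4"
      using \<kappa> c \<eta> by (intro lower_density_sum lower_density_high_degree) auto
    show "\<forall>\<^sub>F x in sparse m d. measure_pmf.prob (hypergraph_pmf m (fst x) (snd x))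
      {E. real (card (anch (fst x) E)) < (\<delta> - \<epsilon>) * real (card (fst x))} < \<eta>"
      using A1 A2 A3 A4 finite_sparse
    proof eventually_elim
      case (elim x)
      obtain V p where x: "x = (V, p)" by (cases x)
      define N where "N = real (card V)"
      have V: "finite V" and N: "0 < N" using elim by (auto simp: x N_def)
      let ?M = "hypergraph_pmf m V p"
      let ?W = "\<lambda>E. real (\<Sum>i<B. card (large (Suc K) V E \<inter> high_degree (Suc i) V E))"
      let ?S = "\<lambda>E. real (card (large (Suc K) V E))"
      let ?T = "\<lambda>E. real (\<Sum>v\<in>V. edeg E v)"
      let ?U = "\<lambda>E. real (\<Sum>i<B. card (high_degree (Suc i) V E))"
      let ?B1 = "\<lambda>E. ?W E < ((\<Sum>i<B. t (Suc i)) - \<kappa> / (16 * real m)) * N"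
      let ?B2 = "\<lambda>E. (\<rho> + \<epsilon>2) * N \<le> ?S E"
      let ?B3 = "\<lambda>E. (d + \<kappa> / (16 * c)) * N \<le> ?T E"
      let ?B4 = "\<lambda>E. ?U E < ((\<Sum>i<B. poisson_tail d (Suc i)) - \<kappa> / (16 * c)) * N"
      have "measure_pmf.prob ?M {E. real (card (anch V E)) < (\<delta> - \<epsilon>) * N} \<le>
        measure_pmf.prob ?M {E. (?B1 E \<or> ?B2 E) \<or> (?B3 E \<or> ?B4 E)}"
      proof (rule prob_mono, rule CollectI, rule ccontr)
        fix E assume "E \<in> set_pmf ?M" and low: "E \<in> {E. real (card (anch V E)) < (\<delta> - \<epsilon>) * N}"
          and "\<not> ((?B1 E \<or> ?B2 E) \<or> (?B3 E \<or> ?B4 E))"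
        then have n: "((\<Sum>i<B. t (Suc i)) - \<kappa> / (16 * real m)) * N \<le> ?W E" "?S E \<le> (\<rho> + \<epsilon>2) * N"
            "?T E \<le> (d + \<kappa> / (16 * c)) * N" "((\<Sum>i<B. poisson_tail d (Suc i)) - \<kappa> / (16 * c)) * N \<le> ?U E"
          by linarith+
        have E: "E \<subseteq> rsets V (Suc m)" using \<open>E \<in> set_pmf ?M\<close> by (rule random_subsetD)
        have "(\<kappa> + real (Suc m) * \<rho> - \<kappa> / 8 - \<kappa> / 16) * N = real m * ((d * (1 - ?x ^ Suc m) - \<kappa> / (8 * real m) - \<kappa> / (16 * real m)) * N)"
          using m0 by (simp add: \<kappa>_def field_simps)
        also have "\<dots> \<le> real m * (((\<Sum>i<B. t (Suc i)) - \<kappa> / (16 * real m)) * N)"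
          using B2 N m0 by (intro mult_left_mono mult_right_mono) auto
        also have "\<dots> \<le> real m * ?W E" using n(1) m0 by (intro mult_left_mono) auto
        finally have w: "(\<kappa> + real (Suc m) * \<rho> - \<kappa> / 8 - \<kappa> / 16) * N \<le> real m * ?W E" .
        have "real (Suc m) * ?S E \<le> real (Suc m) * ((\<rho> + \<epsilon>2) * N)" using n(2) by (intro mult_left_mono) auto
        also have "\<dots> = (real (Suc m) * \<rho> + \<kappa> / 8) * N" by (simp add: \<epsilon>2_def field_simps del: of_nat_Suc)
        finally have ss: "real (Suc m) * ?S E \<le> (real (Suc m) * \<rho> + \<kappa> / 8) * N" .
        have "?T E - ?U E \<le> (\<kappa> / (16 * c) + \<kappa> / (16 * c) + \<kappa> / (8 * c)) * N"
        proof -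
          have "?T E - ?U E \<le> (d + \<kappa> / (16 * c)) * N - ((\<Sum>i<B. poisson_tail d (Suc i)) - \<kappa> / (16 * c)) * N"
            by (rule diff_mono[OF n(3,4)])
          also have "\<dots> = (d - (\<Sum>i<B. poisson_tail d (Suc i)) + \<kappa> / (16 * c) + \<kappa> / (16 * c)) * N"
            by (simp add: algebra_simps)
          also have "\<dots> \<le> (\<kappa> / (16 * c) + \<kappa> / (16 * c) + \<kappa> / (8 * c)) * N"
            using B1 N by (intro mult_right_mono) auto
          finally show ?thesis .
        qed
        then have "c * (?T E - ?U E) \<le> c * ((\<kappa> / (16 * c) + \<kappa> / (16 * c) + \<kappa> / (8 * c)) * N)"
          using c by (intro mult_left_mono) auto
        also have "\<dots> = \<kappa> / 4 * N" using c by (simp add: field_simps)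
        finally have tu: "c * (?T E - ?U E) \<le> \<kappa> / 4 * N" .
        have "(\<delta> - \<epsilon>) * N \<le> \<delta> * N" using \<epsilon> N by (intro mult_right_mono) auto
        with low have "real (card (anch V E)) \<le> \<delta> * N" by simp
        then have "c * (real B * real (card (anch V E))) \<le> c * (b * (\<delta> * N))"
          using c N \<delta> b by (intro mult_left_mono mult_mono) auto
        also have "\<dots> = \<kappa> / 4 * N" using c b by (simp add: \<delta>_def field_simps)
        finally have a: "c * (real B * real (card (anch V E))) \<le> \<kappa> / 4 * N" .
        have "real m * ?W E \<le> real (Suc m) * ?S E + c * (real B * real (card (anch V E)) + (?T E - ?U E))"
          unfolding c_def by (rule anch_degree_bound[OF V E])
        with w ss tu a have "(\<kappa> + real (Suc m) * \<rho> - \<kappa> / 8 - \<kappa> / 16) * N \<le> (real (Suc m) * \<rho> + \<kappa> / 8) * N + \<kappa> / 4 * N + \<kappa> / 4 * N"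
          by (simp only: distrib_left)
        \<comment> \<open>The budget: of \<kappa>, the degree sum in large clusters loses 1/8 +
          1/16, the number of vertices in large clusters 1/8, and the excess degrees and the
          anchored vertices 1/4 each. The remaining 3/16 contradicts \<kappa> > 0.\<close>
        then have "3 / 16 * (\<kappa> * N) \<le> 0" by (simp add: algebra_simps)
        moreover have "0 < \<kappa> * N" using \<kappa> N by simp
        ultimately show False by linarith
      qed
      also have "\<dots> \<le> (measure_pmf.prob ?M {E. ?B1 E} + measure_pmf.prob ?M {E. ?B2 E}) +
          (measure_pmf.prob ?M {E. ?B3 E} + measure_pmf.prob ?M {E. ?B4 E})"
        by (rule order_trans[OF prob_Un_le add_mono[OF prob_Un_le prob_Un_le]])
      also have "\<dots> < \<eta>" using elim(1-4) by (simp add: x N_def)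
      finally show ?case by (simp add: x N_def)
    qed
  qed
  with \<delta> that show thesis by blast
qed

section \<open>The density of anchored vertices and the rarity of entanglement\<close>

lemma lower_density_anch_step:
  assumes "lower_density m d anch q" "0 \<le> q" "q \<le> 1"
  shows "lower_density m d anch (survival m d q)"
proof -
  have "lower_density m d anch (poisson_tail (d * (1 - (1 - q) ^ m)) 1)"
  proof (rule lower_density_transfer[OF assms _ link_limit_hits])
    fix V :: "nat set" and W v and E :: "nat set set"
    assume V: "finite V" and E: "E \<subseteq> rsets V (Suc m)" and W: "W \<subseteq> V" "v \<in> W"
      and hit: "1 \<le> card {l \<in> links E W v. l \<inter> anch (V - W) (avoid E W) \<noteq> {}}"
    note finE = rsets_edges(1)[OF V E]
    have "\<exists>l\<in>links E W v. l \<inter> anch (V - W) (avoid E W) \<noteq> {}"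
      using hit finE by (subst (asm) card_hits_ge1_iff) auto
    then obtain l where "l \<in> links E W v" "l \<inter> anchored (avoid E W) \<noteq> {}" by (auto simp: anch_def)
    then have "v \<in> anchored E" by (rule links_hit_anchored[OF finE])
    then show "v \<in> anch V E" using W by (auto simp: anch_def)
  qed (use m d in \<open>auto simp: anch_def\<close>)
  then show ?thesis by (simp only: survival_eq)
qed

text \<open>A supremum of attainable densities takes the place of infinitely many iterations: it is
  attainable itself, one more step does not leave the set, and below \<rho> this step would be
  strictly upward.\<close>

lemma lower_density_anch: "lower_density m d anch \<rho>"
proof (cases "0 < \<rho>")
  case False
  then show ?thesis using rho_nonneg by (intro lower_density_trivial) simp
next
  case True
  obtain \<delta> where \<delta>: "0 < \<delta>" "lower_density m d anch \<delta>" using anch_nonvanishing[OF True] .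
  define T where "T = {q. 0 \<le> q \<and> q \<le> \<rho> \<and> lower_density m d anch q}"
  have "min \<delta> \<rho> \<in> T"
    unfolding T_def mem_Collect_eq
    using True \<delta>(1) by (intro conjI lower_density_mono[OF \<delta>(2)]) auto
  have bdd: "bdd_above T" by (rule bdd_aboveI[of _ \<rho>]) (auto simp: T_def)
  define q where "q = Sup T"
  have "min \<delta> \<rho> \<le> q" unfolding q_def using \<open>min \<delta> \<rho> \<in> T\<close> bdd by (rule cSup_upper)
  then have q0: "0 < q" using \<delta> True by linarith
  have q1: "q \<le> \<rho>" 
  proof -
    have "T \<noteq> {}" using \<open>min \<delta> \<rho> \<in> T\<close> by blast
    then show ?thesis unfolding q_def by (rule cSup_least) (simp add: T_def)
  qed
  \<comment> \<open>The tolerance \<epsilon> built into \<open>lower_density\<close> makes the set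
    of attainable densities closed from below.\<close>
  have low: "lower_density m d anch q"
  proof (rule lower_density_closed)
    fix q' assume "q' < q"
    then obtain t where "t \<in> T" "q' < t" using less_cSup_iff[OF _ bdd, of q'] \<open>min \<delta> \<rho> \<in> T\<close> by (auto simp: q_def)
    then show "lower_density m d anch q'" using lower_density_mono[of m d anch t q'] by (simp add: T_def)
  qed
  have "q = \<rho>"
  proof (rule ccontr)
    assume "q \<noteq> \<rho>"
    then have "q < survival m d q" using q0 q1 by (intro survival_gt) auto
    moreover have "survival m d q \<in> T"
      using lower_density_anch_step[OF low] survival_le_rho[of q] survival_bounds[of d q m] d q0 q1 rho_less
      by (auto simp: T_def)
    then have "survival m d q \<le> q" unfolding q_def using bdd by (rule cSup_upper)
    ultimately show False by simp
  qed
  with low show ?thesis by simp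
qed

text \<open>No recursion on anchored vertices themselves is used here, since entanglement in large
  clusters is not yet under control. Large clusters are counted entirely, and the anchored vertices
  outside them are negligible.\<close>

lemma mean_anch:
  assumes "0 < \<epsilon>"
  shows "\<forall>\<^sub>F x in sparse m d. mean anch x \<le> \<rho> + \<epsilon>"
proof -
  obtain K where K: "\<forall>\<^sub>F x in sparse m d. mean (large K) x \<le> \<rho> + \<epsilon> / 2"
    using mean_large[of "\<rho> + \<epsilon> / 2"] assms by auto
  have "\<forall>\<^sub>F x in sparse m d. mean (small_anchored K) x \<le> \<epsilon> / 2"
    using assms by (intro mean_small_anchored) simp
  with K show ?thesis
    using finite_sparse
  proof eventually_elim
    case (elim x)
    have "mean anch x + mean (\<lambda>V E. {}) x \<le> mean (large K) x + mean (small_anchored K) x"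
    proof (rule mean_add)
      fix V :: "nat set" and E :: "nat set set" assume V: "finite V"
      have "card (anch V E) \<le> card (large K V E \<union> small_anchored K V E)"
        using V by (intro card_mono) (auto simp: anch_def large_def small_anchored_def)
      also have "\<dots> \<le> card (large K V E) + card (small_anchored K V E)" by (rule card_Un_le)
      finally show "card (anch V E) + card {} \<le> card (large K V E) + card (small_anchored K V E)" by simp
    qed (use elim in simp)
    with elim show ?case by simp
  qed
qed

text \<open>Large clusters have mean density at most about \<rho>, and anchored vertices, nearly all
  of which lie in large clusters, already account for \<rho>.\<close>

lemma mean_large_not_anchored:
  assumes "0 < \<epsilon>"
  shows "\<exists>K. \<forall>\<^sub>F x in sparse m d. mean (\<lambda>V E. large K V E - anchored E) x \<le> \<epsilon>"
proof -
  have e: "0 < \<epsilon> / 3" using assms by simp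
  then obtain K where K: "\<forall>\<^sub>F x in sparse m d. mean (large K) x \<le> \<rho> + \<epsilon> / 3"
    using mean_large[of "\<rho> + \<epsilon> / 3"] by auto
  have "\<forall>\<^sub>F x in sparse m d. mean (\<lambda>V E. large K V E - anchored E) x \<le> \<epsilon>"
    using K mean_small_anchored[OF e, of K] mean_lower[OF lower_density_anch less_imp_le[OF rho_less] e] finite_sparse
  proof eventually_elim
    case (elim x)
    have "mean (\<lambda>V E. large K V E - anchored E) x + mean anch x \<le> mean (large K) x + mean (small_anchored K) x"
    proof (rule mean_add)
      fix V :: "nat set" and E :: "nat set set" assume V: "finite V"
      then have fin: "finite (large K V E)" by (simp add: large_def)
      have "card (anch V E) \<le> card ((large K V E \<inter> anchored E) \<union> small_anchored K V E)"
        using V by (intro card_mono) (auto simp: anch_def large_def small_anchored_def)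
      also have "\<dots> \<le> card (large K V E \<inter> anchored E) + card (small_anchored K V E)" by (rule card_Un_le)
      finally have "card (anch V E) \<le> card (large K V E \<inter> anchored E) + card (small_anchored K V E)" .
      moreover have "card (large K V E - anchored E) + card (large K V E \<inter> anchored E) = card (large K V E)"
        using fin by (subst card_Un_disjoint[symmetric]) (auto intro: arg_cong[where f = card])
      ultimately show "card (large K V E - anchored E) + card (anch V E) \<le> card (large K V E) + card (small_anchored K V E)"
        by linarith
    qed (use elim in simp)
    with elim show ?case by simp
  qed
  then show ?thesis by blast
qed

text \<open>A vertex that is not anchored either has a bounded cluster or belongs to the negligible
  part of the large clusters; these are the two cases of \<open>one_step_entangled\<close>.\<close>

lemma one_step_entangled_anchored:
  assumes "0 < \<epsilon>"
  shows "\<forall>\<^sub>F x in sparse m d. one_step (\<lambda>V D L. entangled (- anchored D) D L) x \<le> \<epsilon>"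
proof -
  define c where "c = (d * fact m + 1) + (d * fact m + 1) ^ 2"
  have "0 < d * fact m + 1" using d by (intro add_pos_pos mult_pos_pos) auto
  then have c: "0 < c" unfolding c_def by (rule add_pos_nonneg) simp
  have "0 < \<epsilon> / (2 * c)" using assms c by simp
  then obtain K where "\<forall>\<^sub>F x in sparse m d. mean (\<lambda>V E. large K V E - anchored E) x \<le> \<epsilon> / (2 * c)"
    using mean_large_not_anchored by blast
  then have "\<forall>\<^sub>F x in sparse m d. one_step (\<lambda>V D L. entangled (- anchored D) D L) x \<le> c * (\<epsilon> / (2 * c)) + \<epsilon> / 2"
    unfolding c_def using assms
    by (intro one_step_entangled[where B = "\<lambda>V E. large K V E - anchored E" and K = K and X = "\<lambda>V D. - anchored D"])
      (auto simp: large_def)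
  moreover have "c * (\<epsilon> / (2 * c)) + \<epsilon> / 2 = \<epsilon>" using c by simp
  ultimately show ?thesis by simp
qed

section \<open>Concentration of core degrees\<close>

definition core_degree :: "nat \<Rightarrow> nat set \<Rightarrow> nat set set \<Rightarrow> nat set" where
  "core_degree j V E = {v \<in> V. j \<le> edeg (core_edges E) v}"

text \<open>The probability that Z is at least j. Tails are used because link conditions must be
  monotone. The exception at j = 1 removes the event of no hit link and that of exactly one hit link
  containing just one anchored vertex.\<close>

definition core_tail :: "nat \<Rightarrow> real" where
  "core_tail j = (if j = 1 then 1 - (1 - \<rho>) * (1 + d * real m * \<rho> * (1 - \<rho>) ^ (m - 1))
     else poisson_tail (d * (1 - (1 - \<rho>) ^ m)) j)"

lemma anch_links:
  assumes "finite V" "E \<subseteq> rsets V (Suc m)" "v \<in> W" "l \<in> links E W v"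
  shows "l \<inter> anch (V - W) D = l \<inter> anchored D"
  using links_subset_rsets[OF assms(2,3,1)] assms(4) by (auto simp: anch_def rsets_def)

lemma mean_core_degree:
  assumes lim: "link_limit m d cond \<pi>" and \<epsilon>: "0 < \<epsilon>"
    and step: "\<And>V E v. finite V \<Longrightarrow> E \<subseteq> rsets V (Suc m) \<Longrightarrow> v \<in> core_degree j V E \<Longrightarrow>
      \<not> entangled (- anchored (avoid E {v})) (avoid E {v}) (links E {v} v) \<Longrightarrow>
      cond (anch (V - {v}) (avoid E {v})) (links E {v} v)"
  shows "\<forall>\<^sub>F x in sparse m d. mean (core_degree j) x \<le> \<pi> \<rho> + \<epsilon>"
proof -
  have e: "0 < \<epsilon> / 3" using \<epsilon> by simp
  obtain \<delta> where \<delta>: "0 < \<delta>" and up: "\<forall>\<^sub>F x in sparse m d. \<forall>A\<subseteq>fst x. real (card A) \<le> (\<rho> + \<delta>) * real (card (fst x)) \<longrightarrow>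
    measure_pmf.prob (random_subset (rsets (fst x) m) (snd x)) {L. cond A L} \<le> \<pi> \<rho> + \<epsilon> / 3"
    by (rule link_upper[OF lim rho_nonneg less_imp_le[OF rho_less] e])
  have "\<forall>\<^sub>F x in sparse m d. measure_pmf.prob (hypergraph_pmf m (fst x) (snd x))
      {E. (\<rho> + \<delta>) * real (card (fst x)) \<le> real (card (anch (fst x) E))} < \<epsilon> / 3"
    using rho_nonneg rho_less \<delta> e by (intro upper_tail_single lower_density_anch mean_anch) auto
  then have cond: "\<forall>\<^sub>F x in sparse m d. one_step (\<lambda>V D L. cond (anch V D) L) x \<le> \<pi> \<rho> + \<epsilon> / 3 + \<epsilon> / 3"
    using up finite_sparse
  proof eventually_elim
    case (elim x)
    let ?M = "hypergraph_pmf m (fst x) (snd x)"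
    let ?U = "{E. (\<rho> + \<delta>) * real (card (fst x)) \<le> real (card (anch (fst x) E))}"
    \<comment> \<open>On the exceptional event the bound is this quantity plus 1, which dominates a
      probability only if the quantity is nonnegative. The empty set A provides this.\<close>
    have nn: "0 \<le> \<pi> \<rho> + \<epsilon> / 3"
    proof -
      have "real (card {}) \<le> (\<rho> + \<delta>) * real (card (fst x))" using rho_nonneg \<delta> by simp
      with elim(2) have "measure_pmf.prob (random_subset (rsets (fst x) m) (snd x)) {L. cond {} L} \<le> \<pi> \<rho> + \<epsilon> / 3"
        by blast
      then show ?thesis using measure_nonneg order_trans by blast
    qed
    have "one_step (\<lambda>V D L. cond (anch V D) L) x \<le> measure_pmf.expectation ?M (\<lambda>D. \<pi> \<rho> + \<epsilon> / 3 + indicator ?U D)"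
      unfolding one_step_def
    proof (rule expectation_mono)
      fix D
      show "measure_pmf.prob (random_subset (rsets (fst x) m) (snd x)) {L. cond (anch (fst x) D) L} \<le> \<pi> \<rho> + \<epsilon> / 3 + indicator ?U D"
      proof (cases "D \<in> ?U")
        case True
        have "measure_pmf.prob (random_subset (rsets (fst x) m) (snd x)) {L. cond (anch (fst x) D) L} \<le> 1"
          by (rule measure_pmf.prob_le_1)
        moreover have "indicator ?U D = (1 :: real)" using True by simp
        ultimately show ?thesis using nn by linarith
      next
        case False
        then show ?thesis using elim(2) by (auto simp: anch_def)
      qed
    qed (use elim in simp)
    also have "\<dots> = \<pi> \<rho> + \<epsilon> / 3 + measure_pmf.prob ?M ?U" using elim by simp
    finally show ?case using elim(1) by simp
  qed
  have "\<forall>\<^sub>F x in sparse m d. one_step (\<lambda>V D L. cond (anch V D) L \<or> entangled (- anchored D) D L) x \<le> \<pi> \<rho> + \<epsilon>"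
    using cond one_step_entangled_anchored[OF e] finite_sparse
  proof eventually_elim
    case (elim x)
    have "one_step (\<lambda>V D L. cond (anch V D) L \<or> entangled (- anchored D) D L) x \<le>
      one_step (\<lambda>V D L. cond (anch V D) L) x + one_step (\<lambda>V D L. entangled (- anchored D) D L) x"
      using elim by (intro one_step_or) simp
    with elim show ?case by linarith
  qed
  then show ?thesis
    using step by (intro mean_le_one_step[where P = "\<lambda>V D L. cond (anch V D) L \<or> entangled (- anchored D) D L"])
      (auto simp: core_degree_def)
qed

lemma core_degree_density:
  assumes "1 \<le> j"
  shows "lower_density m d (core_degree j) (core_tail j)"
    and "0 < \<epsilon> \<Longrightarrow> \<forall>\<^sub>F x in sparse m d. mean (core_degree j) x \<le> core_tail j + \<epsilon>"
proof -
  have "lower_density m d (core_degree j) (core_tail j) \<and>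
    (\<forall>\<epsilon>>0. \<forall>\<^sub>F x in sparse m d. mean (core_degree j) x \<le> core_tail j + \<epsilon>)"
  proof (cases "j = 1")
    case True
    let ?\<pi> = "\<lambda>a. 1 - exp (- (d * (1 - (1 - a) ^ m))) * (1 + d * real m * a * (1 - a) ^ (m - 1))"
    have eq: "?\<pi> \<rho> = core_tail j" using True by (simp add: core_tail_def rho_exp)
    have "lower_density m d (core_degree j) (?\<pi> \<rho>)"
    proof (rule lower_density_transfer[OF lower_density_anch rho_nonneg _ _ link_limit_core_hit])
      fix V :: "nat set" and W v and E :: "nat set set"
      assume V: "finite V" and E: "E \<subseteq> rsets V (Suc m)" and W: "W \<subseteq> V" "v \<in> W"
        and hit: "2 \<le> card {l \<in> links E W v. l \<inter> anch (V - W) (avoid E W) \<noteq> {}} \<or>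
          (\<exists>l\<in>links E W v. finite l \<and> 2 \<le> card (l \<inter> anch (V - W) (avoid E W)))"
      note finE = rsets_edges(1)[OF V E]
      note al = anch_links[OF V E W(2)]
      have "1 \<le> edeg (core_edges E) v"
        using hit
      proof (elim disjE bexE conjE)
        assume "2 \<le> card {l \<in> links E W v. l \<inter> anch (V - W) (avoid E W) \<noteq> {}}"
        then have two: "2 \<le> card {l \<in> links E W v. l \<inter> anchored (avoid E W) \<noteq> {}}" using al by (simp cong: conj_cong)
        then show ?thesis using edeg_core_ge[OF finE two] by linarith
      next
        fix l assume l: "l \<in> links E W v" "finite l" "2 \<le> card (l \<inter> anch (V - W) (avoid E W))"
        then show ?thesis using edeg_core_ge1[OF finE l(1,2)] al[OF l(1)] by simp
      qed
      with True W show "v \<in> core_degree j V E" by (auto simp: core_degree_def)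
    qed (use rho_less m d in \<open>auto simp: anch_def core_degree_def\<close>)
    moreover have "\<forall>\<^sub>F x in sparse m d. mean (core_degree j) x \<le> ?\<pi> \<rho> + \<epsilon>" if "0 < \<epsilon>" for \<epsilon>
    proof (rule mean_core_degree[OF link_limit_core_hit that])
      fix V :: "nat set" and E v
      assume V: "finite V" and E: "E \<subseteq> rsets V (Suc m)" and v: "v \<in> core_degree j V E"
        and not: "\<not> entangled (- anchored (avoid E {v})) (avoid E {v}) (links E {v} v)"
      note finE = rsets_edges(1)[OF V E]
      have vV: "v \<in> V" "1 \<le> edeg (core_edges E) v" using v True by (auto simp: core_degree_def)
      note al = anch_links[OF V E, of v "{v}", OF singletonI]
      note lr = links_rsets[OF V E vV(1)]
      have "2 \<le> card {l \<in> links E {v} v. l \<inter> anchored (avoid E {v}) \<noteq> {}} \<or>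
        (\<exists>l\<in>links E {v} v. 2 \<le> card (l \<inter> anchored (avoid E {v})))"
        using lr by (intro edeg_core_ge1_cases[OF finE not vV(2)])
      then show "2 \<le> card {l \<in> links E {v} v. l \<inter> anch (V - {v}) (avoid E {v}) \<noteq> {}} \<or>
          (\<exists>l\<in>links E {v} v. finite l \<and> 2 \<le> card (l \<inter> anch (V - {v}) (avoid E {v})))"
        using al lr by (simp cong: conj_cong bex_cong)
    qed
    ultimately show ?thesis unfolding eq by blast
  next
    case False
    let ?\<pi> = "\<lambda>a. poisson_tail (d * (1 - (1 - a) ^ m)) j"
    have eq: "?\<pi> \<rho> = core_tail j" using False by (simp add: core_tail_def)
    have j: "2 \<le> j" using False assms by simp
    have "lower_density m d (core_degree j) (?\<pi> \<rho>)"
    proof (rule lower_density_transfer[OF lower_density_anch rho_nonneg _ _ link_limit_hits])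
      fix V :: "nat set" and W v and E :: "nat set set"
      assume V: "finite V" and E: "E \<subseteq> rsets V (Suc m)" and W: "W \<subseteq> V" "v \<in> W"
        and hit: "j \<le> card {l \<in> links E W v. l \<inter> anch (V - W) (avoid E W) \<noteq> {}}"
      note finE = rsets_edges(1)[OF V E]
      have ge: "j \<le> card {l \<in> links E W v. l \<inter> anchored (avoid E W) \<noteq> {}}"
        using hit anch_links[OF V E W(2)] by (simp cong: conj_cong)
      then have "j \<le> edeg (core_edges E) v" using edeg_core_ge[OF finE, of W v] j by linarith
      with W show "v \<in> core_degree j V E" by (auto simp: core_degree_def)
    qed (use rho_less m d in \<open>auto simp: anch_def core_degree_def\<close>)
    moreover have "\<forall>\<^sub>F x in sparse m d. mean (core_degree j) x \<le> ?\<pi> \<rho> + \<epsilon>" if "0 < \<epsilon>" for \<epsilon>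
    proof (rule mean_core_degree[OF link_limit_hits that])
      fix V :: "nat set" and E v
      assume V: "finite V" and E: "E \<subseteq> rsets V (Suc m)" and v: "v \<in> core_degree j V E"
        and not: "\<not> entangled (- anchored (avoid E {v})) (avoid E {v}) (links E {v} v)"
      have "j \<le> card {l \<in> links E {v} v. l \<inter> anchored (avoid E {v}) \<noteq> {}}"
        using edeg_core_le[OF rsets_edges(1)[OF V E] not] v by (simp add: core_degree_def)
      then show "j \<le> card {l \<in> links E {v} v. l \<inter> anch (V - {v}) (avoid E {v}) \<noteq> {}}"
        using anch_links[OF V E, of v "{v}"] by (simp cong: conj_cong)
    qed
    ultimately show ?thesis unfolding eq by blast
  qed
  then show "lower_density m d (core_degree j) (core_tail j)"
    and "0 < \<epsilon> \<Longrightarrow> \<forall>\<^sub>F x in sparse m d. mean (core_degree j) x \<le> core_tail j + \<epsilon>" by blast+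
qed

lemma core_degree_concentration:
  assumes j: "1 \<le> j" and q: "0 \<le> core_tail j" "core_tail j \<le> 1" and \<epsilon>: "0 < \<epsilon>" and \<eta>: "0 < \<eta>"
  shows "\<forall>\<^sub>F x in sparse m d. measure_pmf.prob (hypergraph_pmf m (fst x) (snd x))
    {E. \<epsilon> * real (card (fst x)) \<le> \<bar>real (card (core_degree j (fst x) E)) - core_tail j * real (card (fst x))\<bar>} < \<eta>"
proof -
  have e: "0 < \<epsilon> / 2" "0 < \<eta> / 2" using \<epsilon> \<eta> by auto
  have "\<forall>\<^sub>F x in sparse m d. measure_pmf.prob (hypergraph_pmf m (fst x) (snd x))
    {E. (core_tail j + \<epsilon>) * real (card (fst x)) \<le> real (card (core_degree j (fst x) E))} < \<eta> / 2"
    using e \<epsilon> by (intro upper_tail_single core_degree_density j q) auto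
  with lower_densityD[OF core_degree_density(1)[OF j] e] show ?thesis
    using finite_sparse
  proof eventually_elim
    case (elim x)
    let ?N = "real (card (fst x))" and ?M = "hypergraph_pmf m (fst x) (snd x)"
    let ?c = "\<lambda>E. real (card (core_degree j (fst x) E))"
    have "measure_pmf.prob ?M {E. \<epsilon> * ?N \<le> \<bar>?c E - core_tail j * ?N\<bar>} \<le>
        measure_pmf.prob ?M {E. ?c E < (core_tail j - \<epsilon> / 2) * ?N \<or> (core_tail j + \<epsilon>) * ?N \<le> ?c E}"
    proof (rule prob_mono, rule CollectI)
      fix E assume "E \<in> {E. \<epsilon> * ?N \<le> \<bar>?c E - core_tail j * ?N\<bar>}"
      moreover have "0 < \<epsilon> * ?N" using \<epsilon> elim by simp
      ultimately show "?c E < (core_tail j - \<epsilon> / 2) * ?N \<or> (core_tail j + \<epsilon>) * ?N \<le> ?c E"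
        by (simp add: algebra_simps) linarith
    qed
    also have "\<dots> \<le> measure_pmf.prob ?M {E. ?c E < (core_tail j - \<epsilon> / 2) * ?N} + measure_pmf.prob ?M {E. (core_tail j + \<epsilon>) * ?N \<le> ?c E}"
      by (rule prob_Un_le)
    also have "\<dots> < \<eta>" using elim by simp
    finally show ?case .
  qed
qed

end

section \<open>Degrees in the loose core\<close>

lemma pmf_Po: "0 \<le> c \<Longrightarrow> pmf (Po c) k = c ^ k / fact k * exp (- c)"
  by (auto simp: Po_def power_0_left indicator_def)

lemma pmf_Ber:
  assumes "0 \<le> q" "q \<le> 1"
  shows "pmf (Ber q) j = (if j = 0 then 1 - q else if j = 1 then q else 0)"
proof -
  have "pmf (Ber q) j = measure_pmf.prob (bernoulli_pmf q) (of_bool -` {j})"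
    by (simp add: Ber_def pmf_map)
  also have "of_bool -` {j} = (if j = 0 then {False} else if j = 1 then {True} else {})"
  proof (rule set_eqI)
    fix b show "b \<in> of_bool -` {j} \<longleftrightarrow> b \<in> (if j = 0 then {False} else if j = 1 then {True} else {})"
      by (cases b) auto
  qed
  finally show ?thesis using assms by (simp add: measure_pmf_single)
qed

lemma pmf_Z:
  "pmf (Z_pmf r d) j = (if j = 1 then 0 else pmf (Po (d * rho_hat r d)) j)
     + pmf (Po (d * rho_hat r d)) 1 * pmf (Ber (eta r d)) j"
proof -
  let ?Y = "Po (d * rho_hat r d)" and ?q = "pmf (Ber (eta r d)) j"
  have int: "integrable (measure_pmf ?Y) (indicator A :: nat \<Rightarrow> real)" for A
    by (rule measure_pmf.integrable_const_bound[where B = 1]) auto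
  have "pmf (Z_pmf r d) j = measure_pmf.expectation ?Y (\<lambda>y. pmf (if y \<noteq> 1 then return_pmf y else Ber (eta r d)) j)"
    by (simp add: Z_pmf_def pmf_bind)
  also have "\<dots> = measure_pmf.expectation ?Y (\<lambda>y. indicator ({j} - {1}) y + indicator {1} y * ?q)"
    by (intro Bochner_Integration.integral_cong refl) (auto simp: indicator_def)
  also have "\<dots> = measure_pmf.prob ?Y ({j} - {1}) + measure_pmf.prob ?Y {1} * ?q"
    using int by simp
  also have "measure_pmf.prob ?Y ({j} - {1}) = (if j = 1 then 0 else pmf ?Y j)"
    by (simp add: measure_pmf_single)
  finally show ?thesis by (simp add: measure_pmf_single)
qed

context fixpoint
begin

text \<open>With l the rate of hit links and l1 the rate of links with exactly one anchored vertex,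
  \<eta> is the conditional chance that a hit link contains at least two. It redistributes the mass
  at Y = 1 between 0 and 1 as the exceptional value of \<open>core_tail 1\<close> demands.\<close>

lemma pmf_Z_eq_core_tail: "pmf (Z_pmf (Suc m) d) j = core_tail j - core_tail (Suc j)"
proof -
  define x l l1 where "x = 1 - \<rho>" and "l = d * (1 - x ^ m)" and "l1 = d * real m * \<rho> * x ^ (m - 1)"
  have x: "0 < x" "x \<le> 1" using rho_less rho_nonneg by (auto simp: x_def)
  have l0: "0 \<le> l" unfolding l_def x_def using rho_nonneg rho_less by (intro rate_nonneg) auto
  have ex: "exp (- l) = x" using rho_exp by (simp add: l_def x_def)
  have hat: "d * rho_hat (Suc m) d = l" by (simp add: rho_hat_def l_def x_def \<rho>_def)
  have hat': "rho_hat (Suc m) d = 1 - x ^ m" by (simp add: rho_hat_def x_def \<rho>_def)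
  have Po: "pmf (Po l) k = l ^ k / fact k * x" for k using pmf_Po[OF l0] ex by simp
  have "pmf (Po l) 1 * pmf (Ber (eta (Suc m) d)) j = (if j = 0 then l1 * x else if j = 1 then (l - l1) * x else 0)"
  \<comment> \<open>For \<rho> = 0 the rate l is 0 and the mass at Y = 1 vanishes, so the quotient
    by zero in \<open>eta\<close> has no influence.\<close>
  proof (cases "\<rho> = 0")
    case True
    then have "l = 0" "l1 = 0" by (auto simp: l_def x_def l1_def)
    then show ?thesis using Po[of 1] by simp
  next
    case False
    then have "x < 1" using rho_nonneg by (simp add: x_def)
    then have pos: "0 < 1 - x ^ m" using x m by (simp add: power_Suc_less_one power_less_one_iff)
    have eta: "eta (Suc m) d = 1 - real m * \<rho> * x ^ (m - 1) / (1 - x ^ m)"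
      using m by (simp add: eta_def hat' x_def \<rho>_def numeral_2_eq_2)
    \<comment> \<open>The tangent at x evaluated at 1; it says that \<eta> is nonnegative.\<close>
    have "x ^ m + real m * x ^ (m - 1) * (1 - x) \<le> 1 ^ m" using x by (intro power_tangent) auto
    then have le: "real m * \<rho> * x ^ (m - 1) \<le> 1 - x ^ m" by (simp add: x_def algebra_simps)
    have "0 \<le> real m * \<rho> * x ^ (m - 1)" using x rho_nonneg by simp
    then have bounds: "0 \<le> eta (Suc m) d" "eta (Suc m) d \<le> 1"
      unfolding eta using le pos by (auto simp: divide_le_eq_1)
    \<comment> \<open>Thinning: hit links with a single anchored vertex have rate l (1 -
      \<eta>).\<close>
    have "l * (1 - eta (Suc m) d) = l1" unfolding eta l_def l1_def using pos by simp
    then have "l * eta (Suc m) d = l - l1" by (simp add: algebra_simps)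
    then show ?thesis
      using Po[of 1] \<open>l * (1 - eta (Suc m) d) = l1\<close> unfolding pmf_Ber[OF bounds] by (simp add: mult_ac)
  qed
  then have Z: "pmf (Z_pmf (Suc m) d) j = (if j = 1 then 0 else l ^ j / fact j * x)
      + (if j = 0 then l1 * x else if j = 1 then (l - l1) * x else 0)"
    unfolding pmf_Z hat Po by simp
  have tail: "core_tail i = (if i = 1 then 1 - x * (1 + l1) else poisson_tail l i)" for i
    by (simp add: core_tail_def x_def l_def l1_def)
  consider "j = 0" | "j = 1" | "2 \<le> j" by linarith
  then show ?thesis
  proof cases
    case 1
    then show ?thesis unfolding Z tail by (simp add: algebra_simps)
  next
    case 2
    have "poisson_tail l 2 = 1 - x - l * x"
      by (simp add: poisson_tail_def numeral_2_eq_2 ex)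
    then show ?thesis using 2 unfolding Z tail by (simp add: algebra_simps numeral_2_eq_2)
  next
    case 3
    then show ?thesis unfolding Z tail by (simp add: poisson_tail_Suc ex)
  qed
qed

lemma core_tail_bounds: "0 \<le> core_tail j" "core_tail j \<le> 1"
proof -
  have l0: "0 \<le> d * (1 - (1 - \<rho>) ^ m)" using rho_nonneg rho_less by (intro rate_nonneg) auto
  have "core_tail 0 = 1" by (simp add: core_tail_def)
  then have 1: "core_tail 1 = 1 - pmf (Z_pmf (Suc m) d) 0" using pmf_Z_eq_core_tail[of 0] by simp
  show "0 \<le> core_tail j"
    using 1 pmf_le_1 poisson_tail_nonneg[OF l0] by (cases "j = 1") (auto simp: core_tail_def)
  show "core_tail j \<le> 1"
    using 1 pmf_nonneg poisson_tail_le_1[OF l0] by (cases "j = 1") (auto simp: core_tail_def)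
qed

lemma core_degree_concentration_all:
  assumes \<epsilon>: "0 < \<epsilon>" and \<eta>: "0 < \<eta>"
  shows "\<forall>\<^sub>F x in sparse m d. measure_pmf.prob (hypergraph_pmf m (fst x) (snd x))
    {E. \<epsilon> * real (card (fst x)) \<le> \<bar>real (card (core_degree j (fst x) E)) - core_tail j * real (card (fst x))\<bar>} < \<eta>"
proof (cases "1 \<le> j")
  case True
  then show ?thesis using core_degree_concentration core_tail_bounds assms by blast
next
  case False
  then have j: "j = 0" by simp
  have "core_degree j V E = V" for V E by (auto simp: j core_degree_def)
  moreover have "core_tail j = 1" by (simp add: j core_tail_def)
  ultimately have eq: "{E. \<epsilon> * real (card V) \<le> \<bar>real (card (core_degree j V E)) - core_tail j * real (card V)\<bar>} = {}"
    if "0 < card V" for V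
    using that \<epsilon> by (auto simp: not_le)
  show ?thesis
    using finite_sparse by eventually_elim (use \<eta> in \<open>simp add: eq\<close>)
qed

text \<open>The edge probability is normalized by n - 1 choose m, the filter by n choose m. Their
  quotient is (n - m) / n and tends to 1.\<close>

lemma filterlim_sparse_interval:
  assumes dn: "dn \<longlonglongrightarrow> d" and p: "\<And>n. p n = dn n / real ((n - 1) choose m)"
  shows "filterlim (\<lambda>n. ({1..n}, p n)) (sparse m d) sequentially"
proof -
  have "(\<lambda>n. real m * inverse (real n)) \<longlonglongrightarrow> real m * 0"
    by (intro tendsto_intros lim_inverse_n)
  then have "(\<lambda>n. dn n / (1 - real m * inverse (real n))) \<longlonglongrightarrow> d / (1 - real m * 0)"
    by (intro tendsto_divide tendsto_diff tendsto_const dn) auto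
  then have "(\<lambda>n. dn n / (1 - real m * inverse (real n))) \<longlonglongrightarrow> d" by simp
  moreover have "\<forall>\<^sub>F n in sequentially. dn n / (1 - real m * inverse (real n)) = p n * real (n choose m)"
    using eventually_gt_at_top[of m]
  proof eventually_elim
    case (elim n)
    have "real (n - m) * real (n choose m) = real n * real ((n - 1) choose m)"
      using binomial_absorb_comp[of n m] by (metis of_nat_mult)
    then have "(real n - real m) * real (n choose m) = real n * real ((n - 1) choose m)"
      using elim by (simp add: of_nat_diff)
    moreover have "0 < (n - 1) choose m" using elim by simp
    moreover have "1 - real m * inverse (real n) = (real n - real m) / real n" using elim by (simp add: field_simps)
    ultimately show ?case using elim by (simp add: p field_simps)
  qed
  ultimately have "(\<lambda>n. p n * real (n choose m)) \<longlonglongrightarrow> d" by (rule Lim_transform_eventually)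
  then show ?thesis
    unfolding sparse_def filterlim_inf filterlim_filtercomap_iff by (simp add: o_def filterlim_ident)
qed

lemma core_degree_proportion_eq:
  assumes V: "finite V" and E: "E \<subseteq> rsets V (Suc m)"
  shows "core_degree_proportion \<lparr>verts = V, edges = E\<rparr> j =
    (real (card (core_degree j V E)) - real (card (core_degree (Suc j) V E))) / real (card V)"
proof -
  let ?V = V and ?C = "core_edges E"
  have fin: "finite E" using rsets_edges(1)[OF V E] .
  have core: "loose_core \<lparr>verts = ?V, edges = E\<rparr> = \<lparr>verts = \<Union>?C, edges = ?C\<rparr>"
    using V fin E by (subst loose_core_eq) (auto simp: rsets_def)
  have deg: "vertex_degree \<lparr>verts = \<Union>?C, edges = ?C\<rparr> v = edeg ?C v" for v
    by (simp add: vertex_degree_def edeg_def)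
  have "1 \<le> edeg ?C v \<longleftrightarrow> v \<in> \<Union>?C" for v
    by (rule edeg_ge1_iff[OF finite_subset[OF core_edges_subset fin]])
  \<comment> \<open>Vertices outside the core are exactly those of core degree 0, so j = 0 becomes
    an instance of the general count.\<close>
  then have vert: "v \<in> \<Union>?C \<longleftrightarrow> edeg ?C v \<noteq> 0" for v by (metis less_one not_le)
  have "core_degree_proportion \<lparr>verts = ?V, edges = E\<rparr> j = real (card {v \<in> ?V. edeg ?C v = j}) / real (card V)"
  proof (cases "j = 0")
    case True
    then have "{v \<in> ?V. v \<notin> \<Union>?C} = {v \<in> ?V. edeg ?C v = j}" using vert by blast
    then show ?thesis using True by (simp add: core_degree_proportion_def core)
  next
    case False
    then have "{v \<in> ?V. v \<in> \<Union>?C \<and> edeg ?C v = j} = {v \<in> ?V. edeg ?C v = j}" using vert by blast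
    then show ?thesis using False by (simp add: core_degree_proportion_def core deg)
  qed
  moreover have "{v \<in> ?V. edeg ?C v = j} = core_degree j ?V E - core_degree (Suc j) ?V E"
    by (auto simp: core_degree_def)
  moreover have "core_degree (Suc j) ?V E \<subseteq> core_degree j ?V E" "finite (core_degree j ?V E)"
    using V by (auto simp: core_degree_def)
  then have "card (core_degree j ?V E - core_degree (Suc j) ?V E) = card (core_degree j ?V E) - card (core_degree (Suc j) ?V E)"
    "card (core_degree (Suc j) ?V E) \<le> card (core_degree j ?V E)"
    by (auto intro: card_Diff_subset card_mono finite_subset)
  ultimately show ?thesis by (simp add: of_nat_diff)
qed

lemma random_hypergraph_eq:
  "random_hypergraph (Suc m) n p = map_pmf (\<lambda>E. \<lparr>verts = {1..n}, edges = E\<rparr>) (hypergraph_pmf m {1..n} p)"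
  by (simp add: random_hypergraph_def random_subset_def map_pmf_comp rsets_def)

lemma core_degree_proportion_tendsto:
  assumes dn: "dn \<longlonglongrightarrow> d" and p: "\<And>n. p n = dn n / real ((n - 1) choose m)" and \<epsilon>: "0 < \<epsilon>"
  shows "(\<lambda>n. measure_pmf.prob (random_hypergraph (Suc m) n (p n))
    {H. \<bar>core_degree_proportion H j - pmf (Z_pmf (Suc m) d) j\<bar> \<le> \<epsilon>}) \<longlonglongrightarrow> 1"
proof (rule order_tendstoI)
  fix y :: real assume "1 < y"
  then show "\<forall>\<^sub>F n in sequentially. measure_pmf.prob (random_hypergraph (Suc m) n (p n))
      {H. \<bar>core_degree_proportion H j - pmf (Z_pmf (Suc m) d) j\<bar> \<le> \<epsilon>} < y"
    using measure_pmf.prob_le_1 by (intro always_eventually allI) (rule le_less_trans)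
next
  fix y :: real assume y: "y < 1"
  have pos: "0 < \<epsilon> / 2" "0 < (1 - y) / 2" using \<epsilon> y by auto
  let ?bad = "\<lambda>i V E. \<epsilon> / 2 * real (card V) \<le> \<bar>real (card (core_degree i V E)) - core_tail i * real (card V)\<bar>"
  have conc: "\<forall>\<^sub>F n in sequentially. measure_pmf.prob (hypergraph_pmf m {1..n} (p n)) {E. ?bad i {1..n} E} < (1 - y) / 2" for i
    using eventually_compose_filterlim[OF core_degree_concentration_all[OF pos] filterlim_sparse_interval[OF dn p]] by simp
  show "\<forall>\<^sub>F n in sequentially. y < measure_pmf.prob (random_hypergraph (Suc m) n (p n))
      {H. \<bar>core_degree_proportion H j - pmf (Z_pmf (Suc m) d) j\<bar> \<le> \<epsilon>}"
    using conc[of j] conc[of "Suc j"] eventually_gt_at_top[of 0]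
  proof eventually_elim
    case (elim n)
    define V where "V = {1..n}"
    have V: "finite V" "card V = n" by (auto simp: V_def)
    let ?M = "hypergraph_pmf m V (p n)"
    let ?P = "\<lambda>E. \<bar>core_degree_proportion \<lparr>verts = V, edges = E\<rparr> j - pmf (Z_pmf (Suc m) d) j\<bar> \<le> \<epsilon>"
    have "measure_pmf.prob ?M {E. \<not> ?P E} \<le> measure_pmf.prob ?M {E. ?bad j V E \<or> ?bad (Suc j) V E}"
    proof (rule prob_mono, rule CollectI, rule ccontr)
      fix E assume "E \<in> set_pmf ?M" and "E \<in> {E. \<not> ?P E}"
        and "\<not> (?bad j V E \<or> ?bad (Suc j) V E)"
      then have not: "\<not> ?P E"
        and 1: "\<bar>real (card (core_degree j V E)) - core_tail j * real n\<bar> < \<epsilon> / 2 * real n"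
        and 2: "\<bar>real (card (core_degree (Suc j) V E)) - core_tail (Suc j) * real n\<bar> < \<epsilon> / 2 * real n" by (auto simp: V(2))
      have E: "E \<subseteq> rsets V (Suc m)" using \<open>E \<in> set_pmf ?M\<close> by (rule random_subsetD)
      have "core_degree_proportion \<lparr>verts = V, edges = E\<rparr> j - pmf (Z_pmf (Suc m) d) j =
        ((real (card (core_degree j V E)) - core_tail j * real n) -
          (real (card (core_degree (Suc j) V E)) - core_tail (Suc j) * real n)) / real n"
        using elim(3) by (simp add: core_degree_proportion_eq[OF V(1) E] V(2) pmf_Z_eq_core_tail field_simps)
      also have "\<bar>\<dots>\<bar> \<le> \<epsilon>"
      proof -
        have "\<bar>(real (card (core_degree j V E)) - core_tail j * real n) -
          (real (card (core_degree (Suc j) V E)) - core_tail (Suc j) * real n)\<bar> \<le> \<epsilon> * real n"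
          using 1 2 by linarith
        then show ?thesis using elim(3) by (simp add: divide_le_eq)
      qed
      finally show False using not by simp
    qed
    also have "\<dots> \<le> measure_pmf.prob ?M {E. ?bad j V E} + measure_pmf.prob ?M {E. ?bad (Suc j) V E}"
      by (rule prob_Un_le)
    also have "\<dots> < 1 - y" using add_strict_mono[OF elim(1,2)] unfolding V_def[symmetric] by (simp only: field_sum_of_halves)
    finally have "y < measure_pmf.prob ?M {E. ?P E}" by (simp add: prob_Not)
    then show ?case by (simp add: random_hypergraph_eq vimage_def V_def)
  qed
qed

end

text \<open>One error sequence must serve every j. At level k the first k indices are required to
  succeed with error and failure probability both below 1/(k + 1), and the level is raised with n
  only as far as this is true.\<close>

lemma diagonal_error:
  fixes P :: "nat \<Rightarrow> nat \<Rightarrow> real \<Rightarrow> real"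
  assumes lim: "\<And>j \<epsilon>. 0 < \<epsilon> \<Longrightarrow> (\<lambda>n. P n j \<epsilon>) \<longlonglongrightarrow> 1" and le: "\<And>n j \<epsilon>. P n j \<epsilon> \<le> 1"
  shows "\<exists>\<epsilon>. \<epsilon> \<longlonglongrightarrow> 0 \<and> (\<forall>j. (\<lambda>n. P n j (\<epsilon> n)) \<longlonglongrightarrow> 1)"
proof -
  define e where "e k = inverse (real (Suc k))" for k
  define good where "good k n \<longleftrightarrow> (\<forall>j\<le>k. 1 - e k < P n j (e k))" for k n
  \<comment> \<open>The bound k \<le> n keeps the set finite, and the inserted 0 keeps it nonempty
    when no level is good yet.\<close>
  define K where "K n = Max (insert 0 {k. k \<le> n \<and> good k n})" for n
  have fin: "finite (insert 0 {k. k \<le> n \<and> good k n})" for n by auto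
  have K: "K n = 0 \<or> good (K n) n" for n
    using Max_in[OF fin, of n] by (auto simp: K_def)
  have ev: "\<forall>\<^sub>F n in sequentially. good k n" for k
  proof -
    have "\<forall>\<^sub>F n in sequentially. \<forall>j\<in>{..k}. 1 - e k < P n j (e k)"
    proof (rule eventually_ball_finite)
      have "0 < e k" by (simp add: e_def)
      then show "\<forall>j\<in>{..k}. \<forall>\<^sub>F n in sequentially. 1 - e k < P n j (e k)"
        by (intro ballI order_tendstoD(1)[OF lim]) auto
    qed simp
    then show ?thesis by (rule eventually_mono) (auto simp: good_def)
  qed
  have "\<forall>\<^sub>F n in sequentially. k \<le> K n" for k
    using ev[of k] eventually_ge_at_top[of k]
  proof eventually_elim
    case (elim n)
    then show ?case unfolding K_def using fin by (intro Max_ge) auto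
  qed
  then have Kinf: "filterlim K at_top sequentially" by (simp add: filterlim_at_top)
  have e0: "e \<longlonglongrightarrow> 0" unfolding e_def by (rule LIMSEQ_inverse_real_of_nat)
  have eK: "(\<lambda>n. e (K n)) \<longlonglongrightarrow> 0" by (rule filterlim_compose[OF e0 Kinf])
  have "(\<lambda>n. P n j (e (K n))) \<longlonglongrightarrow> 1" for j
  proof (rule tendsto_sandwich)
    have "\<forall>\<^sub>F n in sequentially. Suc j \<le> K n" using Kinf unfolding filterlim_at_top by blast
    then show "\<forall>\<^sub>F n in sequentially. 1 - e (K n) \<le> P n j (e (K n))"
    proof eventually_elim
      case (elim n)
      then have "good (K n) n" "j \<le> K n" using K[of n] by auto
      then show ?case unfolding good_def by (meson less_imp_le)
    qed
    show "\<forall>\<^sub>F n in sequentially. P n j (e (K n)) \<le> 1" using le by simp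
    show "(\<lambda>n. 1 - e (K n)) \<longlonglongrightarrow> 1" using tendsto_diff[OF tendsto_const eK, of 1] by simp
  qed simp
  with eK show ?thesis by (intro exI[of _ "\<lambda>n. e (K n)"]) simp
qed

theorem theorem1p4:
  fixes r :: nat and d :: real and dn :: "nat \<Rightarrow> real" and p :: "nat \<Rightarrow> real"
  assumes "r \<ge> 3" and "d > 0"
    and "dn \<longlonglongrightarrow> d"
    and "\<And>n. p n = dn n / real ((n - 1) choose (r - 1))"
  shows "\<exists>\<epsilon> :: nat \<Rightarrow> real. \<epsilon> \<longlonglongrightarrow> 0 \<and>
    (\<forall>j. (\<lambda>n. measure_pmf.prob (random_hypergraph r n (p n))
              {H. pmf (Z_pmf r d) j - \<epsilon> n \<le> core_degree_proportion H j \<and>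
                  core_degree_proportion H j \<le> pmf (Z_pmf r d) j + \<epsilon> n}) \<longlonglongrightarrow> 1)"
proof -
  interpret fixpoint "r - 1" d using assms by unfold_locales auto
  have r: "Suc (r - 1) = r" using assms(1) by simp
  have "pmf (Z_pmf r d) j - \<epsilon> \<le> c \<and> c \<le> pmf (Z_pmf r d) j + \<epsilon> \<longleftrightarrow> \<bar>c - pmf (Z_pmf r d) j\<bar> \<le> \<epsilon>" for j c \<epsilon>
    by linarith
  then show ?thesis
    using diagonal_error[of "\<lambda>n j \<epsilon>. measure_pmf.prob (random_hypergraph r n (p n))
        {H. \<bar>core_degree_proportion H j - pmf (Z_pmf r d) j\<bar> \<le> \<epsilon>}"]
      core_degree_proportion_tendsto[OF assms(3,4), unfolded r] by simp
qed

end
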